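(* Let $\alpha\in(0,1/2]$ and $f_0(x)=\frac1{2\pi\alpha}\mathbf 1_{[-\pi\alpha,\pi\alpha]}(x)$ on $\mathbb R/2\pi\mathbb Z$ (represented by $[-\pi,\pi]$). Put $\omega_\alpha=e^{i\pi\alpha}$, and let $w(t,\cdot):\mathbb D\to V_t$ be the conformal map associated with $f_0$ (see context). For every $t>0$, the map $w(t,\cdot)$ extends continuously to $\partial\mathbb D$, and the image of $\partial\mathbb D$ is a piecewise analytic Jordan curve $\partial V_t\subset\overline{\mathbb D}\setminus\{\omega_\alpha,\overline{\omega_\alpha}\}$. The density defined by $$f(t,x)=\frac{1+2\operatorname{Re}g_0(w(t,e^{ix}))}{2\pi}$$ is continuous on $(0,\infty)\times\mathbb R/2\pi\mathbb Z$. Moreover, set $$t_\ast=\frac{1-\cos(\pi\alpha)}{2\pi^2},\qquad t^\ast=\frac{1+\cos(\pi\alpha)}{2\pi^2},$$ so that $0<t_\ast\le t^\ast$, with $t_\ast<t^\ast$ if $\alpha\neq1/2$ and $t_\ast=t^\ast$ otherwise. There exist smooth functions $\phi_1:(0,t_\ast)\to(0,\pi\alpha)$ and $\phi_2:(0,t^\ast)\to(\pi\alpha,\pi)$ such that $\phi_1$ decreases from $\pi\alpha$ to $0$ and $\phi_2$ increases from $\pi\alpha$ to $\pi$ (extended by continuity by $\phi_1(t_\ast)=0$ and $\phi_2(t^\ast)=\pi$), and such that, for $x\in[-\pi,\pi]$: 1. For all $t\in(0,t_\ast]$, one has $f(t,x)=\frac1{2\pi\alpha}$ if $x\in[-\phi_1(t),\phi_1(t)]$,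 $f(t,x)=0$ if $x\notin(-\phi_2(t),\phi_2(t))$, and $0<f(t,x)<\frac1{2\pi\alpha}$ elsewhere, while $f(t,x)$ is analytic except along the curves $(t,\pm\phi_1(t))$ and $(t,\pm\phi_2(t))$. 2. For all $t\in(t_\ast,t^\ast]$, one has $f(t,x)=0$ if $x\notin(-\phi_2(t),\phi_2(t))$ and $0<f(t,x)<\frac1{2\pi\alpha}$ elsewhere, while $f(t,x)$ is analytic except along the curves $(t,\pm\phi_2(t))$. 3. For all $t\in(t^\ast,\infty)$, one has $0<f(t,x)<\frac1{2\pi\alpha}$ and $f(t,x)$ is analytic.
   Context: $\mathbb D$ is the open unit disk. For the initial density $f_0(x)=\frac1{2\pi\alpha}\mathbf 1_{[-\pi\alpha,\pi\alpha]}(x)$ on $\mathbb R/2\pi\mathbb Z$ (represented by $[-\pi,\pi]$), with $\alpha\in(0,1/2]$ and $\omega_\alpha=e^{i\pi\alpha}$, the moment generating function $g_0(z)=\sum_{n\ge1}z^n\int_{-\pi}^{\pi}e^{inx}f_0(x)\,dx$ equals $$g_0(z)=\frac1{2i\pi\alpha}\log\left(\frac{1-z\overline{\omega_\alpha}}{1-z\,\omega_\alpha}\right),$$ where the logarithm is understood as $\log(1-z\overline{\omega_\alpha})-\log(1-z\omega_\alpha)$ with principal branches, so that $g_0$ extends continuously to $\overline{\mathbb D}\setminus\{\omega_\alpha,\overline{\omega_\alpha}\}$. Set $$A_0(w)=2\pi^2\,\frac{\sin(\pi\alpha(1+2g_0(w)))}{\sin(\pi\alpha)}=2\pi^2\frac{(1-w)(1+w)}{(w-\omega_\alpha)(w-\overline{\omega_\alpha})},\qquad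 \Phi_t(w)=w\,e^{tA_0(w)}.$$ For every $t\ge0$ and $z\in\mathbb D$ there is a unique $w(t,z)\in\mathbb D$ with $\Phi_t(w(t,z))=z$; the map $w(t,\cdot)$ is a biholomorphism from $\mathbb D$ onto the open set $V_t=\Phi_t^{-1}(\mathbb D)\cap\mathbb D$. The function $f(t,\cdot)$ is the hydrodynamic-limit density, at time $t$, of the maximal entropy symmetric exclusion process with initial profile $f_0$. *)

theory Defs
  imports "HOL-Analysis.Analysis"
begin

text \<open>Functions on \<open>\<real>/2\<pi>\<int>\<close> are represented by their restriction to \<open>[-\<pi>, \<pi>]\<close>.\<close>

definition f0 :: "real \<Rightarrow> real \<Rightarrow> real" where
  "f0 \<alpha> x = indicat_real {- (pi * \<alpha>)..pi * \<alpha>} x / (2 * pi * \<alpha>)"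

definition mom_gen :: "(real \<Rightarrow> real) \<Rightarrow> complex \<Rightarrow> complex" where
  "mom_gen h z = (\<Sum>n. z ^ Suc n *
     integral {-pi..pi} (\<lambda>x. exp (\<i> * of_nat (Suc n) * complex_of_real x) * complex_of_real (h x)))"

text \<open>Extension of a function on the open unit disk by taking limits from inside the disk. It agrees
  with \<open>h\<close> on the open disk when \<open>h\<close> is continuous there; at boundary points where \<open>h\<close> has no limit
  (such as \<open>\<omega> \<alpha>\<close> and its conjugate, for \<open>g0 \<alpha>\<close> below) its value carries no information.\<close>

definition disk_ext :: "(complex \<Rightarrow> complex) \<Rightarrow> complex \<Rightarrow> complex" where
  "disk_ext h z = Lim (at z within ball 0 1) h"

definition \<omega> :: "real \<Rightarrow> complex" where
  "\<omega> \<alpha> = exp (\<i> * complex_of_real (pi * \<alpha>))"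

text \<open>The value of \<open>g0 \<alpha>\<close> on the closed disk without \<open>\<omega> \<alpha>\<close> and its conjugate is
  \<open>(Ln (1 - z * cnj (\<omega> \<alpha>)) - Ln (1 - z * \<omega> \<alpha>)) / (2 * \<i> * pi * \<alpha>)\<close>.\<close>

definition g0 :: "real \<Rightarrow> complex \<Rightarrow> complex" where
  "g0 \<alpha> = disk_ext (mom_gen (f0 \<alpha>))"

definition A0 :: "real \<Rightarrow> complex \<Rightarrow> complex" where
  "A0 \<alpha> w = 2 * (complex_of_real pi)\<^sup>2 *
     sin (complex_of_real (pi * \<alpha>) * (1 + 2 * g0 \<alpha> w)) / sin (complex_of_real (pi * \<alpha>))"

definition \<Phi> :: "real \<Rightarrow> real \<Rightarrow> complex \<Rightarrow> complex" where
  "\<Phi> \<alpha> t w = w * exp (complex_of_real t * A0 \<alpha> w)"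

definition V :: "real \<Rightarrow> real \<Rightarrow> complex set" where
  "V \<alpha> t = {w \<in> ball 0 1. \<Phi> \<alpha> t w \<in> ball 0 1}"

text \<open>For \<open>z\<close> in the open disk and \<open>t \<ge> 0\<close>, the point described here exists and is unique.\<close>

definition w :: "real \<Rightarrow> real \<Rightarrow> complex \<Rightarrow> complex" where
  "w \<alpha> t z = (THE u. u \<in> ball 0 1 \<and> \<Phi> \<alpha> t u = z)"

definition w_ext :: "real \<Rightarrow> real \<Rightarrow> complex \<Rightarrow> complex" where
  "w_ext \<alpha> t = disk_ext (w \<alpha> t)"

text \<open>The density, as a \<open>2\<pi>\<close>-periodic function of \<open>x\<close> in \<open>\<real>\<close>.\<close>

definition f_density :: "real \<Rightarrow> real \<Rightarrow> real \<Rightarrow> real" where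
  "f_density \<alpha> t x = (1 + 2 * Re (g0 \<alpha> (w_ext \<alpha> t (exp (\<i> * complex_of_real x))))) / (2 * pi)"

definition t_low :: "real \<Rightarrow> real" where
  "t_low \<alpha> = (1 - cos (pi * \<alpha>)) / (2 * pi\<^sup>2)"

definition t_up :: "real \<Rightarrow> real" where
  "t_up \<alpha> = (1 + cos (pi * \<alpha>)) / (2 * pi\<^sup>2)"

text \<open>A regular analytic parametrisation on a compact interval, analytic up to and including
  the endpoints.\<close>

definition analytic_arc_on :: "(real \<Rightarrow> complex) \<Rightarrow> real \<Rightarrow> real \<Rightarrow> bool" where
  "analytic_arc_on \<gamma> a b \<longleftrightarrow>
     (\<exists>h. h analytic_on (complex_of_real ` {a..b}) \<and>
          (\<forall>s\<in>{a..b}. \<gamma> s = h (complex_of_real s) \<and> deriv h (complex_of_real s) \<noteq> 0))"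

definition piecewise_analytic_path :: "(real \<Rightarrow> complex) \<Rightarrow> bool" where
  "piecewise_analytic_path \<gamma> \<longleftrightarrow>
     (\<exists>n. \<exists>s :: nat \<Rightarrow> real. s 0 = 0 \<and> s n = 1 \<and>
        (\<forall>i<n. s i < s (Suc i) \<and> analytic_arc_on \<gamma> (s i) (s (Suc i))))"

definition piecewise_analytic_Jordan_curve :: "complex set \<Rightarrow> bool" where
  "piecewise_analytic_Jordan_curve C \<longleftrightarrow>
     (\<exists>\<gamma>. simple_path \<gamma> \<and> pathfinish \<gamma> = pathstart \<gamma> \<and> path_image \<gamma> = C \<and>
          piecewise_analytic_path \<gamma>)"

text \<open>Joint real analyticity at a point: \<open>F\<close> is given near \<open>(a, b)\<close> by an absolutely convergent
  double power series.\<close>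

definition real_analytic2_at :: "(real \<Rightarrow> real \<Rightarrow> real) \<Rightarrow> real \<Rightarrow> real \<Rightarrow> bool" where
  "real_analytic2_at F a b \<longleftrightarrow>
     (\<exists>c :: nat \<Rightarrow> nat \<Rightarrow> real. \<exists>r>0. \<forall>s y. \<bar>s - a\<bar> < r \<longrightarrow> \<bar>y - b\<bar> < r \<longrightarrow>
        ((\<lambda>(m, n). c m n * (s - a) ^ m * (y - b) ^ n) has_sum F s y) UNIV)"

text \<open>\<open>C\<^sup>\<infinity>\<close> on an open set of reals.\<close>

definition smooth_on :: "(real \<Rightarrow> real) \<Rightarrow> real set \<Rightarrow> bool" where
  "smooth_on \<phi> S \<longleftrightarrow> (\<forall>k. \<forall>t\<in>S. (deriv ^^ k) \<phi> differentiable (at t))"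

end

theory Submission
  imports Defs "HOL-Complex_Analysis.Complex_Analysis" "HOL-Real_Asymp.Real_Asymp"
begin

text \<open>With \<open>a = \<pi>\<alpha>\<close> and \<open>T = 2\<pi>\<^sup>2t\<close>, the map \<open>\<Phi> \<alpha> t\<close> is \<open>\<Phi>(u) = u exp (T B(u))\<close>, where \<open>B\<close> is the
average of the Herglotz kernels of the two boundary points \<open>e\<^sup>i\<^sup>a\<close> and \<open>e\<^sup>-\<^sup>i\<^sup>a\<close>. Write
\<open>M(u)\<close> for the average of \<open>1/|1 - e\<^sup>\<plusminus>\<^sup>i\<^sup>a u|\<^sup>2\<close>, so that \<open>Re B = (1 - |u|\<^sup>2) M\<close>. Inside the disk the
inequality \<open>|\<Phi>(u)| \<le> 1\<close> reads \<open>T |u| M(u) \<le> \<kappa>(|u|)\<close> with \<open>\<kappa>(r) = - r ln r / (1 - r\<^sup>2)\<close>, and this second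
form still makes sense on the unit circle, where \<open>\<kappa>(1) = 1/2\<close>. It defines a compact set \<open>region a T\<close>
that avoids the two poles.

The heart of the matter is that \<open>\<Phi>\<close> is injective on this compact set (\<open>flow_inj_on_region\<close>). If
\<open>\<Phi>(u) = \<Phi>(v)\<close>, suitable logarithms \<open>P, Q\<close> of \<open>u, v\<close> satisfy \<open>P - Q = T (B(v) - B(u))\<close>. By Cauchy-Schwarz
\<open>|B(v) - B(u)|\<^sup>2 \<le> 4 |u - v|\<^sup>2 M(u) M(v)\<close>, and \<open>|u - v| = |e\<^sup>P - e\<^sup>Q|\<close> is explicit, so that the
defining inequality of the region reduces \<open>P = Q\<close> to an elementary real inequality between \<open>cosh\<close>,
\<open>cos\<close> and \<open>sinh\<close> (\<open>inv_sinhc_mult_less\<close>). Every point of the open disk is a value of \<open>\<Phi>\<close> by Brouwer's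
theorem applied to \<open>u \<mapsto> z exp (- T B(u))\<close>, hence by compactness \<open>\<Phi>\<close> is a homeomorphism from the region
onto the closed disk. Its inverse \<open>inv_flow\<close> is the continuous extension of \<open>w\<close>, the region is the
closure of \<open>V\<close>, and \<open>inv_flow\<close> maps the unit circle onto the frontier of \<open>V\<close>. A closed graph argument
makes \<open>inv_flow\<close> continuous in the time as well, which gives the continuity of the density.

The boundary curve \<open>\<Gamma>(x) = inv_flow (e\<^sup>i\<^sup>x)\<close> solves \<open>\<Phi>(\<Gamma>(x)) = e\<^sup>i\<^sup>x\<close> with \<open>\<Phi>\<close> holomorphic near the
curve. If \<open>\<Phi> - \<Phi>(\<Gamma>(x\<^sub>0))\<close> vanishes to order \<open>k\<close> at \<open>\<Gamma>(x\<^sub>0)\<close>, then \<open>s \<mapsto> \<Gamma>(x\<^sub>0 \<plusminus> s\<^sup>k)\<close> is a regular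
analytic arc up to \<open>s = 0\<close>. This covers ordinary points (\<open>k = 1\<close>), the corners, and the more degenerate
corners at the two critical times alike; a compactness argument glues the arcs.

The points of the unit circle in the region are the \<open>e\<^sup>i\<^sup>\<theta>\<close> with
\<open>T (1 - cos a cos \<theta>) \<le> (cos \<theta> - cos a)\<^sup>2\<close>. They form an arc around \<open>1\<close>, present for \<open>T \<le> 1 - cos a\<close>,
and an arc around \<open>-1\<close>, present for \<open>T \<le> 1 + cos a\<close>; each shrinks to a point at equality, and these
bounds are the two critical times. On these arcs \<open>\<Phi>\<close> acts on the
angle as \<open>\<theta> \<mapsto> \<theta> - T sin \<theta> / (cos \<theta> - cos a)\<close>, which is monotone exactly because of the inequality, and
the images of the end points of the arcs are the angles \<open>\<phi>\<^sub>1\<close> and \<open>\<phi>\<^sub>2\<close>. Reflection \<open>u \<mapsto> -u\<close>,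
\<open>a \<mapsto> \<pi> - a\<close> exchanges the two arcs. The density is the harmonic extension of the initial profile,
evaluated on the boundary curve: it takes the two extreme values on the two arcs and values strictly
between them in the open disk. Near a point of the curve in the open disk the map
\<open>u \<mapsto> e\<^sup>i\<^sup>y exp (- T B(u))\<close> is a contraction, whose fixed point depends holomorphically on complex \<open>T\<close>
and \<open>y\<close>, and a separately holomorphic bounded function is a double power series.\<close>

section \<open>A comparison of hyperbolic and circular functions\<close>

lemma pos_of_deriv_pos:
  fixes f :: "real \<Rightarrow> real"
  assumes f: "f 0 = 0" "\<And>z. (f has_real_derivative f' z) (at z)" and pos: "\<And>z. 0 < z \<Longrightarrow> z < x \<Longrightarrow> 0 < f' z"
    and "0 < x"
  shows "0 < f x"
proof -
  have "f 0 < f x"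
  proof (rule DERIV_pos_imp_increasing_open[OF \<open>0 < x\<close>])
    show "continuous_on {0..x} f" by (rule DERIV_continuous_on[OF has_field_derivative_at_within[OF f(2)]])
  qed (use f(2) pos in blast)
  then show ?thesis using f(1) by simp
qed

lemma sinh_less_mult_cosh:
  fixes x :: real assumes "0 < x" shows "sinh x < x * cosh x"
proof -
  have "0 < x * cosh x - sinh x"
    by (rule pos_of_deriv_pos[of "\<lambda>x. x * cosh x - sinh x" "\<lambda>z. z * sinh z"])
      (use assms in \<open>auto intro!: derivative_eq_intros\<close>)
  then show ?thesis by simp
qed

lemma cosh_minus_one_less:
  fixes x :: real assumes "0 < x" shows "2 * (cosh x - 1) < x * sinh x"
proof -
  have c: "cosh x = 1 + 2 * sinh (x/2) ^ 2"
    using cosh_double[of "x/2"] cosh_square_eq[of "x/2"] by simp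
  have s: "sinh x = 2 * sinh (x/2) * cosh (x/2)"
    using sinh_double[of "x/2"] by simp
  have "sinh (x/2) < x/2 * cosh (x/2)" using sinh_less_mult_cosh[of "x/2"] assms by simp
  moreover have "0 < sinh (x/2)" using assms by simp
  ultimately have "4 * sinh (x/2) * sinh (x/2) < 4 * sinh (x/2) * (x/2 * cosh (x/2))"
    by (intro mult_strict_left_mono) auto
  then show ?thesis unfolding c s by (simp add: power2_eq_square algebra_simps)
qed

definition inv_sinhc :: "real \<Rightarrow> real" where
  "inv_sinhc x = (if x = 0 then 1 else x / sinh x)"

lemma inv_sinhc_pos: "0 < inv_sinhc x"
  by (auto simp: inv_sinhc_def zero_less_divide_iff)

lemma inv_sinhc_antimono:
  assumes "0 < x" "x \<le> y" shows "inv_sinhc y \<le> inv_sinhc x"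
proof -
  have "x / sinh x \<ge> y / sinh y"
  proof (rule DERIV_nonpos_imp_nonincreasing[OF assms(2)])
    fix z assume z: "x \<le> z" "z \<le> y"
    then have z0: "z > 0" using assms by simp
    have "((\<lambda>z. z / sinh z) has_real_derivative (sinh z - z * cosh z) / (sinh z * sinh z)) (at z)"
      using z0 by (auto intro!: derivative_eq_intros)
    moreover have "(sinh z - z * cosh z) / (sinh z * sinh z) \<le> 0"
      using sinh_less_mult_cosh[OF z0] by (intro divide_nonpos_nonneg) auto
    ultimately show "\<exists>y. ((\<lambda>z. z / sinh z) has_real_derivative y) (at z) \<and> y \<le> 0" by blast
  qed
  then show ?thesis using assms by (auto simp: inv_sinhc_def)
qed

lemma inv_sinhc_less_1: assumes "0 < x" shows "inv_sinhc x < 1"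
proof -
  have "0 < sinh x - x"
    by (rule pos_of_deriv_pos[of "\<lambda>x. sinh x - x" "\<lambda>z. cosh z - 1"])
      (use cosh_real_nonneg_less_iff[of 0] assms in \<open>auto intro!: derivative_eq_intros\<close>)
  then show ?thesis using assms by (auto simp: inv_sinhc_def)
qed

lemma inv_sinhc_le_1: "0 \<le> x \<Longrightarrow> inv_sinhc x \<le> 1"
  using inv_sinhc_less_1[of x] by (cases "x = 0") (auto simp: inv_sinhc_def)

lemma sin_less_self:
  fixes x :: real assumes "0 < x" shows "sin x < x"
proof (cases "x > 1")
  case True then show ?thesis using sin_le_one[of x] by linarith
next
  case False
  have "0 < x - sin x"
  proof (rule pos_of_deriv_pos[of "\<lambda>x. x - sin x" "\<lambda>z. 1 - cos z"])
    show "0 < 1 - cos z" if "0 < z" "z < x" for z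
      using cos_monotone_0_pi[of 0 z] that False pi_gt3 by auto
  qed (use assms in \<open>auto intro!: derivative_eq_intros\<close>)
  then show ?thesis by simp
qed

text \<open>This is the chord-arc inequality on the unit circle.\<close>

lemma two_minus_cos_less:
  fixes y :: real assumes "y \<noteq> 0" shows "2 - 2 * cos y < y\<^sup>2"
proof -
  have pos: "2 - 2 * cos y < y\<^sup>2" if "0 < y" for y :: real
  proof -
    have "0 < y\<^sup>2 + 2 * cos y - 2"
      by (rule pos_of_deriv_pos[of "\<lambda>x. x\<^sup>2 + 2 * cos x - 2" "\<lambda>z. 2 * z - 2 * sin z"])
        (use that sin_less_self in \<open>auto intro!: derivative_eq_intros\<close>)
    then show ?thesis by simp
  qed
  show ?thesis using pos[of y] pos[of "-y"] assms by (cases "y > 0") auto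
qed

text \<open>The circular part is the chord-arc inequality, since the factors are at most 1. In the hyperbolic
part, for \<open>0 < d = p - q \<le> p\<close>, monotonicity of \<open>sinh x / x\<close> bounds the product of the factors by \<open>d / sinh d\<close>, and
\<open>2 (cosh d - 1) < d sinh d\<close>. It is the inequality that excludes two points of the region with the same
image.\<close>

lemma inv_sinhc_mult_less:
  assumes "0 \<le> p" "0 \<le> q" "p \<noteq> q \<or> y \<noteq> 0"
  shows "inv_sinhc p * inv_sinhc q * (2 * cosh (p - q) - 2 * cos y) < (p - q)\<^sup>2 + y\<^sup>2"
proof -
  have main: "inv_sinhc p * inv_sinhc q * (2 * cosh (p - q) - 2 * cos y) < (p - q)\<^sup>2 + y\<^sup>2"
    if "q \<le> p" "0 \<le> q" "p \<noteq> q \<or> y \<noteq> 0" for p q :: real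
  proof -
    define d where "d = p - q"
    have d: "0 \<le> d" "d \<le> p" using that by (auto simp: d_def)
    define k where "k = inv_sinhc p * inv_sinhc q"
    have kp: "k \<le> inv_sinhc p" and k1: "k \<le> 1" and k0: "0 < k"
      using inv_sinhc_le_1[of q] inv_sinhc_le_1[of p] that inv_sinhc_pos[of p] inv_sinhc_pos[of q]
      by (auto simp: k_def mult_le_one mult_left_le)
    have A: "k * (2 * cosh d - 2) \<le> d\<^sup>2" "d \<noteq> 0 \<Longrightarrow> k * (2 * cosh d - 2) < d\<^sup>2"
    proof -
      show *: "k * (2 * cosh d - 2) < d\<^sup>2" if "d \<noteq> 0"
      proof -
        have d0: "0 < d" using d that by simp
        have "k \<le> d / sinh d"
          using inv_sinhc_antimono[OF d0 d(2)] kp d0 by (simp add: inv_sinhc_def)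
        then have "k * (2 * cosh d - 2) \<le> d / sinh d * (2 * cosh d - 2)"
          using cosh_real_ge_1[of d] by (intro mult_right_mono) auto
        also have "\<dots> < d / sinh d * (d * sinh d)"
          using cosh_minus_one_less[OF d0] d0 by (intro mult_strict_left_mono) auto
        also have "\<dots> = d\<^sup>2" using d0 by (simp add: power2_eq_square)
        finally show ?thesis .
      qed
      show "k * (2 * cosh d - 2) \<le> d\<^sup>2" using * by (cases "d = 0") auto
    qed
    have B: "k * (2 - 2 * cos y) \<le> 2 - 2 * cos y"
      using k1 k0 cos_le_one[of y] by (intro mult_left_le_one_le) auto
    have "k * (2 * cosh d - 2 * cos y) = k * (2 * cosh d - 2) + k * (2 - 2 * cos y)"
      by (simp add: algebra_simps)
    also have "\<dots> < d\<^sup>2 + y\<^sup>2"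
    proof (cases "y = 0")
      case True
      then show ?thesis using A that by (simp add: d_def)
    next
      case False
      then show ?thesis using A(1) B two_minus_cos_less[of y] by linarith
    qed
    finally show ?thesis by (simp add: k_def d_def)
  qed
  show ?thesis
  proof (cases "q \<le> p")
    case True then show ?thesis using main[of q p] assms by auto
  next
    case False
    have "cosh (q - p) = cosh (p - q)" by (metis cosh_minus minus_diff_eq)
    then show ?thesis using main[of p q] False assms
      unfolding power2_commute[of p q] mult.commute[of "inv_sinhc p"] \<open>cosh (q - p) = cosh (p - q)\<close> by auto
  qed
qed

section \<open>The flow map and its injectivity\<close>

text \<open>The average of the Herglotz kernels \<open>(1 + \<omega>u) / (1 - \<omega>u)\<close> at \<open>\<omega> = e\<^sup>i\<^sup>a\<close> and \<open>\<omega> = e\<^sup>-\<^sup>i\<^sup>a\<close>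
(see \<open>herglotz_split\<close>), over a common denominator.\<close>

definition herglotz :: "real \<Rightarrow> complex \<Rightarrow> complex" where
  "herglotz a u = (1 - u\<^sup>2) / ((1 - cis a * u) * (1 - cis (- a) * u))"

abbreviation poles :: "real \<Rightarrow> complex set" where
  "poles a \<equiv> {cis a, cis (- a)}"

definition pole_sum :: "real \<Rightarrow> complex \<Rightarrow> real" where
  "pole_sum a u = (1 / (cmod (1 - cis a * u))\<^sup>2 + 1 / (cmod (1 - cis (- a) * u))\<^sup>2) / 2"

text \<open>The map \<open>\<Phi> \<alpha> t\<close> in the variables \<open>a = \<pi>\<alpha>\<close>, \<open>T = 2\<pi>\<^sup>2t\<close>; in
this form it is visibly holomorphic across the unit circle away from the poles.\<close>

definition flow :: "real \<Rightarrow> real \<Rightarrow> complex \<Rightarrow> complex" where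
  "flow a T u = u * exp (of_real T * herglotz a u)"

text \<open>Taking logarithms in \<open>|flow a T u| \<le> 1\<close> and multiplying by \<open>|u| / (1 - |u|\<^sup>2)\<close> gives
\<open>T |u| pole_sum a u \<le> kappa |u|\<close>. The value at 1 is the limit.\<close>

definition kappa :: "real \<Rightarrow> real" where
  "kappa r = (if r = 1 then 1 / 2 else - r * ln r / (1 - r\<^sup>2))"

text \<open>The condition \<open>T |u| pole_sum a u \<le> kappa |u|\<close> with the denominators of \<open>pole_sum\<close> multiplied out.
In this form it is closed jointly in \<open>T\<close> and \<open>u\<close>, and for \<open>T > 0\<close> it fails at the poles if they are
distinct, because there the right-hand side vanishes and the left-hand side does not.\<close>

definition region :: "real \<Rightarrow> real \<Rightarrow> complex set" where
  "region a T = {u. cmod u \<le> 1 \<and>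
     T * cmod u * ((cmod (1 - cis a * u))\<^sup>2 + (cmod (1 - cis (- a) * u))\<^sup>2)
       \<le> 2 * kappa (cmod u) * ((cmod (1 - cis a * u))\<^sup>2 * (cmod (1 - cis (- a) * u))\<^sup>2)}"

lemma nonpole_factors:
  assumes "u \<notin> poles a"
  shows "1 - cis a * u \<noteq> 0" "1 - cis (- a) * u \<noteq> 0"
proof -
  have "u = cis (- a) * (cis a * u)" "u = cis a * (cis (- a) * u)"
    by (simp_all add: cis_mult flip: mult.assoc)
  then show "1 - cis a * u \<noteq> 0" "1 - cis (- a) * u \<noteq> 0"
    using assms by (metis insertCI mult.right_neutral right_minus_eq)+
qed

lemma disc_nonpole: "cmod u < 1 \<Longrightarrow> u \<notin> poles a"
  by auto

lemma herglotz_split: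
  assumes "u \<notin> poles a"
  shows "herglotz a u = ((1 + cis a * u) / (1 - cis a * u) + (1 + cis (- a) * u) / (1 - cis (- a) * u)) / 2"
proof -
  have m: "cis a * cis (- a) = 1" by (simp add: cis_mult)
  show ?thesis
    unfolding herglotz_def add_frac_eq[OF nonpole_factors[OF assms]]
  proof -
    have "(1 + cis a * u) * (1 - cis (- a) * u) + (1 + cis (- a) * u) * (1 - cis a * u) = 2 * (1 - u\<^sup>2)"
      using m by algebra
    then show "(1 - u\<^sup>2) / ((1 - cis a * u) * (1 - cis (- a) * u)) =
      ((1 + cis a * u) * (1 - cis (- a) * u) + (1 + cis (- a) * u) * (1 - cis a * u)) /
      ((1 - cis a * u) * (1 - cis (- a) * u)) / 2"
      using nonpole_factors[OF assms] by (simp only: divide_divide_eq_left mult.commute[of _ 2] mult_divide_mult_cancel_left[OF zero_neq_numeral[symmetric]])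
  qed
qed

lemma Re_herglotz:
  assumes "u \<notin> poles a"
  shows "Re (herglotz a u) = (1 - (cmod u)\<^sup>2) * pole_sum a u"
proof -
  have *: "Re ((1 + z) / (1 - z)) = (1 - (cmod z)\<^sup>2) / (cmod (1 - z))\<^sup>2" for z
  proof -
    have "Re ((1 + z) * cnj (1 - z)) = 1 - (cmod z)\<^sup>2"
      unfolding cmod_power2 by (simp add: power2_eq_square algebra_simps)
    then show ?thesis
      by (subst complex_div_cnj) (metis Re_divide_of_real of_real_power)
  qed
  show ?thesis
    unfolding herglotz_split[OF assms] pole_sum_def Re_divide_numeral plus_complex.sel *
    by (simp add: norm_mult field_simps)
qed

lemma pole_sum_pos: "u \<notin> poles a \<Longrightarrow> 0 < pole_sum a u"
  using nonpole_factors[of u a] by (auto simp: pole_sum_def add_pos_pos)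

lemma herglotz_diff:
  assumes "u \<notin> poles a" "v \<notin> poles a"
  shows "herglotz a u - herglotz a v =
    (u - v) * (cis a / ((1 - cis a * u) * (1 - cis a * v)) + cis (- a) / ((1 - cis (- a) * u) * (1 - cis (- a) * v)))"
  unfolding herglotz_split[OF assms(1)] herglotz_split[OF assms(2)]
  using nonpole_factors[OF assms(1)] nonpole_factors[OF assms(2)]
  by (simp add: divide_simps) (simp add: algebra_simps)

text \<open>The difference has the factor \<open>u - v\<close> and a cofactor that is a sum of two products, one for each
pole, to which the Cauchy-Schwarz inequality applies.\<close>

lemma norm_herglotz_diff_le:
  assumes "u \<notin> poles a" "v \<notin> poles a"
  shows "(cmod (herglotz a u - herglotz a v))\<^sup>2 \<le> 4 * (cmod (u - v))\<^sup>2 * pole_sum a u * pole_sum a v"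
proof -
  define x1 y1 x2 y2 where "x1 = 1 / cmod (1 - cis a * u)" and "y1 = 1 / cmod (1 - cis a * v)"
    and "x2 = 1 / cmod (1 - cis (- a) * u)" and "y2 = 1 / cmod (1 - cis (- a) * v)"
  note defs = x1_def y1_def x2_def y2_def
  have "cmod (herglotz a u - herglotz a v) \<le> cmod (u - v) * (x1 * y1 + x2 * y2)"
    unfolding herglotz_diff[OF assms] norm_mult defs
    by (intro mult_left_mono order_trans[OF norm_triangle_ineq]) (auto simp: norm_divide norm_mult)
  then have "(cmod (herglotz a u - herglotz a v))\<^sup>2 \<le> (cmod (u - v) * (x1 * y1 + x2 * y2))\<^sup>2"
    by (intro power_mono) auto
  also have "\<dots> = (cmod (u - v))\<^sup>2 * (x1 * y1 + x2 * y2)\<^sup>2" by (simp add: power_mult_distrib)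
  also have "\<dots> \<le> (cmod (u - v))\<^sup>2 * ((x1\<^sup>2 + x2\<^sup>2) * (y1\<^sup>2 + y2\<^sup>2))"
  proof (intro mult_left_mono)
    have "(x1\<^sup>2 + x2\<^sup>2) * (y1\<^sup>2 + y2\<^sup>2) - (x1 * y1 + x2 * y2)\<^sup>2 = (x1 * y2 - x2 * y1)\<^sup>2"
      by (simp add: power2_eq_square algebra_simps)
    then show "(x1 * y1 + x2 * y2)\<^sup>2 \<le> (x1\<^sup>2 + x2\<^sup>2) * (y1\<^sup>2 + y2\<^sup>2)"
      by (smt (verit) zero_le_power2)
  qed auto
  also have "\<dots> = 4 * (cmod (u - v))\<^sup>2 * pole_sum a u * pole_sum a v"
    unfolding pole_sum_def defs by (simp add: power_divide)
  finally show ?thesis .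
qed

lemma cmod_exp_diff:
  "(cmod (exp P - exp Q))\<^sup>2 = exp (Re P + Re Q) * (2 * cosh (Re P - Re Q) - 2 * cos (Im P - Im Q))"
proof -
  have "(cmod (exp P - exp Q))\<^sup>2 =
      (exp (Re P) * cos (Im P) - exp (Re Q) * cos (Im Q))\<^sup>2 + (exp (Re P) * sin (Im P) - exp (Re Q) * sin (Im Q))\<^sup>2"
    unfolding cmod_power2 by (simp add: Re_exp Im_exp)
  also have "\<dots> = (exp (Re P))\<^sup>2 + (exp (Re Q))\<^sup>2 - 2 * exp (Re P) * exp (Re Q) * cos (Im P - Im Q)"
    unfolding cos_diff using sin_cos_squared_add[of "Im P"] sin_cos_squared_add[of "Im Q"] by algebra
  also have "\<dots> = exp (Re P + Re Q) * (2 * cosh (Re P - Re Q) - 2 * cos (Im P - Im Q))"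
    by (simp add: cosh_field_def exp_add exp_diff field_simps power2_eq_square)
  finally show ?thesis .
qed

lemma kappa_inv_sinhc:
  assumes "0 < r" "r \<le> 1" shows "2 * kappa r = inv_sinhc (- ln r)"
proof (cases "r = 1")
  case True then show ?thesis by (simp add: kappa_def inv_sinhc_def)
next
  case False
  then have "ln r \<noteq> 0" "r\<^sup>2 < 1" using assms by (auto simp: power_less_one_iff)
  moreover have "sinh (- ln r) = (1 - r\<^sup>2) / (2 * r)"
    using assms by (simp add: sinh_field_def exp_minus field_simps power2_eq_square)
  ultimately show ?thesis using assms False by (simp add: kappa_def inv_sinhc_def field_simps)
qed

lemma region_nonpole:
  assumes "0 < T" "sin a \<noteq> 0" "u \<in> region a T" shows "u \<notin> poles a"
proof -
  have *: "1 - cis b * cis b \<noteq> 0" if "sin b \<noteq> 0" for b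
  proof
    assume h: "1 - cis b * cis b = 0"
    then have "cis (- b) = cis b"
      by (metis cis_mult add.right_neutral cis_zero mult.assoc mult.left_neutral right_minus_eq
          ab_left_minus)
    then show False using that by (auto simp: complex_eq_iff)
  qed
  have z: "cis a * cis (- a) = 1" "cis (- a) * cis a = 1" by (simp_all add: cis_mult)
  have sq: "0 < (cmod (1 - cis a * cis a))\<^sup>2" "0 < (cmod (1 - cis (- a) * cis (- a)))\<^sup>2"
    using *[of a] *[of "- a"] assms by auto
  show ?thesis
  proof
    assume "u \<in> poles a"
    then show False
    proof
      assume "u = cis a" then show False
        using assms(1,3) sq z unfolding region_def by (auto simp: mult_le_0_iff)
    next
      assume "u \<in> {cis (- a)}" then show False
        using assms(1,3) sq z unfolding region_def by (auto simp: mult_le_0_iff)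
    qed
  qed
qed

lemma region_iff_pole_sum:
  assumes "u \<notin> poles a"
  shows "u \<in> region a T \<longleftrightarrow> cmod u \<le> 1 \<and> T * cmod u * pole_sum a u \<le> kappa (cmod u)"
proof -
  define p q where "p = (cmod (1 - cis a * u))\<^sup>2" and "q = (cmod (1 - cis (- a) * u))\<^sup>2"
  have "0 < p" "0 < q" using nonpole_factors[OF assms] by (auto simp: p_def q_def)
  then have "T * cmod u * (p + q) \<le> 2 * kappa (cmod u) * (p * q) \<longleftrightarrow>
      T * cmod u * ((1 / p + 1 / q) / 2) \<le> kappa (cmod u)"
    by (simp add: field_simps)
  then show ?thesis unfolding region_def pole_sum_def p_def q_def by simp
qed

lemma flow_eq_0_iff [simp]: "flow a T u = 0 \<longleftrightarrow> u = 0"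
  by (simp add: flow_def)

text \<open>Equality of the images gives logarithms \<open>P, Q\<close> of the two points whose difference is
\<open>T (herglotz a v - herglotz a u)\<close>. Bounding the right-hand side by \<open>|e\<^sup>P - e\<^sup>Q|\<close> and the two pole sums,
and the pole sums by the inequality of the region, contradicts \<open>inv_sinhc_mult_less\<close> unless \<open>P = Q\<close>.\<close>

lemma flow_inj_on_region:
  assumes T: "0 < T" and a: "sin a \<noteq> 0"
  shows "inj_on (flow a T) (region a T)"
proof (rule inj_onI)
  fix u v assume u: "u \<in> region a T" and v: "v \<in> region a T" and eq: "flow a T u = flow a T v"
  show "u = v"
  proof (cases "u = 0 \<or> v = 0")
    case True then show ?thesis using eq by (metis flow_eq_0_iff)
  next
    case False
    then have nz: "u \<noteq> 0" "v \<noteq> 0" by auto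
    note np = region_nonpole[OF T a u] region_nonpole[OF T a v]
    have "exp (Ln u + of_real T * herglotz a u) = exp (Ln v + of_real T * herglotz a v)"
      using eq nz by (simp add: exp_add flow_def)
    then obtain n :: int where "Ln u + of_real T * herglotz a u = Ln v + of_real T * herglotz a v + (of_int (2 * n) * pi) * \<i>"
      by (auto simp: exp_eq)
    \<comment> \<open>The multiple of \<open>2\<pi>i\<close> is absorbed into the logarithm of \<open>v\<close>.\<close>
    then obtain P Q where P: "exp P = u" and Q: "exp Q = v" and PQ: "P + of_real T * herglotz a u = Q + of_real T * herglotz a v"
      using that[of "Ln u" "Ln v + (of_int (2 * n) * pi) * \<i>"] nz
      by (simp add: exp_add algebra_simps exp_integer_2pi)
    have ReP: "cmod u = exp (Re P)" "cmod v = exp (Re Q)" using P Q by auto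
    have le1: "cmod u \<le> 1" "cmod v \<le> 1" using u v by (auto simp: region_def)
    have kP: "2 * kappa (cmod u) = inv_sinhc (- Re P)" "2 * kappa (cmod v) = inv_sinhc (- Re Q)"
      using kappa_inv_sinhc[of "cmod u"] kappa_inv_sinhc[of "cmod v"] le1 nz by (simp_all add: ReP)
    have ReP0: "0 \<le> - Re P" "0 \<le> - Re Q" using le1 by (simp_all add: ReP)
    have "P - Q = of_real T * (herglotz a v - herglotz a u)" using PQ by (simp add: algebra_simps)
    then have "(cmod (P - Q))\<^sup>2 = T\<^sup>2 * (cmod (herglotz a v - herglotz a u))\<^sup>2"
      by (simp add: norm_mult power_mult_distrib)
    also have "\<dots> \<le> T\<^sup>2 * (4 * (cmod (v - u))\<^sup>2 * pole_sum a v * pole_sum a u)"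
      by (intro mult_left_mono norm_herglotz_diff_le np) auto
    also have "(cmod (v - u))\<^sup>2 = cmod u * cmod v * (2 * cosh (- Re P - - Re Q) - 2 * cos (Im P - Im Q))"
      using cmod_exp_diff[of P Q] P Q cosh_minus[of "Re P - Re Q"]
      by (simp add: norm_minus_commute exp_add ReP)
    finally have 1: "(cmod (P - Q))\<^sup>2 \<le> 4 * ((T * cmod u * pole_sum a u) * (T * cmod v * pole_sum a v)) *
        (2 * cosh (- Re P - - Re Q) - 2 * cos (Im P - Im Q))"
      by (simp add: power2_eq_square algebra_simps)
    have "(T * cmod u * pole_sum a u) * (T * cmod v * pole_sum a v) \<le> kappa (cmod u) * kappa (cmod v)"
    proof (intro mult_mono)
      show *: "T * cmod u * pole_sum a u \<le> kappa (cmod u)" "T * cmod v * pole_sum a v \<le> kappa (cmod v)"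
        using u v region_iff_pole_sum[OF np(1)] region_iff_pole_sum[OF np(2)] by blast+
      show "0 \<le> T * cmod v * pole_sum a v" using pole_sum_pos[OF np(2)] T by simp
      have "0 \<le> T * cmod u * pole_sum a u" using pole_sum_pos[OF np(1)] T by simp
      then show "0 \<le> kappa (cmod u)" using *(1) by linarith
    qed
    then have 2: "4 * ((T * cmod u * pole_sum a u) * (T * cmod v * pole_sum a v)) \<le> inv_sinhc (- Re P) * inv_sinhc (- Re Q)"
      by (simp flip: kP)
    have 3: "0 \<le> 2 * cosh (- Re P - - Re Q) - 2 * cos (Im P - Im Q)"
      using cosh_real_ge_1[of "- Re P - - Re Q"] cos_le_one[of "Im P - Im Q"] by linarith
    have le: "(cmod (P - Q))\<^sup>2 \<le> inv_sinhc (- Re P) * inv_sinhc (- Re Q) * (2 * cosh (- Re P - - Re Q) - 2 * cos (Im P - Im Q))"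
      using order_trans[OF 1 mult_right_mono[OF 2 3]] .
    have "P = Q"
    proof (rule ccontr)
      assume "P \<noteq> Q"
      then have "- Re P \<noteq> - Re Q \<or> Im P - Im Q \<noteq> 0" by (auto simp: complex_eq_iff)
      from inv_sinhc_mult_less[OF ReP0 this] le show False
        by (simp add: cmod_power2 power2_commute)
    qed
    then show "u = v" using P Q by simp
  qed
qed

section \<open>The flow map as a homeomorphism onto the closed disk\<close>

lemma continuous_on_kappa: "continuous_on {0..} kappa"
proof -
  define h :: "real \<Rightarrow> real" where "h = (\<lambda>r. - r * ln r / (1 - r\<^sup>2))"
  have near: "(kappa \<longlongrightarrow> l) (at r within S) \<longleftrightarrow> (h \<longlongrightarrow> l) (at r within S)" if "r = 1 \<or> r \<in> {0..} \<and> r \<noteq> 1" for r l S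
  proof (rule filterlim_cong[OF refl refl])
    show "eventually (\<lambda>x. kappa x = h x) (at r within S)"
    proof (cases "r = 1")
      case True
      then show ?thesis by (auto simp: eventually_at_filter kappa_def h_def)
    next
      case False
      have "eventually (\<lambda>x. x \<noteq> 1) (at r within S)"
        using False by (intro tendsto_imp_eventually_ne) auto
      then show ?thesis by eventually_elim (auto simp: kappa_def h_def)
    qed
  qed
  show ?thesis
    unfolding continuous_on_def
  proof
    fix r :: real assume "r \<in> {0..}"
    then consider "r = 0" | "r = 1" | "0 < r" "r \<noteq> 1" by fastforce
    then show "(kappa \<longlongrightarrow> kappa r) (at r within {0..})"
    proof cases
      case 1
      have "(h \<longlongrightarrow> 0) (at_right 0)" unfolding h_def by real_asymp
      then show ?thesis using near[of 0] 1 by (simp add: kappa_def at_within_Ici_at_right)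
    next
      case 2
      have "(h \<longlongrightarrow> 1/2) (at 1)" unfolding h_def by real_asymp
      then have "(h \<longlongrightarrow> 1/2) (at 1 within {0..})" by (rule tendsto_within_subset) simp
      then show ?thesis using near[of 1] 2 by (simp add: kappa_def)
    next
      case 3
      then have "r\<^sup>2 \<noteq> 1" by (simp add: power2_eq_1_iff)
      with 3 have "isCont h r" unfolding h_def by (intro continuous_intros) auto
      then have "(h \<longlongrightarrow> h r) (at r within {0..})" by (meson continuous_at tendsto_within_subset subset_UNIV)
      then show ?thesis using near[of r] 3 by (simp add: kappa_def h_def)
    qed
  qed
qed

lemma closed_region_graph: "closed {(T, u). u \<in> region a T}"
proof -
  have k: "continuous_on UNIV (\<lambda>x :: real \<times> complex. kappa (cmod (snd x)))"
    by (rule continuous_on_compose2[OF continuous_on_kappa]) (auto intro!: continuous_intros)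
  show ?thesis
    unfolding region_def case_prod_beta mem_Collect_eq
    by (intro closed_Collect_conj closed_Collect_le continuous_intros k)
qed

lemma compact_region: "compact (region a T)"
proof -
  have "closed ((\<lambda>u. (T, u)) -` {(T, u). u \<in> region a T})"
    by (rule closed_vimage[OF closed_region_graph]) (intro continuous_intros)
  moreover have "(\<lambda>u. (T, u)) -` {(T, u). u \<in> region a T} = region a T" by auto
  moreover have "bounded (region a T)"
    by (rule bounded_subset[OF bounded_cball[of 0 1]]) (auto simp: region_def)
  ultimately show ?thesis by (simp add: compact_eq_bounded_closed)
qed

lemma continuous_on_herglotz: "continuous_on (- poles a) (herglotz a)"
  unfolding herglotz_def using nonpole_factors[of _ a] by (intro continuous_intros) auto

lemma holomorphic_on_herglotz: "herglotz a holomorphic_on - poles a"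
  unfolding herglotz_def using nonpole_factors[of _ a] by (intro holomorphic_intros) auto

lemma holomorphic_on_flow: "flow a T holomorphic_on - poles a"
  unfolding flow_def by (intro holomorphic_intros holomorphic_on_herglotz)

lemma continuous_on_flow: "continuous_on (UNIV \<times> - poles a) (\<lambda>(T, u). flow a T u)"
  unfolding flow_def case_prod_beta
  by (intro continuous_intros continuous_on_compose2[OF continuous_on_herglotz]) auto

lemma norm_flow:
  assumes "u \<notin> poles a"
  shows "cmod (flow a T u) = cmod u * exp (T * ((1 - (cmod u)\<^sup>2) * pole_sum a u))"
  by (simp add: flow_def norm_mult Re_herglotz[OF assms])

lemma region_iff_norm_flow:
  assumes "0 < cmod u" "cmod u < 1"
  shows "u \<in> region a T \<longleftrightarrow> cmod (flow a T u) \<le> 1"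
proof -
  define r where "r = cmod u"
  have r: "0 < r" "r < 1" "r\<^sup>2 < 1" using assms by (auto simp: r_def power_less_one_iff)
  note np = disc_nonpole[OF assms(2), of a]
  have "cmod (flow a T u) \<le> 1 \<longleftrightarrow> exp (ln r + T * ((1 - r\<^sup>2) * pole_sum a u)) \<le> exp 0"
    using r unfolding norm_flow[OF np] by (simp add: exp_add flip: r_def)
  also have "\<dots> \<longleftrightarrow> T * ((1 - r\<^sup>2) * pole_sum a u) \<le> - ln r"
    unfolding exp_le_cancel_iff by linarith
  also have "\<dots> \<longleftrightarrow> T * r * pole_sum a u \<le> kappa r"
    using r mult_le_cancel_left_pos[of r "T * ((1 - r\<^sup>2) * pole_sum a u)" "- ln r"]
      pos_le_divide_eq[of "1 - r\<^sup>2" "T * r * pole_sum a u" "- r * ln r"]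
    by (simp add: kappa_def ac_simps)
  finally show ?thesis using region_iff_pole_sum[OF np] r by (simp flip: r_def)
qed

lemma zero_in_region: "0 \<in> region a T"
  by (simp add: region_def kappa_def)

lemma norm_flow_le_1:
  assumes "0 < T" "sin a \<noteq> 0" "u \<in> region a T"
  shows "cmod (flow a T u) \<le> 1" "cmod u = 1 \<Longrightarrow> cmod (flow a T u) = 1"
proof -
  note np = region_nonpole[OF assms]
  show *: "cmod (flow a T u) = 1" if "cmod u = 1" using norm_flow[OF np] that by simp
  have "cmod u \<le> 1" using assms(3) by (simp add: region_def)
  then consider "u = 0" | "0 < cmod u" "cmod u < 1" | "cmod u = 1" by fastforce
  then show "cmod (flow a T u) \<le> 1"
    by cases (use region_iff_norm_flow assms(3) * in \<open>auto simp: flow_def\<close>)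
qed

text \<open>A solution of \<open>flow a T u = z\<close> is a fixed point of \<open>u \<mapsto> z exp (- T herglotz a u)\<close>, which maps the
closed disk of radius \<open>|z|\<close> into itself because \<open>herglotz\<close> has nonnegative real part.\<close>

lemma flow_surj_ball:
  assumes "0 < T" "cmod z < 1"
  obtains u where "cmod u < 1" "flow a T u = z"
proof (cases "z = 0")
  case True
  then show thesis using that[of 0] by (simp add: flow_def)
next
  case False
  define F where "F = (\<lambda>u. z * exp (- of_real T * herglotz a u))"
  have sub: "cball 0 (cmod z) \<subseteq> - poles a"
    using assms(2) by auto
  have "continuous_on (cball 0 (cmod z)) F"
    unfolding F_def by (intro continuous_intros continuous_on_subset[OF continuous_on_herglotz sub])
  moreover have "F \<in> cball 0 (cmod z) \<rightarrow> cball 0 (cmod z)"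
  proof
    fix u :: complex assume u: "u \<in> cball 0 (cmod z)"
    then have np: "u \<notin> poles a" using assms(2) by auto
    have "(cmod u)\<^sup>2 \<le> 1" using u assms(2) by (simp add: power_le_one)
    then have "0 \<le> T * Re (herglotz a u)"
      unfolding Re_herglotz[OF np] using assms pole_sum_pos[OF np] by simp
    then have "exp (- (T * Re (herglotz a u))) \<le> 1" by simp
    then show "F u \<in> cball 0 (cmod z)"
      by (simp add: F_def norm_mult mult_left_le)
  qed
  ultimately obtain u where u: "u \<in> cball 0 (cmod z)" "F u = u"
    using brouwer_ball[of "cmod z" 0 F] False by auto
  have "flow a T u = F u * exp (of_real T * herglotz a u)" using u by (simp add: flow_def)
  also have "\<dots> = z" by (simp add: F_def mult.assoc flip: exp_add)
  finally show thesis using that[of u] u assms(2) by simp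
qed

text \<open>The image is compact and contains the open disk, hence the closed one. So boundary values need no
separate existence argument.\<close>

lemma flow_image_region:
  assumes T: "0 < T" and a: "sin a \<noteq> 0"
  shows "flow a T ` region a T = cball 0 1"
proof
  show "flow a T ` region a T \<subseteq> cball 0 1" using norm_flow_le_1[OF T a] by auto
  have "ball 0 1 \<subseteq> flow a T ` region a T"
  proof
    fix z :: complex assume "z \<in> ball 0 1"
    then have z: "cmod z < 1" by simp
    obtain u where u: "cmod u < 1" "flow a T u = z" using flow_surj_ball[OF T z] .
    have "u \<in> region a T"
      using u z region_iff_norm_flow[of u a T] zero_in_region[of a T] by (cases "u = 0") auto
    then show "z \<in> flow a T ` region a T" using u by auto
  qed
  moreover have "continuous_on (region a T) (flow a T)"
    using region_nonpole[OF T a]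
    by (intro continuous_on_subset[OF holomorphic_on_imp_continuous_on[OF holomorphic_on_flow]]) auto
  then have "closed (flow a T ` region a T)"
    by (intro compact_imp_closed compact_continuous_image compact_region)
  ultimately have "closure (ball 0 1) \<subseteq> flow a T ` region a T" by (rule closure_minimal)
  then show "cball 0 1 \<subseteq> flow a T ` region a T" by (simp add: closure_ball)
qed

definition inv_flow :: "real \<Rightarrow> real \<Rightarrow> complex \<Rightarrow> complex" where
  "inv_flow a T z = the_inv_into (region a T) (flow a T) z"

lemma inv_flow:
  assumes "0 < T" "sin a \<noteq> 0" "cmod z \<le> 1"
  shows "inv_flow a T z \<in> region a T" "flow a T (inv_flow a T z) = z"
  using assms flow_inj_on_region[OF assms(1,2)] flow_image_region[OF assms(1,2)]
    the_inv_into_into[of "flow a T" "region a T" z "region a T"] f_the_inv_into_f[of "flow a T" "region a T" z]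
  by (auto simp: inv_flow_def)

lemma inv_flow_unique:
  assumes "0 < T" "sin a \<noteq> 0" "u \<in> region a T" "flow a T u = z"
  shows "inv_flow a T z = u"
  using the_inv_into_f_f[OF flow_inj_on_region[OF assms(1,2)] assms(3)] assms(4)
  by (simp add: inv_flow_def)

lemma inv_flow_in_ball:
  assumes "0 < T" "sin a \<noteq> 0" "cmod z < 1"
  shows "cmod (inv_flow a T z) < 1"
  using inv_flow[of T a z] norm_flow_le_1(2)[of T a "inv_flow a T z"] assms
  by (fastforce simp: region_def)

text \<open>Joint continuity in time and space comes from a closed graph with values in a compact set: the graph is
cut out by \<open>u \<in> region a T\<close>, a closed condition in \<open>(T, u)\<close>, and by \<open>flow a T u = z\<close>.\<close>

lemma continuous_on_inv_flow:
  assumes a: "sin a \<noteq> 0"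
  shows "continuous_on ({0<..} \<times> cball 0 1) (\<lambda>(T, z). inv_flow a T z)"
proof -
  define S where "S = {0::real<..} \<times> cball (0::complex) 1"
  define f where "f = (\<lambda>(T, z). inv_flow a T z)"
  define G where "G = (S \<times> cball 0 1) \<inter> {x. snd x \<in> region a (fst (fst x))}"
  have fS: "f \<in> S \<rightarrow> cball 0 1"
    using inv_flow(1)[OF _ a] by (fastforce simp: S_def f_def region_def)
  have G: "closedin (top_of_set (S \<times> cball 0 1)) G"
  proof -
    have "closed ((\<lambda>x :: (real \<times> complex) \<times> complex. (fst (fst x), snd x)) -` {(T, u). u \<in> region a T})"
      by (rule closed_vimage[OF closed_region_graph]) (intro continuous_intros)
    then have "closed {x :: (real \<times> complex) \<times> complex. snd x \<in> region a (fst (fst x))}"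
      by (simp add: vimage_def)
    then show ?thesis unfolding G_def by (rule closedin_closed_Int)
  qed
  have graph: "(\<lambda>x. (x, f x)) ` S = G \<inter> (\<lambda>x. flow a (fst (fst x)) (snd x) - snd (fst x)) -` {0}" (is "_ = ?R")
  proof
    show "(\<lambda>x. (x, f x)) ` S \<subseteq> ?R"
      using inv_flow[OF _ a] fS by (auto simp: S_def f_def G_def Pi_iff)
    show "?R \<subseteq> (\<lambda>x. (x, f x)) ` S"
    proof
      fix x assume x: "x \<in> ?R"
      then have "f (fst x) = snd x"
        using inv_flow_unique[OF _ a, of "fst (fst x)" "snd x" "snd (fst x)"]
        by (auto simp: G_def S_def f_def)
      then show "x \<in> (\<lambda>x. (x, f x)) ` S" using x by (intro image_eqI[of _ _ "fst x"]) (auto simp: G_def)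
    qed
  qed
  have "continuous_on G (\<lambda>x. flow a (fst (fst x)) (snd x) - snd (fst x))"
  proof (intro continuous_intros continuous_on_compose2[OF continuous_on_flow[of a], of G "\<lambda>x. (fst (fst x), snd x)", simplified])
    show "(\<lambda>x. (fst (fst x), snd x)) ` G \<subseteq> UNIV \<times> - poles a"
      using region_nonpole[OF _ a] by (fastforce simp: G_def S_def)
  qed
  then have "closedin (top_of_set G) ((\<lambda>x. (x, f x)) ` S)"
    unfolding graph by (intro continuous_closedin_preimage) auto
  then have "closedin (top_of_set (S \<times> cball 0 1)) ((\<lambda>x. (x, f x)) ` S)"
    using closedin_trans G by blast
  then have "continuous_on S f"
    using continuous_closed_graph_eq[OF compact_cball fS] by blast
  then show ?thesis by (simp add: S_def f_def)
qed

lemma continuous_on_inv_flow_snd: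
  assumes "0 < T" "sin a \<noteq> 0"
  shows "continuous_on (cball 0 1) (inv_flow a T)"
proof -
  have "continuous_on (cball 0 1) (\<lambda>z. (\<lambda>(T, z). inv_flow a T z) (T, z))"
    by (rule continuous_on_compose2[OF continuous_on_inv_flow[OF assms(2)]])
      (use assms(1) in \<open>auto intro!: continuous_intros\<close>)
  then show ?thesis by simp
qed

lemma flow_preimage_ball:
  assumes "0 < T" "sin a \<noteq> 0"
  shows "{u \<in> ball 0 1. flow a T u \<in> ball 0 1} = inv_flow a T ` ball 0 1"
proof (intro equalityI subsetI)
  fix u assume u: "u \<in> {u \<in> ball 0 1. flow a T u \<in> ball 0 1}"
  have "u \<in> region a T"
    using u region_iff_norm_flow[of u a T] zero_in_region[of a T] by (cases "u = 0") auto
  then show "u \<in> inv_flow a T ` ball 0 1"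
    using inv_flow_unique[OF assms, of u "flow a T u"] u by (intro image_eqI[of _ _ "flow a T u"]) auto
next
  fix u assume "u \<in> inv_flow a T ` ball 0 1"
  then show "u \<in> {u \<in> ball 0 1. flow a T u \<in> ball 0 1}"
    using inv_flow(2)[OF assms] inv_flow_in_ball[OF assms] by auto
qed

text \<open>The inverse maps the closed disk onto the compact set \<open>region a T\<close>, so by continuity the closure of
the image of the open disk is the whole region, and injectivity leaves the image of the circle as
frontier.\<close>

lemma frontier_flow_preimage_ball:
  assumes "0 < T" "sin a \<noteq> 0"
  shows "frontier {u \<in> ball 0 1. flow a T u \<in> ball 0 1} = inv_flow a T ` sphere 0 1"
proof -
  define V' where "V' = {u \<in> ball 0 1. flow a T u \<in> ball 0 1}"
  note V' = flow_preimage_ball[OF assms, folded V'_def]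
  have "continuous_on (ball 0 1) (flow a T)"
    by (intro continuous_on_subset[OF holomorphic_on_imp_continuous_on[OF holomorphic_on_flow]]) auto
  then have "open (ball 0 1 \<inter> flow a T -` ball 0 1)"
    by (rule continuous_open_preimage) auto
  moreover have "ball 0 1 \<inter> flow a T -` ball 0 1 = V'" by (auto simp: V'_def)
  ultimately have op: "open V'" by simp
  have reg: "region a T = inv_flow a T ` cball 0 1"
  proof (intro equalityI subsetI)
    fix u assume "u \<in> region a T"
    then show "u \<in> inv_flow a T ` cball 0 1"
      using inv_flow_unique[OF assms] norm_flow_le_1(1)[OF assms]
      by (intro image_eqI[of _ _ "flow a T u"]) auto
  qed (use inv_flow[OF assms] in auto)
  have cl: "closed (region a T)" by (rule compact_imp_closed[OF compact_region])
  have "V' \<subseteq> region a T" unfolding V' reg by auto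
  have "closure V' = region a T"
  proof
    show "closure V' \<subseteq> region a T"
      by (rule closure_minimal[OF \<open>V' \<subseteq> region a T\<close> cl])
    have "inv_flow a T ` closure (ball 0 1) \<subseteq> closure (inv_flow a T ` ball 0 1)"
      using continuous_on_inv_flow_snd[OF assms]
      by (intro image_closure_subset closed_closure closure_subset) (simp add: closure_ball)
    then show "region a T \<subseteq> closure V'" using V' reg by (simp add: closure_ball)
  qed
  moreover have "inj_on (inv_flow a T) (cball 0 1)"
    using inv_flow(2)[OF assms] by (intro inj_onI) (metis mem_cball_0)
  ultimately have "frontier V' = inv_flow a T ` (cball 0 1 - ball 0 1)"
    using op V' reg by (auto simp: frontier_def interior_open inj_on_image_set_diff[of _ "cball 0 1"])
  also have "cball 0 1 - ball 0 1 = sphere (0::complex) 1" by auto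
  finally show ?thesis by (simp add: V'_def)
qed

section \<open>Curves with piecewise analytic reparametrisations\<close>

lemma analytic_arc_on_cong:
  assumes "analytic_arc_on \<gamma> a b" "\<And>s. s \<in> {a..b} \<Longrightarrow> \<gamma> s = \<gamma>' s"
  shows "analytic_arc_on \<gamma>' a b"
  using assms unfolding analytic_arc_on_def by metis

lemma analytic_arc_on_affine:
  assumes "analytic_arc_on \<gamma> (k * p + d) (k * q + d)" "0 < k"
  shows "analytic_arc_on (\<lambda>s. \<gamma> (k * s + d)) p q"
proof -
  obtain h where h: "h analytic_on (complex_of_real ` {k * p + d..k * q + d})"
    and gh: "\<And>s. s \<in> {k * p + d..k * q + d} \<Longrightarrow> \<gamma> s = h (of_real s) \<and> deriv h (of_real s) \<noteq> 0"
    using assms(1) unfolding analytic_arc_on_def by blast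
  define g where "g = (\<lambda>z. h (of_real k * z + of_real d))"
  have mem: "k * s + d \<in> {k * p + d..k * q + d}" if "s \<in> {p..q}" for s
    using that assms(2) by auto
  have "h \<circ> (\<lambda>z. of_real k * z + of_real d) analytic_on (complex_of_real ` {p..q})"
  proof (rule analytic_on_compose)
    show "(\<lambda>z. of_real k * z + of_real d) analytic_on (complex_of_real ` {p..q})"
      by (intro analytic_intros)
    show "h analytic_on (\<lambda>z. of_real k * z + of_real d) ` (complex_of_real ` {p..q})"
    proof (rule analytic_on_subset[OF h], intro subsetI)
      fix z assume "z \<in> (\<lambda>z. of_real k * z + of_real d) ` (complex_of_real ` {p..q})"
      then obtain s where s: "s \<in> {p..q}" "z = of_real k * of_real s + of_real d" by auto
      then have "z = of_real (k * s + d)" by simp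
      then show "z \<in> complex_of_real ` {k * p + d..k * q + d}" using mem[OF s(1)] by blast
    qed
  qed
  then have "g analytic_on (complex_of_real ` {p..q})" by (simp add: g_def o_def)
  moreover have "\<gamma> (k * s + d) = g (of_real s) \<and> deriv g (of_real s) \<noteq> 0" if s: "s \<in> {p..q}" for s
  proof -
    have "h analytic_on {of_real (k * s + d)}"
      using mem[OF s] by (intro analytic_on_subset[OF h]) blast
    then have "(h has_field_derivative deriv h (of_real (k * s + d))) (at (of_real (k * s + d)))"
      using analytic_on_imp_differentiable_at DERIV_deriv_iff_field_differentiable by blast
    then have "(h has_field_derivative deriv h (of_real (k * s + d))) (at (of_real k * of_real s + of_real d))"
      by simp
    then have "(g has_field_derivative deriv h (of_real (k * s + d)) * of_real k) (at (of_real s))"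
      unfolding g_def by (rule DERIV_chain2) (auto intro!: derivative_eq_intros)
    then have "deriv g (of_real s) = deriv h (of_real (k * s + d)) * of_real k" by (rule DERIV_imp_deriv)
    then show ?thesis using gh[OF mem[OF s]] assms(2) by (simp add: g_def)
  qed
  ultimately show ?thesis unfolding analytic_arc_on_def by blast
qed

definition regular_germ :: "(complex \<Rightarrow> complex) \<Rightarrow> real \<Rightarrow> bool" where
  "regular_germ h e \<longleftrightarrow> 0 < e \<and> h holomorphic_on ball 0 e \<and> (\<forall>z\<in>ball 0 e. deriv h z \<noteq> 0)"

text \<open>The parameter interval \<open>[0, n]\<close> with unit pieces makes concatenation a mere shift. The
reparametrisation \<open>m\<close> is needed because at a critical point of \<open>\<Phi>\<close> the curve is analytic only in a root of
its natural parameter.\<close>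

definition analytic_reparam :: "(real \<Rightarrow> complex) \<Rightarrow> real \<Rightarrow> real \<Rightarrow> bool" where
  "analytic_reparam \<Gamma> a b \<longleftrightarrow> (\<exists>n m. 0 < n \<and> strict_mono_on {0..real n} m \<and> continuous_on {0..real n} m \<and>
     m 0 = a \<and> m (real n) = b \<and> (\<forall>i<n. analytic_arc_on (\<Gamma> \<circ> m) (real i) (real (Suc i))))"

lemma analytic_reparamE:
  assumes "analytic_reparam \<Gamma> a b"
  obtains n m where "0 < n" "strict_mono_on {0..real n} m" "continuous_on {0..real n} m" "m 0 = a" "m (real n) = b"
    "\<And>i. i < n \<Longrightarrow> analytic_arc_on (\<Gamma> \<circ> m) (real i) (real (Suc i))"
  using assms unfolding analytic_reparam_def by auto

lemma analytic_reparam_trans: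
  assumes "analytic_reparam \<Gamma> a b" "analytic_reparam \<Gamma> b c"
  shows "analytic_reparam \<Gamma> a c"
proof -
  obtain n m where n: "0 < n" and mono: "strict_mono_on {0..real n} m" and cont: "continuous_on {0..real n} m"
    and ends: "m 0 = a" "m (real n) = b" and arcs: "\<And>i. i < n \<Longrightarrow> analytic_arc_on (\<Gamma> \<circ> m) (real i) (real (Suc i))"
    using analytic_reparamE[OF assms(1)] by blast
  obtain n' m' where n': "0 < n'" and mono': "strict_mono_on {0..real n'} m'" and cont': "continuous_on {0..real n'} m'"
    and ends': "m' 0 = b" "m' (real n') = c" and arcs': "\<And>i. i < n' \<Longrightarrow> analytic_arc_on (\<Gamma> \<circ> m') (real i) (real (Suc i))"
    using analytic_reparamE[OF assms(2)] by blast
  define M where "M = (\<lambda>s. if s \<le> real n then m s else m' (s - real n))"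
  have un: "{0..real (n + n')} = {0..real n} \<union> {real n..real (n + n')}" using n n' by auto
  have "continuous_on {0..real (n + n')} M"
    unfolding un M_def
  proof (rule continuous_on_cases)
    show "continuous_on {real n..real (n + n')} (\<lambda>s. m' (s - real n))"
      by (rule continuous_on_compose2[OF cont']) (auto intro!: continuous_intros)
  qed (use cont ends ends' in auto)
  moreover have "strict_mono_on {0..real (n + n')} M"
  proof (rule strict_mono_onI)
    fix r s assume rs: "r \<in> {0..real (n + n')}" "s \<in> {0..real (n + n')}" "r < s"
    consider "s \<le> n" | "r \<le> n" "n < s" | "n < r" using rs by linarith
    then show "M r < M s"
    proof cases
      case 1 then show ?thesis using strict_mono_onD[OF mono] rs by (simp add: M_def)
    next
      case 2
      have "m r \<le> b"
        using mono_onD[OF strict_mono_on_imp_mono_on[OF mono], of r "real n"] rs 2 ends by auto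
      moreover have "b < m' (s - real n)"
        using strict_mono_onD[OF mono', of 0 "s - real n"] rs 2 ends' by auto
      ultimately show ?thesis using 2 by (simp add: M_def)
    next
      case 3 then show ?thesis using strict_mono_onD[OF mono', of "r - real n" "s - real n"] rs by (simp add: M_def)
    qed
  qed
  moreover have "analytic_arc_on (\<Gamma> \<circ> M) (real i) (real (Suc i))" if "i < n + n'" for i
  proof (cases "i < n")
    case True
    then show ?thesis by (intro analytic_arc_on_cong[OF arcs]) (auto simp: M_def)
  next
    case False
    then have "i - n < n'" using that by simp
    from arcs'[OF this] have "analytic_arc_on (\<Gamma> \<circ> m') (1 * real i + (- real n)) (1 * real (Suc i) + (- real n))"
      using False by (simp add: of_nat_diff algebra_simps)
    from analytic_arc_on_affine[OF this] have "analytic_arc_on (\<lambda>s. (\<Gamma> \<circ> m') (1 * s + (- real n))) (real i) (real (Suc i))"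
      by simp
    then show ?thesis
    proof (rule analytic_arc_on_cong)
      fix s assume "s \<in> {real i..real (Suc i)}"
      then have "s = real n \<or> real n < s" using False by auto
      then show "(\<Gamma> \<circ> m') (1 * s + - real n) = (\<Gamma> \<circ> M) s" using ends ends' by (auto simp: M_def)
    qed
  qed
  moreover have "M 0 = a" "M (real (n + n')) = c" using ends ends' n n' by (auto simp: M_def)
  ultimately show ?thesis unfolding analytic_reparam_def using n by (intro exI[of _ "n + n'"] exI[of _ M]) auto
qed

text \<open>Near \<open>\<Gamma> x0\<close> write \<open>F = \<xi>\<^sup>n\<close> with \<open>\<xi>\<close> locally biholomorphic. Then \<open>\<xi>(\<Gamma>(x0 + s\<^sup>n)) / s\<close> is continuous
for \<open>s > 0\<close> and takes values in the finite set of \<open>n\<close>-th roots of \<open>k\<close>, so it is a constant \<open>\<eta>\<close>, and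
\<open>\<Gamma>(x0 + s\<^sup>n) = \<xi>\<^sup>-\<^sup>1(\<eta> s)\<close>. The sign \<open>k\<close> allows the same statement to serve both sides of \<open>x0\<close>.\<close>

lemma root_parametrisation:
  fixes \<Gamma> :: "real \<Rightarrow> complex" and F :: "complex \<Rightarrow> complex"
  assumes F: "F holomorphic_on S" "open S" "\<Gamma> x0 \<in> S" and d: "0 < d"
    and cont: "continuous_on {x0..<x0 + d} \<Gamma>"
    and eq: "\<And>x. x \<in> {x0..<x0 + d} \<Longrightarrow> F (\<Gamma> x) = of_real (k * (x - x0))" and k: "k = 1 \<or> k = -1"
  obtains n h e where "0 < n" "regular_germ h e"
    "\<And>s. 0 \<le> s \<Longrightarrow> s < e \<Longrightarrow> \<Gamma> (x0 + s ^ n) = h (of_real s)"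
proof -
  define u0 where "u0 = \<Gamma> x0"
  have F0: "F u0 = 0" using eq[of x0] d by (simp add: u0_def)
  obtain r0 where r0: "0 < r0" "ball u0 r0 \<subseteq> S" using F(2,3) by (metis u0_def open_contains_ball)
  have holF: "F holomorphic_on ball u0 r0" using F(1) r0(2) holomorphic_on_subset by blast
  have tend: "(\<Gamma> \<longlongrightarrow> u0) (at_right x0)"
  proof -
    have "(\<Gamma> \<longlongrightarrow> u0) (at x0 within {x0..<x0 + d})"
      using cont d by (simp add: continuous_on_def u0_def)
    then have "(\<Gamma> \<longlongrightarrow> u0) (at x0 within {x0..x0 + d/2})"
      by (rule tendsto_within_subset) (use d in auto)
    then show ?thesis
      using d by (simp add: at_within_Icc_at_right)
  qed
  have ex: "\<exists>i>0. (deriv ^^ i) F u0 \<noteq> 0"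
  proof (rule ccontr)
    assume none: "\<not> ?thesis"
    have const: "F u = F u0" if "u \<in> ball u0 r0" for u
    proof (rule holomorphic_fun_eq_const_on_connected[OF holF])
      show "(deriv ^^ i) F u0 = 0" if "0 < i" for i
        using none that by blast
    qed (use that r0 in auto)
    have "\<forall>\<^sub>F x in at_right x0. \<Gamma> x \<in> ball u0 r0"
      using tendstoD[OF tend r0(1)] by (simp add: dist_commute)
    moreover have "\<forall>\<^sub>F x in at_right x0. x \<in> {x0<..<x0 + d}"
      using d by (intro eventually_at_right_real) auto
    ultimately have "\<forall>\<^sub>F x in at_right x0. False"
    proof eventually_elim
      case (elim x)
      have "F (\<Gamma> x) = 0" using const elim F0 by simp
      then show ?case using eq[of x] elim k by auto
    qed
    then show False by (simp add: trivial_limit_at_right_real eventually_False)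
  qed
  define n where "n = (LEAST i. 0 < i \<and> (deriv ^^ i) F u0 \<noteq> 0)"
  have n: "0 < n" "(deriv ^^ n) F u0 \<noteq> 0" using LeastI_ex[OF ex] by (auto simp: n_def)
  have least: "(deriv ^^ i) F u0 = 0" if "0 < i" "i < n" for i
    using not_less_Least[of i "\<lambda>i. 0 < i \<and> (deriv ^^ i) F u0 \<noteq> 0"] that by (auto simp: n_def)
  obtain g r where gr: "0 < r" "g holomorphic_on ball u0 r"
      "\<And>u. u \<in> ball u0 r \<Longrightarrow> F u - F u0 = ((u - u0) * g u) ^ n" "\<And>u. u \<in> ball u0 r \<Longrightarrow> g u \<noteq> 0"
    by (rule holomorphic_factor_order_of_zero_strong[OF holF open_ball centre_in_ball[THEN iffD2, OF r0(1)] n least]) blast+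
  define \<xi> where "\<xi> = (\<lambda>u. (u - u0) * g u)"
  have hol\<xi>: "\<xi> holomorphic_on ball u0 r" unfolding \<xi>_def by (intro holomorphic_intros gr)
  have "(\<xi> has_field_derivative g u0) (at u0)"
  proof -
    have "(g has_field_derivative deriv g u0) (at u0)"
      using gr(1,2) by (simp add: holomorphic_derivI)
    then show ?thesis unfolding \<xi>_def by (auto intro!: derivative_eq_intros)
  qed
  then have "deriv \<xi> u0 \<noteq> 0" using gr(1,4) DERIV_imp_deriv by force
  then obtain r1 where r1: "0 < r1" "ball u0 r1 \<subseteq> ball u0 r" "inj_on \<xi> (ball u0 r1)"
    using has_complex_derivative_locally_injective[OF hol\<xi>] gr(1) by (metis centre_in_ball open_ball)
  have hol1: "\<xi> holomorphic_on ball u0 r1" using hol\<xi> r1(2) holomorphic_on_subset by blast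
  obtain h0 where h0: "h0 holomorphic_on (\<xi> ` ball u0 r1)"
      "\<And>u. u \<in> ball u0 r1 \<Longrightarrow> deriv \<xi> u * deriv h0 (\<xi> u) = 1" "\<And>u. u \<in> ball u0 r1 \<Longrightarrow> h0 (\<xi> u) = u"
    using holomorphic_has_inverse[OF hol1 open_ball r1(3)] by metis
  have "open (\<xi> ` ball u0 r1)" using open_mapping_thm3[OF hol1 open_ball r1(3)] .
  moreover have "\<xi> u0 = 0" by (simp add: \<xi>_def)
  then have "0 \<in> \<xi> ` ball u0 r1" using r1(1) by (metis centre_in_ball imageI)
  ultimately obtain e0 where e0: "0 < e0" "ball 0 e0 \<subseteq> \<xi> ` ball u0 r1" by (metis open_contains_ball)
  have "\<forall>\<^sub>F x in at_right x0. \<Gamma> x \<in> ball u0 r1"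
    using tendstoD[OF tend r1(1)] by (simp add: dist_commute)
  then obtain b where b: "x0 < b" "\<And>x. x0 < x \<Longrightarrow> x < b \<Longrightarrow> \<Gamma> x \<in> ball u0 r1"
    unfolding eventually_at_right_field by blast
  \<comment> \<open>The bound 1 ensures \<open>s\<^sup>n \<le> s\<close>, so that \<open>x0 + s\<^sup>n\<close> stays in the interval controlled by \<open>b\<close> and \<open>d\<close>.\<close>
  define e where "e = Min {e0, 1, b - x0, d}"
  have e: "0 < e" "e \<le> e0" "e \<le> 1" "e \<le> b - x0" "e \<le> d" using e0 b d by (auto simp: e_def)
  have pw: "0 < s ^ n \<and> s ^ n < e" if "0 < s" "s < e" for s :: real
  proof -
    have "s ^ n \<le> s" using that e(3) n(1) power_decreasing[of 1 n s] by simp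
    then show ?thesis using that by auto
  qed
  have inball: "\<Gamma> (x0 + s ^ n) \<in> ball u0 r1" if "0 < s" "s < e" for s
    using pw[OF that] b(2) e by auto
  define q where "q = (\<lambda>s. \<xi> (\<Gamma> (x0 + s ^ n)) / of_real s)"
  have qn: "q s ^ n = of_real k" if s: "s \<in> {0<..<e}" for s
  proof -
    have "\<xi> (\<Gamma> (x0 + s ^ n)) ^ n = F (\<Gamma> (x0 + s ^ n))"
      using gr(3)[of "\<Gamma> (x0 + s ^ n)"] inball[of s] s r1(2) F0 by (auto simp: \<xi>_def)
    also have "\<dots> = of_real (k * s ^ n)" using eq[of "x0 + s ^ n"] pw[of s] s e by auto
    finally show ?thesis using s by (simp add: q_def power_divide)
  qed
  have "q constant_on {0<..<e}"
  proof (rule continuous_finite_range_constant)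
    show "continuous_on {0<..<e} q"
      unfolding q_def
    proof (intro continuous_intros continuous_on_compose2[OF holomorphic_on_imp_continuous_on[OF hol1]]
        continuous_on_compose2[OF cont])
      show "(\<lambda>s. x0 + s ^ n) ` {0<..<e} \<subseteq> {x0..<x0 + d}" using pw e by fastforce
      show "(\<lambda>s. \<Gamma> (x0 + s ^ n)) ` {0<..<e} \<subseteq> ball u0 r1" using inball by auto
    qed auto
    have "finite {z :: complex. z ^ n = of_real k}"
      using finite_nth_roots[of n "of_real k"] n by simp
    then show "finite (q ` {0<..<e})" by (rule rev_finite_subset) (use qn in auto)
  qed auto
  then obtain \<eta> where \<eta>: "\<And>s. s \<in> {0<..<e} \<Longrightarrow> q s = \<eta>" unfolding constant_on_def by blast
  have "cmod \<eta> ^ n = 1"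
    using qn[of "e/2"] \<eta>[of "e/2"] e(1) k by (auto simp flip: norm_power)
  then have n\<eta>: "cmod \<eta> = 1" using n(1) power_eq_iff_eq_base[of n "cmod \<eta>" 1] by simp
  define h where "h = (\<lambda>z. h0 (\<eta> * z))"
  have mem: "\<eta> * z \<in> \<xi> ` ball u0 r1" if "z \<in> ball 0 e" for z
    using that e0(2) e(2) n\<eta> by (auto simp: norm_mult subset_iff)
  show thesis
  proof (rule that[OF n(1)])
    have "h holomorphic_on ball 0 e"
      unfolding h_def using holomorphic_on_compose_gen[OF _ h0(1), of "\<lambda>z. \<eta> * z" "ball 0 e"] mem
      by (simp add: o_def image_subset_iff)
    moreover have "deriv h z \<noteq> 0" if z: "z \<in> ball 0 e" for z
    proof -
      have "(h0 has_field_derivative deriv h0 (\<eta> * z)) (at (\<eta> * z))"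
        using h0(1) mem[OF z] \<open>open (\<xi> ` ball u0 r1)\<close> holomorphic_derivI by blast
      then have "(h has_field_derivative deriv h0 (\<eta> * z) * \<eta>) (at z)"
        unfolding h_def by (rule DERIV_chain2) (auto intro!: derivative_eq_intros)
      then have "deriv h z = deriv h0 (\<eta> * z) * \<eta>" by (rule DERIV_imp_deriv)
      moreover have "deriv h0 (\<eta> * z) \<noteq> 0" using mem[OF z] h0(2) by fastforce
      ultimately show ?thesis using n\<eta> by auto
    qed
    ultimately show "regular_germ h e" using e(1) by (simp add: regular_germ_def)
    show "\<Gamma> (x0 + s ^ n) = h (of_real s)" if "0 \<le> s" "s < e" for s
    proof (cases "s = 0")
      case True
      then show ?thesis using h0(3)[of u0] r1(1) n(1) \<open>\<xi> u0 = 0\<close> by (simp add: h_def u0_def zero_power)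
    next
      case False
      then have s: "s \<in> {0<..<e}" using that by auto
      then have "\<xi> (\<Gamma> (x0 + s ^ n)) = \<eta> * of_real s" using \<eta>[OF s] by (auto simp: q_def field_simps)
      then show ?thesis using h0(3)[of "\<Gamma> (x0 + s ^ n)"] inball[of s] s by (simp add: h_def)
    qed
  qed
qed

lemma analytic_reparam_right:
  assumes n: "0 < n" and germ: "regular_germ h e"
    and eq: "\<And>s. 0 \<le> s \<Longrightarrow> s < e \<Longrightarrow> \<Gamma> (x0 + s ^ n) = h (of_real s)"
    and y: "x0 < y" "y < x0 + e ^ n"
  shows "analytic_reparam \<Gamma> x0 y"
proof -
  have h: "0 < e" "h holomorphic_on ball 0 e" "\<And>z. z \<in> ball 0 e \<Longrightarrow> deriv h z \<noteq> 0"
    using germ by (auto simp: regular_germ_def)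
  define L where "L = root n (y - x0)"
  have L: "0 < L" "L ^ n = y - x0" using y n by (auto simp: L_def)
  have Le: "L < e"
  proof -
    have "L ^ n < e ^ n" using L y by simp
    then show ?thesis using h(1) by (meson power_less_imp_less_base less_imp_le)
  qed
  define m where "m = (\<lambda>s. x0 + (L * s) ^ n)"
  have "analytic_arc_on (\<lambda>s. \<Gamma> (x0 + s ^ n)) 0 L"
    unfolding analytic_arc_on_def
  proof (intro exI[of _ h] conjI ballI)
    show "h analytic_on (complex_of_real ` {0..L})"
      by (rule analytic_on_subset[of h "ball 0 e"]) (use Le h(2) in \<open>auto simp: analytic_on_open\<close>)
  qed (use h eq Le in auto)
  then have "analytic_arc_on (\<lambda>s. \<Gamma> (x0 + s ^ n)) (L * 0 + 0) (L * 1 + 0)" by simp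
  from analytic_arc_on_affine[OF this L(1)] have "analytic_arc_on (\<Gamma> \<circ> m) 0 1" by (simp add: m_def o_def)
  moreover have "strict_mono_on {0..1} m"
    unfolding m_def using L n by (intro strict_mono_onI) (auto intro!: power_strict_mono)
  moreover have "continuous_on {0..1} m" unfolding m_def by (intro continuous_intros)
  ultimately show ?thesis
    unfolding analytic_reparam_def using L n
    by (intro exI[of _ 1] exI[of _ m]) (auto simp: m_def)
qed

lemma analytic_reparam_left:
  assumes n: "0 < n" and germ: "regular_germ h e"
    and eq: "\<And>s. 0 \<le> s \<Longrightarrow> s < e \<Longrightarrow> \<Gamma> (x0 - s ^ n) = h (of_real s)"
    and y: "y < x0" "x0 - e ^ n < y"
  shows "analytic_reparam \<Gamma> y x0"
proof -
  have h: "0 < e" "h holomorphic_on ball 0 e" "\<And>z. z \<in> ball 0 e \<Longrightarrow> deriv h z \<noteq> 0"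
    using germ by (auto simp: regular_germ_def)
  define L where "L = root n (x0 - y)"
  have L: "0 < L" "L ^ n = x0 - y" using y n by (auto simp: L_def)
  have Le: "L < e"
  proof -
    have "L ^ n < e ^ n" using L y by simp
    then show ?thesis using h(1) by (meson power_less_imp_less_base less_imp_le)
  qed
  define m where "m = (\<lambda>s. x0 - (L * (1 - s)) ^ n)"
  have "analytic_arc_on (\<lambda>s. \<Gamma> (x0 - (- s) ^ n)) (- L) 0"
    unfolding analytic_arc_on_def
  proof (intro exI[of _ "\<lambda>z. h (- z)"] conjI ballI)
    have *: "(\<lambda>z. h (- z)) holomorphic_on ball 0 e"
      using holomorphic_on_compose_gen[OF _ h(2), of "\<lambda>z. - z" "ball 0 e"]
      by (simp add: o_def holomorphic_on_minus image_subset_iff)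
    show "(\<lambda>z. h (- z)) analytic_on (complex_of_real ` {- L..0})"
      by (rule analytic_on_subset[of _ "ball 0 e"]) (use * Le in \<open>auto simp: analytic_on_open\<close>)
    fix s assume s: "s \<in> {- L..0}"
    show "\<Gamma> (x0 - (- s) ^ n) = h (- complex_of_real s)" using eq[of "- s"] s Le by simp
    have mem: "- complex_of_real s \<in> ball 0 e" using s Le by auto
    have "(h has_field_derivative deriv h (- of_real s)) (at (- of_real s))"
      using h(2) mem holomorphic_derivI by blast
    then have "((\<lambda>z. h (- z)) has_field_derivative deriv h (- of_real s) * (- 1)) (at (of_real s))"
      by (rule DERIV_chain2) (auto intro!: derivative_eq_intros)
    then show "deriv (\<lambda>z. h (- z)) (complex_of_real s) \<noteq> 0"
      using h(3)[OF mem] DERIV_imp_deriv by force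
  qed
  then have "analytic_arc_on (\<lambda>s. \<Gamma> (x0 - (- s) ^ n)) (L * 0 + (- L)) (L * 1 + (- L))" by simp
  from analytic_arc_on_affine[OF this L(1)] have "analytic_arc_on (\<Gamma> \<circ> m) 0 1"
    by (rule analytic_arc_on_cong) (simp add: m_def algebra_simps)
  moreover have "strict_mono_on {0..1} m"
    unfolding m_def using L n by (intro strict_mono_onI) (auto intro!: power_strict_mono)
  moreover have "continuous_on {0..1} m" unfolding m_def by (intro continuous_intros)
  ultimately show ?thesis
    unfolding analytic_reparam_def using L n
    by (intro exI[of _ 1] exI[of _ m]) (auto simp: m_def)
qed

text \<open>The bound on \<open>q - p\<close> together with \<open>p \<le> x0 \<le> q\<close> is the form of a local hypothesis in the bisection
principle \<open>Bolzano\<close>, which glues the pieces.\<close>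

lemma analytic_reparam_local:
  fixes \<Gamma> :: "real \<Rightarrow> complex" and F :: "complex \<Rightarrow> complex"
  assumes F: "F holomorphic_on S" "open S" "\<Gamma> x0 \<in> S" and d: "0 < d"
    and cont: "continuous_on {x0 - d<..<x0 + d} \<Gamma>"
    and eq: "\<And>x. x \<in> {x0 - d<..<x0 + d} \<Longrightarrow> F (\<Gamma> x) = of_real (x - x0)"
  shows "\<exists>e>0. \<forall>p q. p \<le> x0 \<and> x0 \<le> q \<and> q - p < e \<longrightarrow> (p < q \<longrightarrow> analytic_reparam \<Gamma> p q)"
proof -
  have "\<exists>e>0. \<forall>q. x0 < q \<and> q < x0 + e \<longrightarrow> analytic_reparam \<Gamma> x0 q"
  proof -
    have 1: "continuous_on {x0..<x0 + d} \<Gamma>" using cont d by (auto intro: continuous_on_subset)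
    have 2: "F (\<Gamma> x) = of_real (1 * (x - x0))" if "x \<in> {x0..<x0 + d}" for x using eq[of x] that d by auto
    obtain n h e where *: "0 < n" "regular_germ h e"
       "\<And>s. 0 \<le> s \<Longrightarrow> s < e \<Longrightarrow> \<Gamma> (x0 + s ^ n) = h (of_real s)"
      by (rule root_parametrisation[OF F d 1 2]) auto
    then show ?thesis using analytic_reparam_right[OF *] by (intro exI[of _ "e ^ n"]) (auto simp: regular_germ_def)
  qed
  then obtain e1 where e1: "0 < e1" "\<And>q. x0 < q \<Longrightarrow> q < x0 + e1 \<Longrightarrow> analytic_reparam \<Gamma> x0 q" by blast
  have "\<exists>e>0. \<forall>p. p < x0 \<and> x0 - e < p \<longrightarrow> analytic_reparam \<Gamma> p x0"
  proof -
    define \<Gamma>' where "\<Gamma>' = (\<lambda>x. \<Gamma> (x0 - x))"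
    have 1: "continuous_on {0..<0 + d} \<Gamma>'"
      unfolding \<Gamma>'_def by (rule continuous_on_compose2[OF cont]) (auto intro!: continuous_intros)
    have 2: "F (\<Gamma>' x) = of_real ((- 1) * (x - 0))" if "x \<in> {0..<0 + d}" for x
      using eq[of "x0 - x"] that d by (auto simp: \<Gamma>'_def)
    have 3: "\<Gamma>' 0 \<in> S" using F by (simp add: \<Gamma>'_def)
    obtain n h e where *: "0 < n" "regular_germ h e"
       "\<And>s. 0 \<le> s \<Longrightarrow> s < e \<Longrightarrow> \<Gamma>' (0 + s ^ n) = h (of_real s)"
      by (rule root_parametrisation[OF F(1,2) 3 d 1 2]) auto
    then show ?thesis using analytic_reparam_left[OF *(1,2), of \<Gamma> x0] *
      by (intro exI[of _ "e ^ n"]) (auto simp: \<Gamma>'_def regular_germ_def)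
  qed
  then obtain e2 where e2: "0 < e2" "\<And>p. p < x0 \<Longrightarrow> x0 - e2 < p \<Longrightarrow> analytic_reparam \<Gamma> p x0" by blast
  show ?thesis
  proof (intro exI[of _ "min e1 e2"] conjI allI impI)
    fix p q assume pq: "p \<le> x0 \<and> x0 \<le> q \<and> q - p < min e1 e2" "p < q"
    show "analytic_reparam \<Gamma> p q"
      using pq e1(2)[of q] e2(2)[of p] analytic_reparam_trans[of \<Gamma> p x0 q]
      by (cases "p = x0"; cases "q = x0") auto
  qed (use e1 e2 in auto)
qed

lemma Jordan_curve_of_analytic_reparam:
  assumes "analytic_reparam \<Gamma> a b" and cont: "continuous_on {a..b} \<Gamma>" and loop: "\<Gamma> a = \<Gamma> b"
    and inj: "\<And>x y. x \<in> {a..b} \<Longrightarrow> y \<in> {a..b} \<Longrightarrow> \<Gamma> x = \<Gamma> y \<Longrightarrow> x < y \<Longrightarrow> x = a \<and> y = b"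
  shows "piecewise_analytic_Jordan_curve (\<Gamma> ` {a..b})"
proof -
  obtain n m where n: "0 < n" and mono: "strict_mono_on {0..real n} m" and contm: "continuous_on {0..real n} m"
    and ends: "m 0 = a" "m (real n) = b" and arcs: "\<And>i. i < n \<Longrightarrow> analytic_arc_on (\<Gamma> \<circ> m) (real i) (real (Suc i))"
    using analytic_reparamE[OF assms(1)] by blast
  have im: "m ` {0..real n} = {a..b}"
  proof (intro equalityI subsetI)
    fix y assume "y \<in> m ` {0..real n}"
    then obtain s where s: "s \<in> {0..real n}" "y = m s" by auto
    have "mono_on {0..real n} m" using mono by (rule strict_mono_on_imp_mono_on)
    then have "m 0 \<le> m s" "m s \<le> m (real n)" using s(1) by (auto elim!: mono_onD)
    then show "y \<in> {a..b}" using ends s(2) by simp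
  next
    fix y assume "y \<in> {a..b}"
    then show "y \<in> m ` {0..real n}"
      using IVT'[of m 0 y "real n"] contm ends n by auto
  qed
  define \<gamma> where "\<gamma> = (\<lambda>s. \<Gamma> (m (real n * s)))"
  have scale: "(\<lambda>s. real n * s) ` {0..1} = {0..real n}"
    using n image_mult_atLeastAtMost[of "real n" 0 1] by simp
  have "path_image \<gamma> = \<Gamma> ` {a..b}"
    unfolding path_image_def \<gamma>_def using im scale by (metis (no_types) image_image)
  moreover have "path \<gamma>"
    unfolding path_def \<gamma>_def
    by (intro continuous_on_compose2[OF cont] continuous_on_compose2[OF contm])
      (use im scale in \<open>auto intro!: continuous_intros simp: image_image[symmetric]\<close>)
  moreover have "loop_free \<gamma>"
  proof -
    have *: "x = 0 \<and> y = 1" if "x \<in> {0..1}" "y \<in> {0..1}" "\<gamma> x = \<gamma> y" "x < y" for x y :: real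
    proof -
      have mem: "real n * x \<in> {0..real n}" "real n * y \<in> {0..real n}" using that(1,2) scale by blast+
      have lt: "m (real n * x) < m (real n * y)"
        using strict_mono_onD[OF mono mem] that n by simp
      have "m (real n * x) = a \<and> m (real n * y) = b"
        using that im mem by (intro inj[OF _ _ _ lt]) (auto simp only: \<gamma>_def)
      moreover have "inj_on m {0..real n}" using mono strict_mono_on_imp_inj_on by blast
      ultimately have "real n * x = 0 \<and> real n * y = real n" using ends mem n
        by (metis inj_onD atLeastAtMost_iff of_nat_0_le_iff order_refl)
      then show ?thesis using n by simp
    qed
    then show ?thesis unfolding loop_free_def by (metis linorder_neqE)
  qed
  moreover have "pathfinish \<gamma> = pathstart \<gamma>"
    using loop ends by (simp add: pathfinish_def pathstart_def \<gamma>_def)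
  moreover have "piecewise_analytic_path \<gamma>"
    unfolding piecewise_analytic_path_def
  proof (intro exI[of _ n] exI[of _ "\<lambda>i. real i / real n"] conjI allI impI)
    fix i assume i: "i < n"
    show "real i / real n < real (Suc i) / real n" using n by (simp add: divide_strict_right_mono)
    have "analytic_arc_on (\<Gamma> \<circ> m) (real n * (real i / real n) + 0) (real n * (real (Suc i) / real n) + 0)"
      using arcs[OF i] n by simp
    from analytic_arc_on_affine[OF this] show "analytic_arc_on \<gamma> (real i / real n) (real (Suc i) / real n)"
      using n by (simp add: \<gamma>_def o_def)
  qed (use n in auto)
  ultimately show ?thesis unfolding piecewise_analytic_Jordan_curve_def simple_path_def by blast
qed

section \<open>Separately holomorphic functions as double power series\<close>

text \<open>Taylor's formula for the \<open>n\<close>-th derivative, with the derivative of order \<open>n + 2\<close> bounded by Cauchy's inequality. The point is that the bound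
depends on \<open>f\<close> only through \<open>M\<close>, hence is uniform over a bounded family.\<close>

lemma field_differentiable_remainder:
  fixes f :: "complex \<Rightarrow> complex"
  assumes hol: "f holomorphic_on S" "open S" and sub: "cball y (2 * \<rho>) \<subseteq> S" and \<rho>: "0 < \<rho>"
    and bd: "\<And>z. z \<in> S \<Longrightarrow> cmod (f z) \<le> M" and h: "cmod h \<le> \<rho>"
  shows "cmod ((deriv ^^ n) f (y + h) - (deriv ^^ n) f y - (deriv ^^ Suc n) f y * h)
    \<le> fact (n + 2) * M / \<rho> ^ (n + 2) * (cmod h)\<^sup>2"
proof -
  have mem: "z \<in> S" if "z \<in> cball y \<rho>" for z
    using sub \<rho> that by (auto simp: subset_iff)
  have B: "cmod ((deriv ^^ (n + 2)) f z) \<le> fact (n + 2) * M / \<rho> ^ (n + 2)" if z: "z \<in> cball y \<rho>" for z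
  proof (rule Cauchy_inequality[OF _ _ \<rho>])
    have zs: "cball z \<rho> \<subseteq> S"
    proof
      fix v assume "v \<in> cball z \<rho>"
      then have "dist y v \<le> 2 * \<rho>" using z dist_triangle[of y v z] by simp
      then show "v \<in> S" using sub by auto
    qed
    then show "f holomorphic_on ball z \<rho>" "continuous_on (cball z \<rho>) f"
      using hol holomorphic_on_subset holomorphic_on_imp_continuous_on continuous_on_subset ball_subset_cball by meson+
    show "cmod (f x) \<le> M" if "cmod (z - x) = \<rho>" for x
      using zs that by (intro bd) (auto simp: dist_norm)
  qed
  have "cmod ((deriv ^^ (n + 0)) f (y + h) - (\<Sum>i\<le>1. (deriv ^^ (n + i)) f y * ((y + h) - y) ^ i / fact i))
      \<le> (fact (n + 2) * M / \<rho> ^ (n + 2)) * cmod ((y + h) - y) ^ Suc 1 / fact 1"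
  proof (rule complex_Taylor[of "cball y \<rho>" 1 "\<lambda>i. (deriv ^^ (n + i)) f"])
    show "((deriv ^^ (n + i)) f has_field_derivative (deriv ^^ (n + Suc i)) f x) (at x within cball y \<rho>)"
      if "x \<in> cball y \<rho>" for i x
    proof -
      have "(deriv ^^ (n + i)) f holomorphic_on S" by (rule holomorphic_higher_deriv[OF hol])
      from holomorphic_derivI[OF this hol(2) mem[OF that]] show ?thesis
        by (simp add: has_field_derivative_at_within)
    qed
    show "cmod ((deriv ^^ (n + Suc 1)) f z) \<le> fact (n + 2) * M / \<rho> ^ (n + 2)" if "z \<in> cball y \<rho>" for z
      using B[OF that] by simp
  qed (use \<rho> h in \<open>auto simp: dist_norm\<close>)
  then show ?thesis by (simp add: power2_eq_square algebra_simps)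
qed

text \<open>Each derivative in the second variable is a limit of difference quotients, which are holomorphic in the
first variable; the limit is locally uniform by the preceding estimate.\<close>

lemma holomorphic_on_higher_deriv_parameter:
  fixes F :: "complex \<Rightarrow> complex \<Rightarrow> complex"
  assumes "open A" "open B" and y: "\<And>s. s \<in> A \<Longrightarrow> F s holomorphic_on B"
    and s: "\<And>y. y \<in> B \<Longrightarrow> (\<lambda>s. F s y) holomorphic_on A"
    and bd: "\<And>s y. s \<in> A \<Longrightarrow> y \<in> B \<Longrightarrow> cmod (F s y) \<le> M"
    and "y \<in> B"
  shows "(\<lambda>s. (deriv ^^ n) (F s) y) holomorphic_on A"
  using \<open>y \<in> B\<close>
proof (induction n arbitrary: y)
  case 0 then show ?case using s by simp
next
  case (Suc n)
  obtain r where r: "0 < r" "cball y r \<subseteq> B" using \<open>open B\<close> Suc.prems open_contains_cball by blast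
  define \<rho> where "\<rho> = r / 2"
  have \<rho>: "0 < \<rho>" "cball y (2 * \<rho>) \<subseteq> B" using r by (auto simp: \<rho>_def)
  define C where "C = fact (n + 2) * M / \<rho> ^ (n + 2)"
  define D where "D = (\<lambda>k s. ((deriv ^^ n) (F s) (y + of_real (\<rho> / Suc k)) - (deriv ^^ n) (F s) y) / of_real (\<rho> / Suc k))"
  show ?case
  proof (rule holomorphic_uniform_sequence[OF \<open>open A\<close>])
    show "D k holomorphic_on A" for k
    proof -
      have "y + of_real (\<rho> / Suc k) \<in> cball y (2 * \<rho>)"
        using \<rho>(1) norm_of_real[of "\<rho> / Suc k", where 'a = complex] mult_left_mono[of 1 "2 * real (Suc k)" \<rho>]
        by (simp add: dist_norm divide_le_eq del: of_real_divide of_real_of_nat_eq)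
      then show ?thesis unfolding D_def using \<rho> Suc by (intro holomorphic_intros) auto
    qed
    fix x assume "x \<in> A"
    then obtain d where d: "0 < d" "cball x d \<subseteq> A" using \<open>open A\<close> open_contains_cball by blast
    have err: "cmod (D k s - (deriv ^^ Suc n) (F s) y) \<le> C * \<rho> * (1 / Suc k)" if "s \<in> A" for k s
    proof -
      define h where "h = \<rho> / Suc k"
      have h: "0 < h" "h \<le> \<rho>" using \<rho>(1) by (auto simp: h_def divide_le_eq)
      have "cmod ((deriv ^^ n) (F s) (y + of_real h) - (deriv ^^ n) (F s) y - (deriv ^^ Suc n) (F s) y * of_real h) \<le> C * h\<^sup>2"
        using field_differentiable_remainder[OF y[OF that] \<open>open B\<close> \<rho>(2,1) bd[OF that], of "of_real h" n] h
        by (simp add: C_def)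
      moreover have "D k s - (deriv ^^ Suc n) (F s) y =
        ((deriv ^^ n) (F s) (y + of_real h) - (deriv ^^ n) (F s) y - (deriv ^^ Suc n) (F s) y * of_real h) / of_real h"
      proof -
        have "D k s = ((deriv ^^ n) (F s) (y + of_real h) - (deriv ^^ n) (F s) y) / of_real h"
          by (simp only: D_def h_def)
        then show ?thesis using h by (simp add: diff_divide_distrib)
      qed
      ultimately have "cmod (D k s - (deriv ^^ Suc n) (F s) y) \<le> C * h\<^sup>2 / h"
        using h by (simp add: norm_divide divide_right_mono)
      also have "\<dots> = C * \<rho> * (1 / Suc k)" using h by (simp add: power2_eq_square h_def)
      finally show ?thesis .
    qed
    have lim: "(\<lambda>k. C * \<rho> * (1 / Suc k)) \<longlonglongrightarrow> C * \<rho> * 0"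
      using tendsto_mult_left[OF LIMSEQ_inverse_real_of_nat, of "C * \<rho>"] by (simp add: inverse_eq_divide)
    have "uniform_limit (cball x d) D (\<lambda>s. (deriv ^^ Suc n) (F s) y) sequentially"
    proof (rule uniform_limitI)
      fix e :: real assume "0 < e"
      with lim have "\<forall>\<^sub>F k in sequentially. C * \<rho> * (1 / Suc k) < e"
        by (intro order_tendstoD(2)[of _ "C * \<rho> * 0"]) auto
      then show "\<forall>\<^sub>F k in sequentially. \<forall>s\<in>cball x d. dist (D k s) ((deriv ^^ Suc n) (F s) y) < e"
      proof eventually_elim
        case (elim k)
        then show ?case
          unfolding dist_norm using le_less_trans[OF err elim] d(2) by blast
      qed
    qed
    then show "\<exists>d>0. cball x d \<subseteq> A \<and> uniform_limit (cball x d) D (\<lambda>s. (deriv ^^ Suc n) (F s) y) sequentially"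
      using d by blast
  qed
qed

text \<open>Expand in the second variable; the coefficients are holomorphic in the first one and inherit Cauchy
bounds, so they can be expanded in turn. On the polydisk of a quarter of the radius the terms are
dominated by \<open>M 2\<^sup>-\<^sup>m 2\<^sup>-\<^sup>n\<close>, which makes the double series absolutely summable.\<close>

lemma double_power_series:
  fixes F :: "complex \<Rightarrow> complex \<Rightarrow> complex"
  assumes R: "0 < R" and y: "\<And>s. s \<in> ball a R \<Longrightarrow> F s holomorphic_on ball b R"
    and s: "\<And>y. y \<in> ball b R \<Longrightarrow> (\<lambda>s. F s y) holomorphic_on ball a R"
    and bd: "\<And>s y. s \<in> ball a R \<Longrightarrow> y \<in> ball b R \<Longrightarrow> cmod (F s y) \<le> M"
  obtains c where "\<And>s y. cmod (s - a) \<le> R / 4 \<Longrightarrow> cmod (y - b) \<le> R / 4 \<Longrightarrow>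
      ((\<lambda>(m, n). c m n * (s - a) ^ m * (y - b) ^ n) has_sum F s y) UNIV"
proof -
  define r where "r = R / 2"
  have r: "0 < r" "r < R" using R by (auto simp: r_def)
  have M: "0 \<le> M" using order_trans[OF norm_ge_zero bd[of a b]] R by simp
  define d where "d = (\<lambda>n s. (deriv ^^ n) (F s) b / fact n)"
  define c where "c = (\<lambda>m n. (deriv ^^ m) (d n) a / fact m)"
  have hold: "d n holomorphic_on ball a R" for n
    unfolding d_def
    by (intro holomorphic_intros holomorphic_on_higher_deriv_parameter[OF _ _ y s bd]) (use R in auto)
  have bdd: "cmod (d n s) \<le> M / r ^ n" if "s \<in> ball a R" for n s
  proof -
    have "cmod ((deriv ^^ n) (F s) b) \<le> fact n * M / r ^ n"
    proof (rule Cauchy_inequality[OF _ _ r(1)])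
      show "F s holomorphic_on ball b r" "continuous_on (cball b r) (F s)"
        using y[OF that] r holomorphic_on_subset holomorphic_on_imp_continuous_on continuous_on_subset
          subset_ball[of r R b] cball_subset_ball_iff[of b r b R] by (meson less_imp_le, simp) 
      show "cmod (F s x) \<le> M" if "cmod (b - x) = r" for x
        using bd[OF \<open>s \<in> ball a R\<close>] that r by (simp add: dist_norm)
    qed
    then show ?thesis by (simp add: d_def norm_divide divide_le_eq mult.commute)
  qed
  have bdc: "cmod (c m n) \<le> M / r ^ n / r ^ m" for m n
  proof -
    have "cmod ((deriv ^^ m) (d n) a) \<le> fact m * (M / r ^ n) / r ^ m"
    proof (rule Cauchy_inequality[OF _ _ r(1)])
      show "d n holomorphic_on ball a r" using hold[of n] r by (auto elim: holomorphic_on_subset)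
      show "continuous_on (cball a r) (d n)"
        using holomorphic_on_imp_continuous_on[OF hold[of n]] r by (auto elim!: continuous_on_subset)
      show "cmod (d n x) \<le> M / r ^ n" if "cmod (a - x) = r" for x
        using bdd that r by (simp add: dist_norm)
    qed
    then show ?thesis by (simp add: c_def norm_divide divide_le_eq mult.commute)
  qed
  show thesis
  proof (rule that[of c])
    fix s y assume sy: "cmod (s - a) \<le> R / 4" "cmod (y - b) \<le> R / 4"
    have mem: "s \<in> ball a R" "y \<in> ball b R" using sy R by (auto simp: dist_norm norm_minus_commute)
    define f where "f = (\<lambda>(n, m). c m n * (s - a) ^ m * (y - b) ^ n)"
    have fbd: "cmod (f (n, m)) \<le> M * (1/2) ^ n * (1/2) ^ m" for n m
    proof -
      have 1: "cmod (s - a) ^ m \<le> (r / 2) ^ m" "cmod (y - b) ^ n \<le> (r / 2) ^ n"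
        using sy by (auto intro!: power_mono simp: r_def)
      have "cmod (f (n, m)) = cmod (c m n) * cmod (s - a) ^ m * cmod (y - b) ^ n"
        by (simp add: f_def norm_mult norm_power)
      also have "\<dots> \<le> (M / r ^ n / r ^ m) * (r / 2) ^ m * (r / 2) ^ n"
        using bdc[of m n] 1 M r by (intro mult_mono) auto
      also have "\<dots> = M * (1/2) ^ n * (1/2) ^ m" using r by (simp add: power_divide)
      finally show ?thesis .
    qed
    have half: "summable (\<lambda>n. (1/2::real) ^ n)" by (simp add: summable_geometric)
    have sm: "(\<lambda>x. M * (1/2) ^ fst x * (1/2) ^ snd x) summable_on (UNIV \<times> UNIV :: (nat \<times> nat) set)"
    proof (rule summable_on_SigmaI)
      have g: "((\<lambda>m. (1/2::real) ^ m) has_sum 2) UNIV"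
        using norm_summable_imp_has_sum[of "\<lambda>m. (1/2::real) ^ m" 2] geometric_sums[of "1/2::real"] half by simp
      show "((\<lambda>m. M * (1/2) ^ fst (n, m) * (1/2) ^ snd (n, m)) has_sum (M * (1/2) ^ n * 2)) UNIV" for n :: nat
        using has_sum_cmult_right[OF g, of "M * (1/2) ^ n"] by simp
      have "((\<lambda>n. (M * 2) * (1/2) ^ n) has_sum (M * 2) * 2) UNIV" by (rule has_sum_cmult_right[OF g])
      then show "(\<lambda>n. M * (1/2) ^ n * 2) summable_on (UNIV :: nat set)"
        by (auto simp: summable_on_def mult_ac)
    qed (use M in auto)
    have sumf: "f summable_on (UNIV \<times> UNIV)"
    proof (rule abs_summable_summable, rule Infinite_Sum.abs_summable_on_comparison_test)
      show "(\<lambda>x. norm (M * (1/2) ^ fst x * (1/2) ^ snd x)) summable_on (UNIV \<times> UNIV :: (nat \<times> nat) set)"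
        using sm M by (simp add: abs_mult)
    qed (use fbd M in \<open>auto simp: abs_mult\<close>)
    have "(f has_sum F s y) (UNIV \<times> UNIV)"
    proof (rule has_sum_SigmaI[OF _ _ sumf])
      fix n :: nat
      have "((\<lambda>m. c m n * (s - a) ^ m) has_sum d n s) UNIV"
      proof (rule norm_summable_imp_has_sum)
        show "(\<lambda>m. c m n * (s - a) ^ m) sums d n s"
          using holomorphic_power_series[OF hold mem(1), of n] by (simp add: c_def)
        show "summable (\<lambda>m. norm (c m n * (s - a) ^ m))"
        proof (rule summable_comparison_test')
          show "summable (\<lambda>m. (M / r ^ n) * (1/2) ^ m)" using half by (rule summable_mult)
          show "norm (norm (c m n * (s - a) ^ m)) \<le> (M / r ^ n) * (1/2) ^ m" if "0 \<le> m" for m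
          proof -
            have "cmod (c m n) * cmod (s - a) ^ m \<le> (M / r ^ n / r ^ m) * (r / 2) ^ m"
              using bdc[of m n] sy M r by (intro mult_mono power_mono) (auto simp: r_def)
            then show ?thesis using r by (simp add: norm_mult norm_power power_divide)
          qed
        qed
      qed
      from has_sum_cmult_left[OF this, of "(y - b) ^ n"]
      show "((\<lambda>m. f (n, m)) has_sum d n s * (y - b) ^ n) UNIV" by (simp add: f_def)
    next
      show "((\<lambda>n. d n s * (y - b) ^ n) has_sum F s y) UNIV"
      proof (rule norm_summable_imp_has_sum)
        show "(\<lambda>n. d n s * (y - b) ^ n) sums F s y"
          using holomorphic_power_series[OF y[OF mem(1)] mem(2)] by (simp add: d_def)
        show "summable (\<lambda>n. norm (d n s * (y - b) ^ n))"
        proof (rule summable_comparison_test')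
          show "summable (\<lambda>n. M * (1/2) ^ n)" using half by (rule summable_mult)
          show "norm (norm (d n s * (y - b) ^ n)) \<le> M * (1/2) ^ n" if "0 \<le> n" for n
          proof -
            have "cmod (d n s) * cmod (y - b) ^ n \<le> (M / r ^ n) * (r / 2) ^ n"
              using bdd[OF mem(1)] sy M r by (intro mult_mono power_mono) (auto simp: r_def)
            then show ?thesis using r by (simp add: norm_mult norm_power power_divide)
          qed
        qed
      qed
    qed
    then have "((\<lambda>(m, n). f (n, m)) has_sum F s y) (UNIV \<times> UNIV)"
      by (rule has_sum_swap[THEN iffD1])
    then show "((\<lambda>(m, n). c m n * (s - a) ^ m * (y - b) ^ n) has_sum F s y) UNIV"
      by (simp add: f_def)
  qed
qed

lemma real_analytic2_at_Re:
  fixes F :: "complex \<Rightarrow> complex \<Rightarrow> complex"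
  assumes R: "0 < R" and y: "\<And>s. s \<in> ball (of_real a) R \<Longrightarrow> F s holomorphic_on ball (of_real b) R"
    and s: "\<And>y. y \<in> ball (of_real b) R \<Longrightarrow> (\<lambda>s. F s y) holomorphic_on ball (of_real a) R"
    and bd: "\<And>s y. s \<in> ball (of_real a) R \<Longrightarrow> y \<in> ball (of_real b) R \<Longrightarrow> cmod (F s y) \<le> M"
    and f: "\<And>s y. \<bar>s - a\<bar> < R \<Longrightarrow> \<bar>y - b\<bar> < R \<Longrightarrow> f s y = Re (F (of_real s) (of_real y))"
  shows "real_analytic2_at f a b"
proof -
  obtain c where c: "\<And>s y. cmod (s - of_real a) \<le> R / 4 \<Longrightarrow> cmod (y - of_real b) \<le> R / 4 \<Longrightarrow>
      ((\<lambda>(m, n). c m n * (s - of_real a) ^ m * (y - of_real b) ^ n) has_sum F s y) UNIV"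
    using double_power_series[OF R y s bd] by blast
  show ?thesis
    unfolding real_analytic2_at_def
  proof (intro exI[of _ "\<lambda>m n. Re (c m n)"] exI[of _ "R / 4"] conjI allI impI)
    fix s y :: real assume sy: "\<bar>s - a\<bar> < R / 4" "\<bar>y - b\<bar> < R / 4"
    have "((\<lambda>(m, n). c m n * (of_real s - of_real a) ^ m * (of_real y - of_real b) ^ n) has_sum F (of_real s) (of_real y)) UNIV"
      using sy by (intro c) (auto simp flip: of_real_diff)
    from has_sum_Re[OF this] show "((\<lambda>(m, n). Re (c m n) * (s - a) ^ m * (y - b) ^ n) has_sum f s y) UNIV"
      using f[of s y] sy R by (simp add: case_prod_unfold flip: of_real_diff of_real_power of_real_mult mult.assoc)
  qed (use R in auto)
qed

lemma real_analytic2_at_const: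
  assumes "0 < r" "\<And>s y. \<bar>s - a\<bar> < r \<Longrightarrow> \<bar>y - b\<bar> < r \<Longrightarrow> f s y = k"
  shows "real_analytic2_at f a b"
  by (rule real_analytic2_at_Re[of r _ "\<lambda>_ _. of_real k" _ "\<bar>k\<bar>"]) (use assms in auto)

section \<open>Analytic dependence on time and angle\<close>

lemma has_field_derivative_herglotz:
  assumes "u \<notin> poles a"
  shows "(herglotz a has_field_derivative (cis a / (1 - cis a * u)\<^sup>2 + cis (- a) / (1 - cis (- a) * u)\<^sup>2)) (at u)"
proof -
  define h where "h = (\<lambda>u. ((1 + cis a * u) / (1 - cis a * u) + (1 + cis (- a) * u) / (1 - cis (- a) * u)) / 2)"
  have *: "((\<lambda>u. (1 + p * u) / (1 - p * u)) has_field_derivative 2 * p / (1 - p * u)\<^sup>2) (at u)" if "1 - p * u \<noteq> 0" for p :: complex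
    using that by (auto intro!: derivative_eq_intros simp: power2_eq_square field_simps)
  have "(h has_field_derivative (2 * cis a / (1 - cis a * u)\<^sup>2 + 2 * cis (- a) / (1 - cis (- a) * u)\<^sup>2) / 2) (at u)"
    unfolding h_def using nonpole_factors[OF assms] by (intro DERIV_cdivide DERIV_add *)
  then have "(h has_field_derivative (cis a / (1 - cis a * u)\<^sup>2 + cis (- a) / (1 - cis (- a) * u)\<^sup>2)) (at u)"
    by (simp add: add_divide_distrib)
  then show ?thesis
  proof (rule has_field_derivative_transform_within_open[of _ _ _ "- poles a"])
    show "open (- poles a)" by (intro open_Compl finite_imp_closed) auto
    show "h v = herglotz a v" if "v \<in> - poles a" for v
      using herglotz_split[of v a] that by (simp add: h_def)
  qed (use assms in auto)
qed

lemma norm_deriv_herglotz_le: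
  assumes "u \<notin> poles a"
  shows "cmod (deriv (herglotz a) u) \<le> 2 * pole_sum a u"
proof -
  have "cmod (deriv (herglotz a) u) \<le> cmod (cis a / (1 - cis a * u)\<^sup>2) + cmod (cis (- a) / (1 - cis (- a) * u)\<^sup>2)"
    unfolding DERIV_imp_deriv[OF has_field_derivative_herglotz[OF assms]] by (rule norm_triangle_ineq)
  also have "\<dots> = 2 * pole_sum a u" by (simp add: pole_sum_def norm_divide norm_power)
  finally show ?thesis .
qed

text \<open>The derivative of \<open>herglotz\<close> is at most twice the pole sum, which the inequality of the region bounds by
\<open>2 kappa |u| / (T |u|)\<close>, and \<open>2 kappa r < 1\<close> for \<open>r < 1\<close>. Consequently \<open>flow a T\<close> has no critical point in
the part of the region inside the open disk.\<close>

lemma region_contracting: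
  assumes "0 < T" "u \<in> region a T" "cmod u < 1"
  shows "T * cmod u * cmod (deriv (herglotz a) u) < 1"
proof (cases "u = 0")
  case False
  note np = disc_nonpole[OF assms(3), of a]
  have "T * cmod u * cmod (deriv (herglotz a) u) \<le> T * cmod u * (2 * pole_sum a u)"
    using assms(1) by (intro mult_left_mono norm_deriv_herglotz_le[OF np]) auto
  also have "\<dots> \<le> 2 * kappa (cmod u)" using region_iff_pole_sum[OF np, of T] assms(2) by simp
  also have "\<dots> = inv_sinhc (- ln (cmod u))" using kappa_inv_sinhc[of "cmod u"] False assms(3) by simp
  also have "\<dots> < 1" using False assms(3) by (intro inv_sinhc_less_1) simp
  finally show ?thesis .
qed auto

lemma open_prod_ballE:
  fixes a :: "'a::metric_space" and b :: "'b::metric_space"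
  assumes "open U" "(a, b) \<in> U"
  obtains r where "0 < r" "ball a r \<times> ball b r \<subseteq> U"
proof -
  obtain A B where AB: "open A" "open B" "(a, b) \<in> A \<times> B" "A \<times> B \<subseteq> U"
    using open_prod_elim[OF assms] .
  obtain r1 r2 where "0 < r1" "ball a r1 \<subseteq> A" "0 < r2" "ball b r2 \<subseteq> B"
    using AB open_contains_ball by (metis mem_Sigma_iff)
  then show thesis using AB(4) by (intro that[of "min r1 r2"]) (auto simp: subset_iff)
qed

text \<open>The point \<open>inv_flow a T e\<^sup>i\<^sup>y\<close> is a fixed point of \<open>u \<mapsto> exp (i y - T herglotz a u)\<close>, whose derivative there
has modulus less than 1. For complex \<open>T\<close> and \<open>y\<close> nearby this map is a contraction of a small closed
disk, its iterates are holomorphic in each of the parameters, and their uniform limit is a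
holomorphic extension of \<open>inv_flow\<close>. The factor \<open>k\<close> converts the time \<open>t\<close> into \<open>T\<close>.\<close>

lemma real_analytic2_at_inv_flow:
  assumes k: "0 < k" and t0: "0 < t0" and a: "sin a \<noteq> 0"
    and inside: "cmod (inv_flow a (k * t0) (cis x0)) < 1" and g: "g holomorphic_on ball 0 1"
  shows "real_analytic2_at (\<lambda>t x. Re (g (inv_flow a (k * t) (cis x)))) t0 x0"
proof -
  define u0 where "u0 = inv_flow a (k * t0) (cis x0)"
  have kt0: "0 < k * t0" using k t0 by simp
  have u0: "u0 \<in> region a (k * t0)" "flow a (k * t0) u0 = cis x0" "cmod u0 < 1"
    using inv_flow[OF kt0 a, of "cis x0"] inside by (auto simp: u0_def)
  define N where "N = (\<lambda>s y u. exp (\<i> * y - of_real k * s * herglotz a u))"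
  have N_eq: "N (of_real s) (of_real y) u = u \<longleftrightarrow> flow a (k * s) u = cis y" for s y u
  proof -
    have "N (of_real s) (of_real y) u = cis y / exp (of_real (k * s) * herglotz a u)"
      by (simp add: N_def exp_diff cis_conv_exp)
    then show ?thesis by (auto simp: flow_def nonzero_divide_eq_eq)
  qed
  have ball_np: "ball 0 1 \<subseteq> - poles a" using disc_nonpole by auto
  have holh: "herglotz a holomorphic_on ball 0 1" using holomorphic_on_herglotz ball_np by (rule holomorphic_on_subset)
  have conth: "continuous_on (ball 0 1) (herglotz a)" using holh by (rule holomorphic_on_imp_continuous_on)
  have contdh: "continuous_on (ball 0 1) (deriv (herglotz a))"
    using holomorphic_on_imp_continuous_on holomorphic_deriv[OF holh] by blast
  define D where "D = (\<lambda>s y u. - (of_real k * s * deriv (herglotz a) u) * N s y u)"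
  have DN: "(N s y has_field_derivative D s y u) (at u)" if "cmod u < 1" for s y u
  proof -
    have "(herglotz a has_field_derivative deriv (herglotz a) u) (at u)"
      using holomorphic_derivI[OF holh open_ball] that by simp
    then show ?thesis unfolding N_def D_def by (auto intro!: derivative_eq_intros)
  qed
  \<comment> \<open>At the base point \<open>N\<close> has the value \<open>u0\<close>, so its derivative is \<open>- k t0 u0\<close> times that of \<open>herglotz a\<close>.\<close>
  have "cmod (D t0 x0 u0) < 1"
    using region_contracting[OF kt0 u0(1,3)] N_eq[of t0 x0 u0] u0(2) k t0
    by (simp add: D_def norm_mult mult_ac)
  then obtain q where q: "cmod (D t0 x0 u0) < q" "q < 1" using dense by blast
  have q0: "0 \<le> q" using q(1) norm_ge_zero[of "D t0 x0 u0"] by linarith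
  define U where "U = (UNIV \<times> ball 0 1) \<inter> (\<lambda>x. cmod (D (fst (fst x)) (snd (fst x)) (snd x))) -` {..<q}"
  have "open U"
    unfolding U_def D_def N_def
    by (intro continuous_open_preimage open_Times continuous_intros continuous_on_compose2[OF conth]
        continuous_on_compose2[OF contdh]) auto
  moreover have "((of_real t0, of_real x0), u0) \<in> U" using u0 q by (simp add: U_def)
  ultimately obtain \<delta>' where \<delta>': "0 < \<delta>'" "ball (complex_of_real t0, complex_of_real x0) \<delta>' \<times> ball u0 \<delta>' \<subseteq> U"
    by (rule open_prod_ballE)
  obtain r1 where r1: "0 < r1" "ball (complex_of_real t0) r1 \<times> ball (complex_of_real x0) r1 \<subseteq> ball (of_real t0, of_real x0) \<delta>'"
    using open_prod_ballE[OF open_ball centre_in_ball[THEN iffD2, OF \<delta>'(1)]] .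
  define \<delta> where "\<delta> = \<delta>' / 2"
  have \<delta>: "0 < \<delta>" "cball u0 \<delta> \<subseteq> ball u0 \<delta>'" using \<delta>' by (auto simp: \<delta>_def)
  \<comment> \<open>Displacing the centre by less than \<open>(1 - q) \<delta>\<close> keeps the disk of radius \<open>\<delta>\<close> invariant.\<close>
  define U2 where "U2 = (\<lambda>x. cmod (N (fst x) (snd x) u0 - u0)) -` {..<(1 - q) * \<delta>}"
  have "open U2"
    unfolding U2_def N_def by (intro open_vimage open_lessThan continuous_intros)
  moreover have "(of_real t0, of_real x0) \<in> U2" using N_eq[of t0 x0 u0] u0 q \<delta> by (simp add: U2_def)
  ultimately obtain r2 where r2: "0 < r2" "ball (complex_of_real t0) r2 \<times> ball (complex_of_real x0) r2 \<subseteq> U2"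
    by (rule open_prod_ballE)
  define U3 where "U3 = ({0<..} \<times> UNIV) \<inter> (\<lambda>x. inv_flow a (k * fst x) (cis (snd x))) -` ball u0 \<delta>"
  have "continuous_on ({0<..} \<times> UNIV) (\<lambda>x. (\<lambda>(T, z). inv_flow a T z) (k * fst x, cis (snd x)))"
    by (rule continuous_on_compose2[OF continuous_on_inv_flow[OF a]])
      (use k in \<open>auto intro!: continuous_intros\<close>)
  then have "continuous_on ({0<..} \<times> UNIV) (\<lambda>x. inv_flow a (k * fst x) (cis (snd x)))" by simp
  then have "open U3"
    unfolding U3_def by (intro continuous_open_preimage open_Times) auto
  moreover have "(t0, x0) \<in> U3" using t0 \<delta> by (simp add: U3_def u0_def)
  ultimately obtain r3 where r3: "0 < r3" "ball t0 r3 \<times> ball x0 r3 \<subseteq> U3"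
    by (rule open_prod_ballE)
  define R where "R = min r1 (min r2 r3)"
  have R: "0 < R" "R \<le> r1" "R \<le> r2" "R \<le> r3" using r1 r2 r3 by (auto simp: R_def)
  define A where "A = ball (complex_of_real t0) R"
  define B where "B = ball (complex_of_real x0) R"
  have small: "cmod (D s y u) < q" "cmod u < 1" if "s \<in> A" "y \<in> B" "u \<in> cball u0 \<delta>" for s y u
  proof -
    have "((s, y), u) \<in> U"
      using that R(2) r1(2) \<delta>'(2) \<delta>(2) by (auto simp: A_def B_def subset_iff)
    then show "cmod (D s y u) < q" "cmod u < 1" by (auto simp: U_def)
  qed
  have Nu0: "cmod (N s y u0 - u0) < (1 - q) * \<delta>" if "s \<in> A" "y \<in> B" for s y
  proof -
    have "(s, y) \<in> U2" using that R(3) r2(2) by (auto simp: A_def B_def subset_iff)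
    then show ?thesis by (simp add: U2_def)
  qed
  have u0mem: "u0 \<in> cball u0 \<delta>" using \<delta>(1) by simp
  have contr: "dist (N s y u) (N s y v) \<le> q * dist u v"
    if sy: "s \<in> A" "y \<in> B" and uv: "u \<in> cball u0 \<delta>" "v \<in> cball u0 \<delta>" for s y u v
    unfolding dist_norm
    by (rule field_differentiable_bound[OF convex_cball[of u0 \<delta>], of _ "D s y"])
      (use small[OF sy] uv DN in \<open>auto intro: has_field_derivative_at_within less_imp_le\<close>)
  have maps: "N s y u \<in> cball u0 \<delta>" if sy: "s \<in> A" "y \<in> B" and u: "u \<in> cball u0 \<delta>" for s y u
  proof -
    have "dist u0 (N s y u) \<le> dist u0 (N s y u0) + dist (N s y u0) (N s y u)" by (rule dist_triangle)
    also have "\<dots> \<le> (1 - q) * \<delta> + q * \<delta>"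
      using Nu0[OF sy] contr[OF sy u0mem u] mult_left_mono[of "dist u0 u" \<delta> q] u q0
      by (simp add: dist_norm norm_minus_commute)
    finally show ?thesis by (simp add: algebra_simps)
  qed
  define W where "W = (\<lambda>s y. THE u. u \<in> cball u0 \<delta> \<and> N s y u = u)"
  have ex1: "\<exists>!u. u \<in> cball u0 \<delta> \<and> N s y u = u" if sy: "s \<in> A" "y \<in> B" for s y
  proof -
    have "\<exists>!u\<in>cball u0 \<delta>. N s y u = u"
      using maps[OF sy] contr[OF sy] q(2) q0 \<delta>(1) by (intro Banach_fix) (auto simp: complete_eq_closed)
    then show ?thesis by blast
  qed
  have W: "W s y \<in> cball u0 \<delta>" "N s y (W s y) = W s y" if "s \<in> A" "y \<in> B" for s y
    using theI'[OF ex1[OF that]] by (auto simp: W_def)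
  have W_unique: "W s y = u" if "s \<in> A" "y \<in> B" "u \<in> cball u0 \<delta>" "N s y u = u" for s y u
    using ex1[OF that(1,2)] W[OF that(1,2)] that(3,4) by blast
  define I where "I = (\<lambda>n s y. (N s y ^^ n) u0)"
  have I_mem: "I n s y \<in> cball u0 \<delta>" if "s \<in> A" "y \<in> B" for n s y
    by (induction n) (use maps[OF that] u0mem in \<open>auto simp: I_def\<close>)
  have I_lim: "dist (I n s y) (W s y) \<le> q ^ n * \<delta>" if sy: "s \<in> A" "y \<in> B" for n s y
  proof (induction n)
    case 0 then show ?case using W(1)[OF sy] by (simp add: I_def)
  next
    case (Suc n)
    have "dist (I (Suc n) s y) (W s y) = dist (N s y (I n s y)) (N s y (W s y))"
      using W(2)[OF sy] by (simp add: I_def)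
    also have "\<dots> \<le> q * dist (I n s y) (W s y)" by (intro contr sy I_mem W)
    also have "\<dots> \<le> q * (q ^ n * \<delta>)" using Suc q0 by (rule mult_left_mono)
    finally show ?case by simp
  qed
  have I1: "cmod (I n s y) < 1" if "s \<in> A" "y \<in> B" for n s y
    using small(2)[OF that I_mem[OF that]] .
  have hol_s: "(\<lambda>s. I n s y) holomorphic_on A" if y: "y \<in> B" for n y
  proof (induction n)
    case (Suc n)
    have "(herglotz a \<circ> (\<lambda>s. I n s y)) holomorphic_on A"
      by (rule holomorphic_on_compose_gen[OF Suc holh]) (use I1 y in auto)
    then have "(\<lambda>s. N s y (I n s y)) holomorphic_on A"
      unfolding N_def by (intro holomorphic_intros) (simp add: o_def)
    then show ?case by (simp add: I_def)
  qed (simp add: I_def)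
  have hol_y: "I n s holomorphic_on B" if s: "s \<in> A" for n s
  proof (induction n)
    case (Suc n)
    have "(herglotz a \<circ> I n s) holomorphic_on B"
      by (rule holomorphic_on_compose_gen[OF Suc holh]) (use I1 s in auto)
    then have "(\<lambda>y. N s y (I n s y)) holomorphic_on B"
      unfolding N_def by (intro holomorphic_intros) (simp add: o_def)
    then show ?case by (simp add: I_def)
  next
    case 0 show ?case unfolding I_def by (simp add: holomorphic_on_const)
  qed
  have limq: "(\<lambda>n. q ^ n * \<delta>) \<longlonglongrightarrow> 0"
    using tendsto_mult_right[OF LIMSEQ_power_zero[of q], of \<delta>] q q0 by simp
  have unif: "uniform_limit X f h sequentially"
    if "\<And>n x. x \<in> X \<Longrightarrow> dist (f n x) (h x) \<le> q ^ n * \<delta>" for X :: "complex set" and f :: "nat \<Rightarrow> complex \<Rightarrow> complex" and h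
  proof (rule uniform_limitI)
    fix e :: real assume "0 < e"
    with limq have "\<forall>\<^sub>F n in sequentially. q ^ n * \<delta> < e" by (rule order_tendstoD)
    then show "\<forall>\<^sub>F n in sequentially. \<forall>x\<in>X. dist (f n x) (h x) < e"
    proof eventually_elim
      case (elim n)
      then show ?case using le_less_trans[OF that elim] by blast
    qed
  qed
  have AB: "open A" "open B" by (auto simp: A_def B_def)
  have Ws: "(\<lambda>s. W s y) holomorphic_on A" if y: "y \<in> B" for y
  proof (rule holomorphic_uniform_sequence[OF AB(1) hol_s[OF y]])
    fix x assume "x \<in> A"
    then obtain d where "0 < d" "cball x d \<subseteq> A" using AB(1) open_contains_cball by blast
    then show "\<exists>d>0. cball x d \<subseteq> A \<and> uniform_limit (cball x d) (\<lambda>n s. I n s y) (\<lambda>s. W s y) sequentially"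
      using I_lim y by (intro exI[of _ d] conjI unif) auto
  qed
  have Wy: "W s holomorphic_on B" if s: "s \<in> A" for s
  proof (rule holomorphic_uniform_sequence[OF AB(2) hol_y[OF s]])
    fix x assume "x \<in> B"
    then obtain d where "0 < d" "cball x d \<subseteq> B" using AB(2) open_contains_cball by blast
    then show "\<exists>d>0. cball x d \<subseteq> B \<and> uniform_limit (cball x d) (\<lambda>n. I n s) (W s) sequentially"
      using I_lim s by (intro exI[of _ d] conjI unif) auto
  qed
  have W1: "W s y \<in> ball 0 1" if "s \<in> A" "y \<in> B" for s y using small(2)[OF that W(1)[OF that]] by simp
  have sub1: "cball u0 \<delta> \<subseteq> ball 0 1"
    using small(2)[of "of_real t0" "of_real x0"] R(1) by (auto simp: A_def B_def)
  have "compact (g ` cball u0 \<delta>)"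
    by (intro compact_continuous_image compact_cball holomorphic_on_imp_continuous_on holomorphic_on_subset[OF g sub1])
  then obtain M where M: "\<And>u. u \<in> cball u0 \<delta> \<Longrightarrow> cmod (g u) \<le> M"
    using compact_imp_bounded bounded_iff by (metis imageI)
  show ?thesis
  proof (rule real_analytic2_at_Re[OF R(1), where F = "\<lambda>s y. g (W s y)" and M = M])
    show "(\<lambda>y. g (W s y)) holomorphic_on ball (of_real x0) R" if "s \<in> ball (of_real t0) R" for s
      using holomorphic_on_compose_gen[OF Wy g, of s] W1 that by (auto simp: o_def A_def B_def image_subset_iff)
    show "(\<lambda>s. g (W s y)) holomorphic_on ball (of_real t0) R" if "y \<in> ball (of_real x0) R" for y
      using holomorphic_on_compose_gen[OF Ws g, of y] W1 that by (auto simp: o_def A_def B_def image_subset_iff)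
    show "cmod (g (W s y)) \<le> M" if "s \<in> ball (of_real t0) R" "y \<in> ball (of_real x0) R" for s y
      using M W(1) that by (auto simp: A_def B_def)
    fix t x :: real assume tx: "\<bar>t - t0\<bar> < R" "\<bar>x - x0\<bar> < R"
    have "(t, x) \<in> U3" using tx R(4) r3(2) by (auto simp: dist_real_def subset_iff abs_minus_commute)
    then have t: "0 < t" and u: "inv_flow a (k * t) (cis x) \<in> ball u0 \<delta>" by (auto simp: U3_def)
    have "flow a (k * t) (inv_flow a (k * t) (cis x)) = cis x"
      using inv_flow(2)[OF _ a, of "k * t" "cis x"] k t by simp
    then have "W (of_real t) (of_real x) = inv_flow a (k * t) (cis x)"
      using tx u N_eq by (intro W_unique) (auto simp: A_def B_def dist_norm abs_minus_commute simp flip: of_real_diff)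
    then show "Re (g (inv_flow a (k * t) (cis x))) = Re (g (W (of_real t) (of_real x)))" by simp
  qed
qed

section \<open>The arcs of the unit circle in the boundary curve\<close>

lemma herglotz_cis:
  assumes "cos \<theta> \<noteq> cos a"
  shows "herglotz a (cis \<theta>) = - \<i> * of_real (sin \<theta> / (cos \<theta> - cos a))"
proof -
  have den: "(1 - cis a * cis \<theta>) * (1 - cis (- a) * cis \<theta>) = 2 * cis \<theta> * of_real (cos \<theta> - cos a)"
  proof -
    have 1: "cis a * cis (- a) = 1" by (simp add: cis_mult)
    have 2: "cis a + cis (- a) = 2 * of_real (cos a)" by (simp add: complex_eq_iff)
    have 3: "1 + cis \<theta> * cis \<theta> = 2 * cis \<theta> * of_real (cos \<theta>)"
      using sin_cos_squared_add[of \<theta>] by (simp add: complex_eq_iff power2_eq_square algebra_simps)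
    have "(1 - cis a * cis \<theta>) * (1 - cis (- a) * cis \<theta>) = 1 - (cis a + cis (- a)) * cis \<theta> + (cis a * cis (- a)) * (cis \<theta> * cis \<theta>)"
      by (simp add: algebra_simps)
    also have "\<dots> = 2 * cis \<theta> * of_real (cos \<theta> - cos a)"
      unfolding 1 2 using 3 by (simp add: algebra_simps)
    finally show ?thesis .
  qed
  have num: "1 - (cis \<theta>)\<^sup>2 = - 2 * \<i> * of_real (sin \<theta>) * cis \<theta>"
    using sin_cos_squared_add[of \<theta>] by (simp add: complex_eq_iff power2_eq_square algebra_simps)
  have "- 2 * \<i> * of_real s * p / (2 * p * of_real d) = - \<i> * of_real (s / d)"
    if "p \<noteq> 0" "d \<noteq> 0" for s d :: real and p :: complex
    using that by simp
  from this[of "cis \<theta>" "cos \<theta> - cos a" "sin \<theta>"] show ?thesis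
    unfolding herglotz_def den num using assms by simp
qed

text \<open>The action of the flow map on the angle of a point of the unit circle, see \<open>flow_cis\<close>.\<close>

definition circle_angle :: "real \<Rightarrow> real \<Rightarrow> real \<Rightarrow> real" where
  "circle_angle a T \<theta> = \<theta> - T * (sin \<theta> / (cos \<theta> - cos a))"

lemma flow_cis:
  assumes "cos \<theta> \<noteq> cos a"
  shows "flow a T (cis \<theta>) = cis (circle_angle a T \<theta>)"
  unfolding flow_def herglotz_cis[OF assms] circle_angle_def
  by (simp add: cis_conv_exp flip: exp_add) (simp add: algebra_simps)

lemma cis_in_region_iff:
  "cis \<theta> \<in> region a T \<longleftrightarrow> T * (1 - cos a * cos \<theta>) \<le> (cos \<theta> - cos a)\<^sup>2"
proof -
  have n: "(cmod (1 - cis b * cis \<theta>))\<^sup>2 = 2 - 2 * cos (b + \<theta>)" for b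
    unfolding cis_mult cmod_power2 using sin_cos_squared_add[of "b + \<theta>"]
    by (simp add: power2_eq_square algebra_simps)
  have s: "(2 - 2 * cos (a + \<theta>)) + (2 - 2 * cos (- a + \<theta>)) = 4 * (1 - cos a * cos \<theta>)"
    unfolding cos_add sin_minus cos_minus by (simp add: algebra_simps)
  have p: "(2 - 2 * cos (a + \<theta>)) * (2 - 2 * cos (- a + \<theta>)) = 4 * (cos \<theta> - cos a)\<^sup>2"
    unfolding cos_add sin_minus cos_minus using sin_cos_squared_add[of a] sin_cos_squared_add[of \<theta>] by algebra
  have "T * 1 * (4 * x) \<le> 2 * (1 / 2) * (4 * y) \<longleftrightarrow> T * x \<le> y" for x y :: real by auto
  moreover have "kappa 1 = 1 / 2" by (simp add: kappa_def)
  ultimately show ?thesis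
    unfolding region_def mem_Collect_eq n s p by (simp only: norm_cis order_refl simp_thms)
qed

text \<open>The root exceeding \<open>cos a\<close> of the quadratic equation \<open>T (1 - cos a u) = (u - cos a)\<^sup>2\<close>: the cosine of the
angle at which the boundary curve leaves the unit circle.\<close>

definition corner_cos :: "real \<Rightarrow> real \<Rightarrow> real" where
  "corner_cos a T = cos a - cos a * T / 2 + sqrt (T * (4 * (sin a)\<^sup>2 + (cos a)\<^sup>2 * T)) / 2"

lemma corner_cos_le_iff:
  assumes T: "0 < T" and a: "sin a \<noteq> 0" and u: "cos a < u"
  shows "corner_cos a T \<le> u \<longleftrightarrow> T * (1 - cos a * u) \<le> (u - cos a)\<^sup>2"
    and "cos a < corner_cos a T"
    and "T * (1 - cos a * corner_cos a T) = (corner_cos a T - cos a)\<^sup>2"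
proof -
  define c where "c = cos a"
  define S where "S = sqrt (T * (4 * (sin a)\<^sup>2 + c\<^sup>2 * T))"
  have S2: "S\<^sup>2 = T * (4 * (1 - c\<^sup>2) + c\<^sup>2 * T)"
  proof -
    have "0 \<le> T * (4 * (sin a)\<^sup>2 + c\<^sup>2 * T)" using T by simp
    then show ?thesis unfolding S_def c_def sin_squared_eq by simp
  qed
  have "\<bar>c * T\<bar> < S"
  proof -
    have "(c * T)\<^sup>2 < T * (4 * (sin a)\<^sup>2 + c\<^sup>2 * T)"
    proof -
      have "T * (4 * (sin a)\<^sup>2 + c\<^sup>2 * T) = (c * T)\<^sup>2 + 4 * (T * (sin a)\<^sup>2)"
        by (simp add: power2_eq_square algebra_simps)
      moreover have "0 < T * (sin a)\<^sup>2" using T a by simp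
      ultimately show ?thesis by linarith
    qed
    then have "sqrt ((c * T)\<^sup>2) < S" unfolding S_def by (rule real_sqrt_less_mono)
    then show ?thesis by simp
  qed
  then have S: "c * T < S" "- (c * T) < S" by auto
  define U where "U = corner_cos a T"
  have U: "U = c - c * T / 2 + S / 2" by (simp add: U_def corner_cos_def c_def S_def)
  \<comment> \<open>The second root of the quadratic lies below \<open>cos a\<close>, so for \<open>u > cos a\<close> the sign is that of \<open>u - U\<close>.\<close>
  define U' where "U' = c - c * T / 2 - S / 2"
  have fact: "(v - c)\<^sup>2 - T * (1 - c * v) = (v - U) * (v - U')" for v
  proof -
    have "4 * ((v - U) * (v - U')) = (2 * v - 2 * c + c * T)\<^sup>2 - S\<^sup>2"
      unfolding U U'_def by (simp add: power2_eq_square field_simps)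
    also have "\<dots> = 4 * ((v - c)\<^sup>2 - T * (1 - c * v))"
      unfolding S2 by (simp add: power2_eq_square algebra_simps)
    finally show ?thesis by simp
  qed
  have U': "U' < c" using S by (simp add: U'_def)
  have "0 < u - U'" using U' u by (simp add: c_def)
  then have "U \<le> u \<longleftrightarrow> 0 \<le> (u - U) * (u - U')" by (simp add: zero_le_mult_iff)
  also have "\<dots> \<longleftrightarrow> T * (1 - c * u) \<le> (u - c)\<^sup>2" unfolding fact[symmetric] by linarith
  finally show "corner_cos a T \<le> u \<longleftrightarrow> T * (1 - cos a * u) \<le> (u - cos a)\<^sup>2" by (simp add: U_def c_def)
  show "cos a < corner_cos a T" using S U by (simp add: U_def c_def)
  show "T * (1 - cos a * corner_cos a T) = (corner_cos a T - cos a)\<^sup>2"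
    using fact[of U] by (simp add: U_def c_def)
qed

lemma corner_cos_le_1_iff:
  assumes T: "0 < T" and a: "0 < a" "a < pi"
  shows "corner_cos a T \<le> 1 \<longleftrightarrow> T \<le> 1 - cos a" "corner_cos a T = 1 \<longleftrightarrow> T = 1 - cos a"
proof -
  have s: "sin a \<noteq> 0" and c: "cos a < 1"
    using a sin_gt_zero[of a] cos_monotone_0_pi[of 0 a] by auto
  have "corner_cos a T \<le> 1 \<longleftrightarrow> T * (1 - cos a) \<le> (1 - cos a)\<^sup>2"
    using corner_cos_le_iff(1)[OF T s c] by simp
  also have "\<dots> \<longleftrightarrow> T \<le> 1 - cos a" using c by (simp add: power2_eq_square)
  finally show 1: "corner_cos a T \<le> 1 \<longleftrightarrow> T \<le> 1 - cos a" .
  show "corner_cos a T = 1 \<longleftrightarrow> T = 1 - cos a"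
  proof
    assume "corner_cos a T = 1"
    then have "T * (1 - cos a) = (1 - cos a)\<^sup>2" using corner_cos_le_iff(3)[OF T s c] by simp
    then show "T = 1 - cos a" using c by (simp add: power2_eq_square)
  next
    assume "T = 1 - cos a"
    have "T * (4 * (sin a)\<^sup>2 + (cos a)\<^sup>2 * T) = ((1 - cos a) * (2 + cos a))\<^sup>2"
      unfolding sin_squared_eq \<open>T = 1 - cos a\<close> by (simp add: power2_eq_square algebra_simps)
    moreover have "0 \<le> (1 - cos a) * (2 + cos a)"
      using c cos_ge_minus_one[of a] by (intro mult_nonneg_nonneg) linarith+
    ultimately have "sqrt (T * (4 * (sin a)\<^sup>2 + (cos a)\<^sup>2 * T)) = (1 - cos a) * (2 + cos a)" by simp
    then show "corner_cos a T = 1"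
      unfolding corner_cos_def \<open>T = 1 - cos a\<close> by (simp add: field_simps)
  qed
qed

text \<open>The image under \<open>circle_angle\<close> of the end point of the arc around 1, see \<open>corner_angle_eq\<close>. The quotient
\<open>T / (u - cos a)\<close> at \<open>u = corner_cos a T\<close> is replaced by the equal \<open>(u - cos a) / (1 - cos a u)\<close>, which stays
continuous at \<open>T = 0\<close>.\<close>

definition corner_angle :: "real \<Rightarrow> real \<Rightarrow> real" where
  "corner_angle a T = arccos (corner_cos a T) -
     sqrt (1 - (corner_cos a T)\<^sup>2) * ((corner_cos a T - cos a) / (1 - cos a * corner_cos a T))"

text \<open>The derivative of \<open>corner_angle a\<close>, see \<open>corner_angle_derivative\<close>.\<close>

definition corner_slope :: "real \<Rightarrow> real \<Rightarrow> real" where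
  "corner_slope a T = - sqrt (1 - (corner_cos a T)\<^sup>2) / (corner_cos a T - cos a)"

context
  fixes a :: real assumes a: "0 < a" "a < pi"
begin

lemma sin_a_nz: "sin a \<noteq> 0" using sin_gt_zero[OF a] by simp

lemma cos_a_bounds: "- 1 < cos a" "cos a < 1"
  using cos_monotone_0_pi[of 0 a] cos_monotone_0_pi[of a pi] a by auto

lemma one_minus_cos_mult_pos:
  assumes "\<bar>v\<bar> \<le> 1" shows "0 < 1 - cos a * v"
proof -
  have "\<bar>cos a\<bar> * \<bar>v\<bar> \<le> \<bar>cos a\<bar> * 1" using assms by (intro mult_left_mono) auto
  then have "\<bar>cos a * v\<bar> \<le> \<bar>cos a\<bar>" by (simp add: abs_mult)
  then show ?thesis using cos_a_bounds by linarith
qed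

lemma corner_angle_eq:
  assumes T: "0 < T" "T \<le> 1 - cos a"
  defines "\<theta> \<equiv> arccos (corner_cos a T)"
  shows "corner_angle a T = circle_angle a T \<theta>" "0 \<le> \<theta>" "\<theta> < a" "cos \<theta> = corner_cos a T"
    "corner_angle a T \<le> \<theta>"
proof -
  define U where "U = corner_cos a T"
  note cc = corner_cos_le_iff[OF T(1) sin_a_nz cos_a_bounds(2)]
  have U: "cos a < U" "U \<le> 1" using cc(2) corner_cos_le_1_iff(1)[OF T(1) a] T(2) by (auto simp: U_def)
  have U1: "\<bar>U\<bar> \<le> 1" using U cos_a_bounds by linarith
  note pos = one_minus_cos_mult_pos[OF U1]
  show "cos \<theta> = corner_cos a T" using U U1 by (simp add: \<theta>_def U_def)
  show "0 \<le> \<theta>" using U U1 unfolding \<theta>_def U_def by (intro arccos_lbound) auto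
  have "arccos U < arccos (cos a)" using U cos_a_bounds by (intro arccos_less_arccos) auto
  then show "\<theta> < a" using a by (simp add: \<theta>_def U_def arccos_cos)
  have "sin \<theta> = sqrt (1 - U\<^sup>2)" using U1 by (simp add: \<theta>_def U_def sin_arccos_abs)
  moreover have "T / (U - cos a) = (U - cos a) / (1 - cos a * U)"
    using cc(3) U pos frac_eq_eq[of "U - cos a" "1 - cos a * U" T "U - cos a"]
    by (simp add: U_def power2_eq_square)
  moreover have "T * (sin \<theta> / (U - cos a)) = sin \<theta> * (T / (U - cos a))" by simp
  ultimately show "corner_angle a T = circle_angle a T \<theta>"
    unfolding corner_angle_def circle_angle_def \<open>cos \<theta> = _\<close> U_def[symmetric]
    by (simp only: \<theta>_def U_def)
  show "corner_angle a T \<le> \<theta>"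
    using U U1 pos unfolding corner_angle_def \<theta>_def U_def[symmetric]
    by (simp add: abs_square_le_1)
qed

text \<open>The derivative \<open>1 - T (1 - cos a cos \<theta>) / (cos \<theta> - cos a)\<^sup>2\<close> of \<open>circle_angle\<close> is nonnegative precisely at
the points of the region, that is, on the arc.\<close>

lemma circle_angle_mono:
  assumes T: "0 < T" "T \<le> 1 - cos a" and \<theta>: "\<bar>\<theta>\<bar> \<le> arccos (corner_cos a T)"
  shows "\<bar>circle_angle a T \<theta>\<bar> \<le> corner_angle a T" "corner_cos a T \<le> cos \<theta>"
proof -
  define \<theta>1 where "\<theta>1 = arccos (corner_cos a T)"
  note ca = corner_angle_eq[OF T, folded \<theta>1_def]
  note cc = corner_cos_le_iff[OF T(1) sin_a_nz]
  have ge: "corner_cos a T \<le> cos t" if "\<bar>t\<bar> \<le> \<theta>1" for t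
    using cos_monotone_0_pi_le[of "\<bar>t\<bar>" \<theta>1] that ca a by simp
  show "corner_cos a T \<le> cos \<theta>" using ge \<theta> by (simp add: \<theta>1_def)
  have mono: "circle_angle a T s \<le> circle_angle a T t" if "- \<theta>1 \<le> s" "s \<le> t" "t \<le> \<theta>1" for s t
  proof (rule DERIV_nonneg_imp_nondecreasing[OF that(2)])
    fix r assume r: "s \<le> r" "r \<le> t"
    have "\<bar>r\<bar> \<le> \<theta>1" using r that by linarith
    then have g: "corner_cos a T \<le> cos r" by (rule ge)
    then have gt: "cos a < cos r" using cc(2)[OF cos_a_bounds(2)] by linarith
    have "(circle_angle a T has_real_derivative
        1 - T * ((cos r * (cos r - cos a) - sin r * (- sin r)) / ((cos r - cos a) * (cos r - cos a)))) (at r)"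
    proof -
      have "((\<lambda>t. sin t / (cos t - cos a)) has_real_derivative
          (cos r * (cos r - cos a) - sin r * (- sin r)) / ((cos r - cos a) * (cos r - cos a))) (at r)"
        using gt by (auto intro!: derivative_eq_intros)
      from DERIV_diff[OF DERIV_ident DERIV_cmult[OF this, of T]] show ?thesis
        by (simp only: circle_angle_def [abs_def])
    qed
    moreover have "cos r * (cos r - cos a) - sin r * (- sin r) = 1 - cos a * cos r"
      using sin_cos_squared_add[of r] by (simp add: power2_eq_square algebra_simps)
    moreover have "T * ((1 - cos a * cos r) / ((cos r - cos a) * (cos r - cos a))) \<le> 1"
      using cc(1)[OF gt] g gt by (simp add: power2_eq_square divide_le_eq)
    ultimately show "\<exists>y. (circle_angle a T has_real_derivative y) (at r) \<and> 0 \<le> y" by fastforce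
  qed
  have odd: "circle_angle a T (- t) = - circle_angle a T t" for t by (simp add: circle_angle_def)
  show "\<bar>circle_angle a T \<theta>\<bar> \<le> corner_angle a T"
    using mono[of \<theta> \<theta>1] mono[of "- \<theta>1" \<theta>] \<theta> odd[of \<theta>1] ca(1) by (auto simp: \<theta>1_def abs_le_iff)
qed

text \<open>By the intermediate value theorem \<open>x\<close> is the \<open>circle_angle\<close> of a point of the arc; injectivity of the flow
on the region identifies this point with the value of \<open>inv_flow\<close>.\<close>

lemma inv_flow_circle:
  assumes T: "0 < T" "T \<le> 1 - cos a" and x: "\<bar>x\<bar> \<le> corner_angle a T"
  shows "cmod (inv_flow a T (cis x)) = 1" "cos a < Re (inv_flow a T (cis x))"
proof -
  define \<theta>1 where "\<theta>1 = arccos (corner_cos a T)"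
  note ca = corner_angle_eq[OF T, folded \<theta>1_def]
  note cc = corner_cos_le_iff[OF T(1) sin_a_nz]
  have gt: "cos a < cos t" if "\<bar>t\<bar> \<le> \<theta>1" for t
    using circle_angle_mono(2)[OF T, of t] that cc(2)[OF cos_a_bounds(2)] by (simp add: \<theta>1_def)
  have "circle_angle a T (- \<theta>1) = - circle_angle a T \<theta>1" by (simp add: circle_angle_def)
  then have "\<exists>\<theta>\<ge>-\<theta>1. \<theta> \<le> \<theta>1 \<and> circle_angle a T \<theta> = x"
  proof (intro IVT')
    show "continuous_on {- \<theta>1..\<theta>1} (circle_angle a T)"
    proof -
      have "cos t - cos a \<noteq> 0" if "t \<in> {- \<theta>1..\<theta>1}" for t using gt[of t] that by (auto simp: abs_le_iff)
      then show ?thesis unfolding circle_angle_def by (intro continuous_intros) auto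
    qed
  qed (use x ca in auto)
  then obtain \<theta> where \<theta>: "\<bar>\<theta>\<bar> \<le> \<theta>1" "circle_angle a T \<theta> = x" by (metis abs_le_iff minus_le_iff)
  have "cis \<theta> \<in> region a T"
    using circle_angle_mono(2)[OF T, of \<theta>] \<theta>(1) cc(1)[OF gt[OF \<theta>(1)]]
    by (simp add: cis_in_region_iff \<theta>1_def)
  then have "inv_flow a T (cis x) = cis \<theta>"
    using flow_cis[of \<theta> a T] gt[OF \<theta>(1)] \<theta>(2) by (intro inv_flow_unique T sin_a_nz) auto
  then show "cmod (inv_flow a T (cis x)) = 1" "cos a < Re (inv_flow a T (cis x))"
    using gt[OF \<theta>(1)] by auto
qed

text \<open>Points of the region on the circle to the right of the poles lie on the arc, whose image angles are at most
\<open>corner_angle a T\<close> by monotonicity; the angle \<open>x\<close> is determined modulo \<open>2\<pi>\<close>.\<close>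

lemma inv_flow_circle_converse:
  assumes T: "0 < T" and c: "cmod (inv_flow a T (cis x)) = 1" "cos a < Re (inv_flow a T (cis x))"
  shows "T \<le> 1 - cos a" "\<bar>x\<bar> \<le> pi \<Longrightarrow> \<bar>x\<bar> \<le> corner_angle a T"
proof -
  define v where "v = inv_flow a T (cis x)"
  have v: "v \<in> region a T" "flow a T v = cis x" using inv_flow[OF T sin_a_nz, of "cis x"] by (auto simp: v_def)
  define \<theta> where "\<theta> = Arg v"
  have v_cis: "v = cis \<theta>" using c(1) rcis_cmod_Arg[of v] by (simp add: v_def \<theta>_def rcis_def)
  have gt: "cos a < cos \<theta>" using c(2) v_cis by (simp flip: v_def)
  have ge: "corner_cos a T \<le> cos \<theta>"
    using v(1) cis_in_region_iff corner_cos_le_iff(1)[OF T sin_a_nz gt] by (simp add: v_cis)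
  then have "corner_cos a T \<le> 1" using cos_le_one order_trans by blast
  then show T2: "T \<le> 1 - cos a" using corner_cos_le_1_iff(1)[OF T a] by simp
  assume x: "\<bar>x\<bar> \<le> pi"
  define \<theta>1 where "\<theta>1 = arccos (corner_cos a T)"
  note ca = corner_angle_eq[OF T T2, folded \<theta>1_def]
  have "\<bar>\<theta>\<bar> \<le> pi" using Arg_bounded[of v] by (auto simp: \<theta>_def)
  have \<theta>1: "\<bar>\<theta>\<bar> \<le> \<theta>1"
  proof (rule ccontr)
    assume "\<not> ?thesis"
    then have "cos \<bar>\<theta>\<bar> < cos \<theta>1" using ca(2) \<open>\<bar>\<theta>\<bar> \<le> pi\<close> by (intro cos_monotone_0_pi) auto
    then show False using ge ca(4) by simp
  qed
  then have le: "\<bar>circle_angle a T \<theta>\<bar> \<le> corner_angle a T" using circle_angle_mono(1)[OF T T2] by (simp add: \<theta>1_def)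
  have "cis x = cis (circle_angle a T \<theta>)" using v(2) flow_cis[of \<theta> a T] gt v_cis by auto
  then obtain n :: int where n: "x = circle_angle a T \<theta> + 2 * pi * n"
    unfolding cis_conv_exp exp_eq by (auto simp: complex_eq_iff)
  have "\<bar>2 * pi * n\<bar> < 2 * pi" using n x le ca(3,5) a by linarith
  then have "\<bar>real_of_int n\<bar> < 1" by (simp add: abs_mult)
  then have "n = 0" by simp
  then show "\<bar>x\<bar> \<le> corner_angle a T" using n le by simp
qed

lemma corner_cos_0: "corner_cos a 0 = cos a" by (simp add: corner_cos_def)

lemma corner_angle_0: "corner_angle a 0 = a"
  using a by (simp add: corner_angle_def corner_cos_0 arccos_cos)

lemma corner_angle_end: "corner_angle a (1 - cos a) = 0"
  using corner_cos_le_1_iff(2)[OF _ a, of "1 - cos a"] cos_a_bounds by (simp add: corner_angle_def)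

lemma corner_cos_bounds:
  assumes "0 \<le> T" "T \<le> 1 - cos a"
  shows "cos a \<le> corner_cos a T" "corner_cos a T \<le> 1"
  using corner_cos_le_iff(2)[OF _ sin_a_nz cos_a_bounds(2), of T] corner_cos_le_1_iff(1)[OF _ a, of T]
    corner_cos_0 cos_a_bounds assms by (cases "T = 0"; force)+

lemma continuous_on_corner_angle: "continuous_on {0..1 - cos a} (corner_angle a)"
proof -
  have cont: "continuous_on {0..1 - cos a} (corner_cos a)"
    unfolding corner_cos_def by (intro continuous_intros) auto
  have "\<bar>corner_cos a T\<bar> \<le> 1" if "T \<in> {0..1 - cos a}" for T
    using corner_cos_bounds[of T] that cos_a_bounds by auto
  then show ?thesis
    unfolding corner_angle_def using one_minus_cos_mult_pos
    by (intro continuous_intros continuous_on_arccos cont) (force simp: abs_le_iff less_imp_neq)+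
qed

text \<open>In \<open>corner_angle a T = circle_angle a T \<theta>(T)\<close> the end point \<open>\<theta>(T)\<close> of the arc is a critical point of
\<open>circle_angle a T\<close>, so only the explicit dependence on \<open>T\<close> contributes.\<close>

lemma corner_angle_derivative:
  assumes T: "0 < T" "T < 1 - cos a"
  shows "(corner_angle a has_real_derivative corner_slope a T) (at T)"
proof -
  define \<theta> where "\<theta> = (\<lambda>T. arccos (corner_cos a T))"
  note cc = corner_cos_le_iff[OF T(1) sin_a_nz cos_a_bounds(2)]
  have U: "cos a < corner_cos a T" "corner_cos a T < 1" "\<bar>corner_cos a T\<bar> < 1"
    using cc(2) corner_cos_le_1_iff[OF T(1) a] T(2) cos_a_bounds by force+
  have "0 < T * (4 * (sin a)\<^sup>2 + (cos a)\<^sup>2 * T)"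
    using T(1) sin_a_nz by (intro mult_pos_pos add_pos_nonneg) auto
  then have "\<exists>D. (corner_cos a has_real_derivative D) (at T)"
    unfolding corner_cos_def by (auto intro!: exI derivative_eq_intros)
  then obtain D where D: "(corner_cos a has_real_derivative D) (at T)" ..
  then have "((\<lambda>T. arccos (corner_cos a T)) has_real_derivative inverse (- sqrt (1 - (corner_cos a T)\<^sup>2)) * D) (at T)"
    using U by (intro DERIV_chain2[OF DERIV_arccos]) auto
  then obtain E where E: "(\<theta> has_real_derivative E) (at T)" unfolding \<theta>_def by blast
  note ca = corner_angle_eq[OF T(1) less_imp_le[OF T(2)], folded \<theta>_def]
  have ct: "cos (\<theta> T) = corner_cos a T" using ca(4) by (simp add: \<theta>_def)
  have st: "sin (\<theta> T) = sqrt (1 - (corner_cos a T)\<^sup>2)" using U by (simp add: \<theta>_def sin_arccos_abs)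
  have gt: "cos a < cos (\<theta> T)" using ct U by simp
  define d where "d = cos (\<theta> T) - cos a"
  have d: "d \<noteq> 0" "T * (1 - cos a * cos (\<theta> T)) = d * d" using gt cc(3) by (simp_all add: d_def ct power2_eq_square)
  define q where "q = (cos (\<theta> T) * E * d - sin (\<theta> T) * (- sin (\<theta> T) * E)) / (d * d)"
  have "((\<lambda>T. sin (\<theta> T) / (cos (\<theta> T) - cos a)) has_real_derivative q) (at T)"
    unfolding q_def using gt by (auto intro!: derivative_eq_intros E simp: d_def)
  from DERIV_diff[OF E DERIV_mult[OF DERIV_ident this]]
  have "((\<lambda>T. circle_angle a T (\<theta> T)) has_real_derivative E - (1 * (sin (\<theta> T) / d) + q * T)) (at T)"
    by (simp only: circle_angle_def d_def)
  moreover have "E - (1 * (sin (\<theta> T) / d) + q * T) = corner_slope a T"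
  proof -
    have "cos (\<theta> T) * E * d - sin (\<theta> T) * (- sin (\<theta> T) * E) = E * (1 - cos a * cos (\<theta> T))"
      unfolding d_def using sin_cos_squared_add[of "\<theta> T"] by algebra
    then have "q * T = E * (T * (1 - cos a * cos (\<theta> T))) / (d * d)" by (simp add: q_def)
    also have "\<dots> = E" unfolding d(2) using d(1) by simp
    finally show ?thesis by (simp add: corner_slope_def st ct d_def)
  qed
  ultimately have "((\<lambda>T. circle_angle a T (\<theta> T)) has_real_derivative corner_slope a T) (at T)" by simp
  then show ?thesis
  proof (rule has_field_derivative_transform_within_open[of _ _ _ "{0<..<1 - cos a}"])
    show "circle_angle a S (\<theta> S) = corner_angle a S" if "S \<in> {0<..<1 - cos a}" for S
      using corner_angle_eq(1)[of S] that by (simp add: \<theta>_def)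
  qed (use T in auto)
qed

lemma corner_angle_strict_antimono:
  assumes "0 \<le> S" "S < T" "T \<le> 1 - cos a"
  shows "corner_angle a T < corner_angle a S"
proof (rule DERIV_neg_imp_decreasing_open[OF assms(2)])
  show "\<exists>y. (corner_angle a has_real_derivative y) (at x) \<and> y < 0" if "S < x" "x < T" for x
  proof -
    have x: "0 < x" "x < 1 - cos a" using that assms by auto
    have "cos a < corner_cos a x" "corner_cos a x < 1"
      using corner_cos_le_iff(2)[OF x(1) sin_a_nz cos_a_bounds(2)] corner_cos_le_1_iff[OF x(1) a] x(2) by force+
    moreover from this have "(corner_cos a x)\<^sup>2 < 1" using cos_a_bounds by (simp add: abs_square_less_1)
    ultimately have "corner_slope a x < 0"
      unfolding corner_slope_def by (intro divide_neg_pos) auto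
    then show ?thesis using corner_angle_derivative[OF x] by blast
  qed
  show "continuous_on {S..T} (corner_angle a)"
    using assms by (intro continuous_on_subset[OF continuous_on_corner_angle]) auto
qed

lemma corner_angle_bounds:
  assumes "0 < T" "T < 1 - cos a" shows "0 < corner_angle a T" "corner_angle a T < a"
  using corner_angle_strict_antimono[of 0 T] corner_angle_strict_antimono[of T "1 - cos a"] assms
  by (simp_all add: corner_angle_0 corner_angle_end)

end

text \<open>Differentiating along the real axis commutes with taking real parts.\<close>

lemma higher_deriv_Re_of_real:
  assumes "open S" "h holomorphic_on S" and eq: "\<And>t. of_real t \<in> S \<Longrightarrow> \<phi> t = Re (h (of_real t))"
  shows "of_real t \<in> S \<Longrightarrow> (deriv ^^ k) \<phi> differentiable (at t)"
proof -
  have op: "open {t :: real. complex_of_real t \<in> S}"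
  proof -
    have "continuous_on UNIV complex_of_real" by (intro continuous_intros)
    from open_vimage[OF assms(1) this] show ?thesis by (simp add: vimage_def)
  qed
  have step: "((deriv ^^ k) \<phi> has_real_derivative Re ((deriv ^^ Suc k) h (of_real t))) (at t)"
    if t: "of_real t \<in> S" and IH: "\<And>t. of_real t \<in> S \<Longrightarrow> (deriv ^^ k) \<phi> t = Re ((deriv ^^ k) h (of_real t))" for k t
  proof -
    have "((deriv ^^ k) h has_field_derivative (deriv ^^ Suc k) h (of_real t)) (at (of_real t))"
      using holomorphic_derivI[OF holomorphic_higher_deriv[OF assms(2,1)] assms(1) t] by simp
    then have "((\<lambda>t. (deriv ^^ k) h (of_real t)) has_vector_derivative (deriv ^^ Suc k) h (of_real t)) (at t)"
      by (rule has_vector_derivative_real_field)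
    then have "((\<lambda>t. Re ((deriv ^^ k) h (of_real t))) has_real_derivative Re ((deriv ^^ Suc k) h (of_real t))) (at t)"
      by (rule has_field_derivative_Re)
    then show ?thesis
      by (rule has_field_derivative_transform_within_open[OF _ op]) (use t IH in auto)
  qed
  have main: "(deriv ^^ k) \<phi> t = Re ((deriv ^^ k) h (of_real t))" if "of_real t \<in> S" for k t
    using that
  proof (induction k arbitrary: t)
    case (Suc k)
    then show ?case using DERIV_imp_deriv[OF step[OF Suc.prems Suc.IH]] by simp
  qed (use eq in auto)
  show "of_real t \<in> S \<Longrightarrow> (deriv ^^ k) \<phi> differentiable (at t)"
    using step[OF _ main] real_differentiable_def by blast
qed

text \<open>The derivative is an algebraic function of \<open>T\<close> involving two square roots of positive quantities, so it is
the restriction of a holomorphic function. The affine form \<open>m + l * \<dots>\<close> covers both angle functions.\<close>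

lemma smooth_on_corner_angle:
  assumes a: "0 < a" "a < pi" and \<kappa>: "0 < \<kappa>"
  shows "smooth_on (\<lambda>t. m + l * corner_angle a (\<kappa> * t)) {0<..<(1 - cos a) / \<kappa>}"
proof -
  define \<phi> where "\<phi> = (\<lambda>t. m + l * corner_angle a (\<kappa> * t))"
  define I where "I = {0<..<(1 - cos a) / \<kappa>}"
  define c where "c = complex_of_real (cos a)"
  define r where "r = (\<lambda>z. of_real \<kappa> * z * (4 * of_real ((sin a)\<^sup>2) + c\<^sup>2 * (of_real \<kappa> * z)))"
  define U where "U = (\<lambda>z. c - c * (of_real \<kappa> * z) / 2 + csqrt (r z) / 2)"
  define h where "h = (\<lambda>z. of_real (l * \<kappa>) * (- csqrt (1 - (U z)\<^sup>2) / (U z - c)))"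
  define S1 where "S1 = {z. 0 < Re (r z)}"
  define S where "S = S1 \<inter> U -` {v. 0 < Re (1 - v\<^sup>2) \<and> v \<noteq> c}"
  define S0 where "S0 = S \<inter> {z. 0 < Re z \<and> Re z < (1 - cos a) / \<kappa>}"
  have S1: "open S1"
    unfolding S1_def r_def by (intro open_Collect_less continuous_intros)
  have nonpos: "z \<notin> \<real>\<^sub>\<le>\<^sub>0" if "0 < Re z" for z using that by (auto simp: complex_nonpos_Reals_iff)
  have holU: "U holomorphic_on S1"
    unfolding U_def r_def S1_def by (intro holomorphic_intros) (use nonpos in \<open>auto simp: r_def\<close>)
  have "{v. 0 < Re (1 - v\<^sup>2) \<and> v \<noteq> c} = {v. 0 < Re (1 - v\<^sup>2)} \<inter> - {c}" by auto
  moreover have "open ({v. 0 < Re (1 - v\<^sup>2)} \<inter> - {c})"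
    by (intro open_Int open_Collect_less continuous_intros open_Compl closed_singleton)
  ultimately have "open S"
    unfolding S_def using S1 holU by (intro continuous_open_preimage holomorphic_on_imp_continuous_on) auto
  then have S0: "open S0" unfolding S0_def
    by (intro open_Int open_Collect_conj open_Collect_less continuous_intros)
  have holS0: "U holomorphic_on S0" by (rule holomorphic_on_subset[OF holU]) (auto simp: S0_def S_def)
  have holh: "h holomorphic_on S0"
    unfolding h_def by (intro holomorphic_intros holS0) (use nonpos in \<open>auto simp: S0_def S_def\<close>)
  have real: "U (of_real t) = of_real (corner_cos a (\<kappa> * t))" "of_real t \<in> S0"
     "Re (h (of_real t)) = l * (corner_slope a (\<kappa> * t) * \<kappa>)"
     if t: "t \<in> I" for t
  proof -
    have T: "0 < \<kappa> * t" "\<kappa> * t < 1 - cos a" using t \<kappa> by (auto simp: I_def field_simps)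
    have pos: "0 < \<kappa> * t * (4 * (sin a)\<^sup>2 + (cos a)\<^sup>2 * (\<kappa> * t))"
      by (rule mult_pos_pos[OF T(1)], rule add_pos_nonneg) (use T(1) sin_a_nz[OF a] in auto)
    have r: "r (of_real t) = of_real (\<kappa> * t * (4 * (sin a)\<^sup>2 + (cos a)\<^sup>2 * (\<kappa> * t)))"
      by (simp add: r_def c_def)
    show Ut: "U (of_real t) = of_real (corner_cos a (\<kappa> * t))"
    proof -
      have "csqrt (r (of_real t)) = of_real (sqrt (\<kappa> * t * (4 * (sin a)\<^sup>2 + (cos a)\<^sup>2 * (\<kappa> * t))))"
        unfolding r using pos by (intro of_real_sqrt[symmetric]) simp
      then show ?thesis unfolding U_def corner_cos_def c_def by simp
    qed
    have ub: "cos a < corner_cos a (\<kappa> * t)" "corner_cos a (\<kappa> * t) < 1"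
      using corner_cos_le_iff(2)[OF T(1) sin_a_nz[OF a] cos_a_bounds(2)[OF a]] corner_cos_le_1_iff[OF T(1) a] T(2) by force+
    then have sq: "(corner_cos a (\<kappa> * t))\<^sup>2 < 1" using cos_a_bounds[OF a] by (simp add: abs_square_less_1)
    show "of_real t \<in> S0"
      using pos ub sq t unfolding S0_def S_def S1_def by (simp add: Ut r c_def I_def flip: of_real_power)
    have "h (of_real t) = of_real (l * (corner_slope a (\<kappa> * t) * \<kappa>))"
    proof -
      have "1 - (U (of_real t))\<^sup>2 = of_real (1 - (corner_cos a (\<kappa> * t))\<^sup>2)" by (simp add: Ut)
      then have "csqrt (1 - (U (of_real t))\<^sup>2) = of_real (sqrt (1 - (corner_cos a (\<kappa> * t))\<^sup>2))"
        using sq by (simp add: csqrt_of_real_nonneg del: of_real_diff)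
      then show ?thesis unfolding h_def Ut c_def by (simp add: corner_slope_def)
    qed
    then show "Re (h (of_real t)) = l * (corner_slope a (\<kappa> * t) * \<kappa>)"
      by simp
  qed
  have der: "(\<phi> has_real_derivative Re (h (of_real t))) (at t)" if t: "t \<in> I" for t
  proof -
    have T: "0 < \<kappa> * t" "\<kappa> * t < 1 - cos a" using t \<kappa> by (auto simp: I_def field_simps)
    have "((\<lambda>t. corner_angle a (\<kappa> * t)) has_real_derivative corner_slope a (\<kappa> * t) * \<kappa>) (at t)"
      by (rule DERIV_chain2[where f = "corner_angle a" and g = "\<lambda>t. \<kappa> * t", OF corner_angle_derivative[OF a T]]) (auto intro!: derivative_eq_intros)
    from DERIV_add[OF DERIV_const[of m] DERIV_cmult[OF this, of l]] show ?thesis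
      unfolding \<phi>_def real(3)[OF t] by simp
  qed
  have deq: "deriv \<phi> t = Re (h (of_real t))" if "of_real t \<in> S0" for t
    using der[of t] that by (intro DERIV_imp_deriv) (auto simp: S0_def I_def)
  show ?thesis
    unfolding smooth_on_def \<phi>_def[symmetric] I_def[symmetric]
  proof (intro allI ballI)
    fix k t assume t: "t \<in> I"
    show "(deriv ^^ k) \<phi> differentiable at t"
    proof (cases k)
      case 0 then show ?thesis using der[OF t] real_differentiable_def by auto
    next
      case (Suc j)
      have "(deriv ^^ j) (deriv \<phi>) differentiable at t"
        by (rule higher_deriv_Re_of_real[OF S0 holh deq real(2)[OF t]])
      then show ?thesis using Suc by (simp add: funpow_swap1)
    qed
  qed
qed

section \<open>The logarithm and its boundary values\<close>

text \<open>The closed form of the moment generating function of \<open>f0 \<alpha>\<close> with \<open>a = \<pi>\<alpha>\<close>.\<close>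

definition log_ratio :: "real \<Rightarrow> complex \<Rightarrow> complex" where
  "log_ratio a z = (Ln (1 - cis (- a) * z) - Ln (1 - cis a * z)) / (2 * \<i> * of_real a)"

lemma integral_exp_f0:
  assumes \<alpha>: "0 < \<alpha>" "\<alpha> \<le> 1"
  shows "integral {-pi..pi} (\<lambda>x. exp (\<i> * of_nat (Suc n) * complex_of_real x) * complex_of_real (f0 \<alpha> x))
     = (cis (pi * \<alpha>) ^ Suc n - cis (- (pi * \<alpha>)) ^ Suc n) / (2 * \<i> * of_real (pi * \<alpha>) * of_nat (Suc n))"
proof -
  define a where "a = pi * \<alpha>"
  have a: "0 < a" "a \<le> pi" using \<alpha> by (auto simp: a_def)
  define m where "m = \<i> * of_nat (Suc n)"
  have m: "m \<noteq> 0" by (simp add: m_def del: of_nat_Suc)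
  have "((\<lambda>x. exp (m * of_real x) * of_real (1 / (2 * a))) has_integral
      (exp (m * of_real a) / m - exp (m * of_real (- a)) / m) * of_real (1 / (2 * a))) {- a..a}"
  proof (rule has_integral_mult_left, rule fundamental_theorem_of_calculus)
    fix x assume "x \<in> {- a..a}"
    have "((\<lambda>z. exp (m * z) / m) has_field_derivative exp (m * of_real x)) (at (of_real x))"
      using m by (auto intro!: derivative_eq_intros)
    then show "((\<lambda>x. exp (m * of_real x) / m) has_vector_derivative exp (m * of_real x)) (at x within {- a..a})"
      by (rule has_vector_derivative_at_within[OF has_vector_derivative_real_field])
  qed (use a in auto)
  then have "((\<lambda>x. if x \<in> {- a..a} then exp (m * of_real x) * of_real (1 / (2 * a)) else 0) has_integral
      (exp (m * of_real a) / m - exp (m * of_real (- a)) / m) * of_real (1 / (2 * a))) {-pi..pi}"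
    using a by (subst has_integral_restrict) auto
  moreover have "(\<lambda>x. if x \<in> {- a..a} then exp (m * of_real x) * of_real (1 / (2 * a)) else 0)
      = (\<lambda>x. exp (m * of_real x) * complex_of_real (f0 \<alpha> x))"
    by (auto simp: f0_def a_def indicator_def)
  ultimately have "((\<lambda>x. exp (m * of_real x) * complex_of_real (f0 \<alpha> x)) has_integral
      (exp (m * of_real a) / m - exp (m * of_real (- a)) / m) * of_real (1 / (2 * a))) {-pi..pi}"
    by (simp only:)
  then have "integral {-pi..pi} (\<lambda>x. exp (m * of_real x) * complex_of_real (f0 \<alpha> x))
      = (exp (m * of_real a) / m - exp (m * of_real (- a)) / m) * of_real (1 / (2 * a))"
    by (rule integral_unique)
  also have "\<dots> = (exp (m * of_real a) - exp (m * of_real (- a))) / (2 * of_real a * m)"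
    by (simp add: mult_ac flip: diff_divide_distrib)
  also have "\<dots> = (cis a ^ Suc n - cis (- a) ^ Suc n) / (2 * of_real a * m)"
  proof -
    have "exp (m * of_real b) = cis b ^ Suc n" for b
      unfolding m_def Complex.DeMoivre unfolding cis_conv_exp by (simp add: mult_ac)
    then show ?thesis by (simp only:)
  qed
  finally show ?thesis by (simp add: m_def a_def mult_ac del: power_Suc of_nat_Suc)
qed

lemma mom_gen_f0:
  assumes \<alpha>: "0 < \<alpha>" "\<alpha> \<le> 1" and z: "cmod z < 1"
  shows "mom_gen (f0 \<alpha>) z = log_ratio (pi * \<alpha>) z"
proof -
  let ?I = "\<lambda>n. integral {-pi..pi} (\<lambda>x. exp (\<i> * of_nat (Suc n) * complex_of_real x) * complex_of_real (f0 \<alpha> x))"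
  define a where "a = pi * \<alpha>"
  have *: "(\<lambda>n. (cis b * z) ^ Suc n / of_nat (Suc n)) sums (- Ln (1 - cis b * z))" for b
  proof -
    have "cmod (- (cis b * z)) < 1" using z by (simp add: norm_mult)
    from Ln_series'[OF this] have "(\<lambda>n. - ((cis b * z) ^ n) / of_nat n) sums Ln (1 - cis b * z)" by simp
    then have "(\<lambda>n. - ((cis b * z) ^ Suc n) / of_nat (Suc n)) sums (Ln (1 - cis b * z))"
      by (subst sums_Suc_iff) simp
    from sums_minus[OF this] show ?thesis by simp
  qed
  have "(\<lambda>n. ((cis a * z) ^ Suc n / of_nat (Suc n) - (cis (- a) * z) ^ Suc n / of_nat (Suc n)) / (2 * \<i> * of_real a))
      sums ((- Ln (1 - cis a * z) - - Ln (1 - cis (- a) * z)) / (2 * \<i> * of_real a))"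
    by (intro sums_divide sums_diff *)
  moreover have "z ^ Suc n * ?I n
     = ((cis a * z) ^ Suc n / of_nat (Suc n) - (cis (- a) * z) ^ Suc n / of_nat (Suc n)) / (2 * \<i> * of_real a)" for n
    unfolding integral_exp_f0[OF \<alpha>] power_mult_distrib a_def
    by (simp add: diff_divide_distrib right_diff_distrib mult_ac del: power_Suc of_nat_Suc)
  ultimately have "(\<lambda>n. z ^ Suc n * ?I n)
     sums ((- Ln (1 - cis a * z) - - Ln (1 - cis (- a) * z)) / (2 * \<i> * of_real a))"
    by presburger
  then show ?thesis unfolding mom_gen_def log_ratio_def a_def by (simp add: sums_unique[symmetric])
qed

lemma disk_ext_eq:
  assumes "continuous_on S h" "ball 0 1 \<subseteq> S" "z \<in> S" "cmod z \<le> 1" "\<And>y. y \<in> ball 0 1 \<Longrightarrow> f y = h y"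
  shows "disk_ext f z = h z"
proof -
  have "(h \<longlongrightarrow> h z) (at z within S)" using assms by (simp add: continuous_on_def)
  then have "(h \<longlongrightarrow> h z) (at z within ball 0 1)" using assms(2) by (rule tendsto_within_subset)
  moreover have "\<forall>\<^sub>F y in at z within ball 0 1. h y = f y"
    using assms(5) by (auto simp: eventually_at_filter)
  ultimately have "(f \<longlongrightarrow> h z) (at z within ball 0 1)" by (rule Lim_transform_eventually)
  moreover have "at z within ball 0 1 \<noteq> bot"
    using assms(4) by (simp add: trivial_limit_within islimpt_ball)
  ultimately show ?thesis unfolding disk_ext_def by (intro tendsto_Lim)
qed

lemma Re_one_minus_pos:
  assumes "cmod z \<le> 1" "z \<notin> poles a"
  shows "0 < Re (1 - cis a * z)" "0 < Re (1 - cis (- a) * z)"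
proof -
  have *: "0 < Re (1 - p)" if "cmod p \<le> 1" "p \<noteq> 1" for p
  proof (rule ccontr)
    assume "\<not> ?thesis"
    then have "1 \<le> Re p" by simp
    moreover have "(Re p)\<^sup>2 + (Im p)\<^sup>2 \<le> 1" using that(1) by (metis cmod_power2 norm_ge_zero power_le_one)
    moreover have "1 \<le> (Re p)\<^sup>2" using \<open>1 \<le> Re p\<close> by (simp add: one_le_power)
    ultimately have "(Im p)\<^sup>2 = 0" "(Re p)\<^sup>2 = 1" using zero_le_power2[of "Im p"] by linarith+
    then have "Im p = 0" "Re p = 1" using \<open>1 \<le> Re p\<close> by (auto simp: power2_eq_1_iff)
    then show False using that(2) by (simp add: complex_eq_iff)
  qed
  show "0 < Re (1 - cis a * z)"
    by (rule *) (use nonpole_factors(1)[OF assms(2)] assms(1) in \<open>simp_all add: norm_mult\<close>)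
  show "0 < Re (1 - cis (- a) * z)"
    by (rule *) (use nonpole_factors(2)[OF assms(2)] assms(1) in \<open>simp_all add: norm_mult\<close>)
qed

lemma one_minus_not_nonpos:
  assumes "cmod z \<le> 1" "z \<notin> poles a"
  shows "1 - cis a * z \<notin> \<real>\<^sub>\<le>\<^sub>0" "1 - cis (- a) * z \<notin> \<real>\<^sub>\<le>\<^sub>0"
  using Re_one_minus_pos[OF assms] by (metis complex_nonpos_Reals_iff not_le)+

lemma continuous_on_log_ratio:
  assumes "a \<noteq> 0" shows "continuous_on (cball 0 1 - poles a) (log_ratio a)"
  unfolding log_ratio_def using one_minus_not_nonpos[of _ a] assms
  by (intro continuous_intros) (auto simp del: not_le)

lemma holomorphic_on_log_ratio:
  assumes "a \<noteq> 0" shows "log_ratio a holomorphic_on ball 0 1"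
proof -
  have "1 - cis a * z \<notin> \<real>\<^sub>\<le>\<^sub>0" "1 - cis (- a) * z \<notin> \<real>\<^sub>\<le>\<^sub>0" if "z \<in> ball 0 1" for z
    using one_minus_not_nonpos[of z a] disc_nonpole[of z a] that by auto
  then show ?thesis unfolding log_ratio_def using assms by (intro holomorphic_intros) auto
qed

lemma g0_eq:
  assumes "0 < \<alpha>" "\<alpha> \<le> 1" "cmod z \<le> 1" "z \<notin> poles (pi * \<alpha>)"
  shows "g0 \<alpha> z = log_ratio (pi * \<alpha>) z"
  unfolding g0_def
  by (rule disk_ext_eq[OF continuous_on_log_ratio]) (use assms mom_gen_f0 disc_nonpole in auto)

text \<open>The right-hand side is a Moebius map, so the sine in the definition of \<open>A0\<close> is a rational function of
\<open>z\<close>.\<close>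

lemma exp_log_ratio:
  assumes "z \<notin> poles a" "a \<noteq> 0"
  shows "exp (\<i> * (of_real a * (1 + 2 * log_ratio a z))) = cis a * (1 - cis (- a) * z) / (1 - cis a * z)"
proof -
  have "\<i> * (of_real a * (1 + 2 * log_ratio a z)) = \<i> * of_real a + Ln (1 - cis (- a) * z) - Ln (1 - cis a * z)"
    using assms(2) by (simp add: log_ratio_def field_simps)
  then show ?thesis using nonpole_factors[OF assms(1)] by (simp add: exp_add exp_diff cis_conv_exp)
qed

lemma A0_eq:
  assumes \<alpha>: "0 < \<alpha>" "\<alpha> < 1" and z: "cmod z < 1"
  shows "A0 \<alpha> z = 2 * (of_real pi)\<^sup>2 * herglotz (pi * \<alpha>) z"
proof -
  define a where "a = pi * \<alpha>"
  have a: "0 < a" "a < pi" using \<alpha> by (auto simp: a_def)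
  have np: "z \<notin> poles a" using disc_nonpole[OF z] .
  define P Q where "P = 1 - cis (- a) * z" and "Q = 1 - cis a * z"
  have PQ: "P \<noteq> 0" "Q \<noteq> 0" using nonpole_factors[OF np] by (auto simp: P_def Q_def)
  have cc: "cis a * cis (- a) = 1" by (simp add: cis_mult)
  have d: "cis a - cis (- a) \<noteq> 0" using sin_gt_zero[OF a] by (simp add: complex_eq_iff)
  have E: "exp (\<i> * (of_real a * (1 + 2 * log_ratio a z))) = cis a * P / Q"
    using exp_log_ratio[OF np] a by (simp add: P_def Q_def)
  have E': "exp (- (\<i> * (of_real a * (1 + 2 * log_ratio a z)))) = cis (- a) * Q / P"
    unfolding exp_minus E by (simp flip: cis_inverse add: inverse_eq_divide)
  have "sin (of_real a * (1 + 2 * log_ratio a z)) = (cis a * P / Q - cis (- a) * Q / P) / (2 * \<i>)"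
    unfolding sin_exp_eq E E' ..
  also have "cis a * P / Q - cis (- a) * Q / P = (cis a * P * P - cis (- a) * Q * Q) / (P * Q)"
    using PQ by (simp add: field_simps)
  also have "cis a * P * P - cis (- a) * Q * Q = (cis a - cis (- a)) * (1 - z\<^sup>2)"
    unfolding P_def Q_def using cc by algebra
  finally have s: "sin (of_real a * (1 + 2 * log_ratio a z)) = (cis a - cis (- a)) * (1 - z\<^sup>2) / (P * Q) / (2 * \<i>)" .
  have sa: "sin (complex_of_real a) = (cis a - cis (- a)) / (2 * \<i>)"
    by (simp add: sin_exp_eq cis_conv_exp)
  have "sin (of_real a * (1 + 2 * log_ratio a z)) / sin (complex_of_real a) = herglotz a z"
    unfolding s sa herglotz_def using d by (simp add: P_def Q_def mult.commute)
  moreover have "g0 \<alpha> z = log_ratio a z"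
    using g0_eq[of \<alpha> z] \<alpha> z np by (simp add: a_def)
  ultimately show ?thesis
    by (simp only: A0_def a_def times_divide_eq_right[symmetric])
qed

lemma \<Phi>_eq:
  assumes "0 < \<alpha>" "\<alpha> < 1" "cmod z < 1"
  shows "\<Phi> \<alpha> t z = flow (pi * \<alpha>) (2 * pi\<^sup>2 * t) z"
  unfolding \<Phi>_def flow_def A0_eq[OF assms] by (simp add: mult_ac)

definition arc_density :: "real \<Rightarrow> complex \<Rightarrow> real" where
  "arc_density a z = (1 + 2 * Re (log_ratio a z)) / (2 * pi)"

text \<open>The angle \<open>X = a + 2 a Re (log_ratio a z)\<close> is an argument of the Moebius image
\<open>(e\<^sup>i\<^sup>a - z) / (1 - e\<^sup>i\<^sup>a z)\<close>, which lies in the upper half plane exactly for \<open>|z| < 1\<close>. The range of \<open>X\<close>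
comes from the principal logarithms of numbers with positive real part, and it fixes the branch.\<close>

lemma density_angle:
  assumes a: "0 < a" "a \<le> pi / 2" and z: "cmod z \<le> 1" "z \<notin> poles a"
  obtains X R where "arc_density a z = X / (2 * pi * a)" "0 < R" "- pi < X" "X < 3 * pi / 2"
    "R * sin X = sin a * (1 - (cmod z)\<^sup>2)" "R * cos X = cos a * (1 + (cmod z)\<^sup>2) - 2 * Re z"
proof -
  define L where "L = Ln (1 - cis (- a) * z) - Ln (1 - cis a * z)"
  define X where "X = a + Im L"
  note nz = nonpole_factors[OF z(2)]
  note pos = Re_one_minus_pos[OF z]
  have Ln: "\<bar>Im (Ln (1 - cis a * z))\<bar> < pi / 2" "\<bar>Im (Ln (1 - cis (- a) * z))\<bar> < pi / 2"
    using pos Re_Ln_pos_lt nz by blast+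
  then have X: "- pi < X" "X < 3 * pi / 2" using a by (auto simp: X_def L_def)
  have "Re (log_ratio a z) = Im L / (2 * a)"
    using a by (simp add: log_ratio_def Re_divide power2_eq_square flip: L_def)
  then have dens: "arc_density a z = X / (2 * pi * a)"
    using a by (simp add: arc_density_def X_def field_simps)
  define R where "R = exp (Re L) * (cmod (1 - cis a * z))\<^sup>2"
  have "cis a * exp L = cis a * (1 - cis (- a) * z) / (1 - cis a * z)"
    using nz by (simp add: L_def exp_diff)
  also have "cis a * (1 - cis (- a) * z) = cis a - z"
    by (simp add: right_diff_distrib cis_mult flip: mult.assoc)
  also have "(cis a - z) / (1 - cis a * z) = (cis a - z) * cnj (1 - cis a * z) / of_real ((cmod (1 - cis a * z))\<^sup>2)"
    by (subst complex_div_cnj) simp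
  finally have "cis a * exp L * of_real ((cmod (1 - cis a * z))\<^sup>2) = (cis a - z) * cnj (1 - cis a * z)"
    using nz by simp
  moreover have "cis a * exp L = of_real (exp (Re L)) * cis X"
    by (simp add: X_def exp_eq_polar cis_mult flip: cis_mult)
  ultimately have eq: "of_real R * cis X = (cis a - z) * cnj (1 - cis a * z)"
    by (simp add: R_def mult_ac)
  have rhs: "(cis a - z) * cnj (1 - cis a * z) = cis a - z - cnj z + cis (- a) * of_real ((cmod z)\<^sup>2)"
  proof -
    have "cis a * cnj (cis a) = 1" by (simp add: cis_cnj cis_mult)
    moreover have "z * cnj z = of_real ((cmod z)\<^sup>2)" by (rule complex_norm_square[symmetric])
    ultimately show ?thesis by (simp add: algebra_simps cis_cnj)
  qed
  have "R * cos X = Re (of_real R * cis X)" "R * sin X = Im (of_real R * cis X)" by simp_all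
  then have "R * sin X = sin a * (1 - (cmod z)\<^sup>2)" "R * cos X = cos a * (1 + (cmod z)\<^sup>2) - 2 * Re z"
    unfolding eq rhs by (simp_all add: algebra_simps)
  moreover have "0 < R" using nz by (simp add: R_def)
  ultimately show thesis using that dens X by blast
qed

text \<open>In the open disk \<open>sin X > 0\<close> leaves \<open>0 < X < \<pi>\<close>; on the circle \<open>sin X = 0\<close> leaves \<open>X = 0\<close> and \<open>X = \<pi>\<close>,
distinguished by the sign of \<open>cos X\<close>.\<close>

lemma density_values:
  assumes a: "0 < a" "a \<le> pi / 2"
  shows "cmod z < 1 \<Longrightarrow> 0 < arc_density a z" "cmod z < 1 \<Longrightarrow> arc_density a z < 1 / (2 * a)"
    "cmod z = 1 \<Longrightarrow> cos a < Re z \<Longrightarrow> arc_density a z = 1 / (2 * a)"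
    "cmod z = 1 \<Longrightarrow> Re z < cos a \<Longrightarrow> arc_density a z = 0"
proof -
  have sa: "0 < sin a" using a sin_gt_zero[of a] pi_gt_zero by linarith
  have inside: "0 < arc_density a z \<and> arc_density a z < 1 / (2 * a)" if z: "cmod z < 1"
  proof -
    obtain X R where XR: "arc_density a z = X / (2 * pi * a)" "0 < R" "- pi < X" "X < 3 * pi / 2"
      "R * sin X = sin a * (1 - (cmod z)\<^sup>2)"
      using density_angle[OF a less_imp_le[OF z] disc_nonpole[OF z]] by metis
    have "(cmod z)\<^sup>2 < 1" using z by (simp add: abs_square_less_1)
    then have "0 < R * sin X" using XR(5) sa by simp
    then have "0 < sin X" using XR(2) by (simp add: zero_less_mult_iff)
    have "0 < X"
    proof (rule ccontr)
      assume "\<not> 0 < X"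
      then have "0 \<le> sin (- X)" using XR(3) by (intro sin_ge_zero) auto
      then show False using \<open>0 < sin X\<close> by simp
    qed
    moreover have "X < pi"
    proof (rule ccontr)
      assume "\<not> X < pi"
      then have "0 \<le> sin (X - pi)" using XR(4) by (intro sin_ge_zero) auto
      then show False using \<open>0 < sin X\<close> by simp
    qed
    ultimately have "0 < X / (2 * pi * a)" "X / (2 * pi * a) < pi / (2 * pi * a)"
      using a divide_strict_right_mono[of X pi "2 * pi * a"] by simp_all
    then show ?thesis using XR(1) by simp
  qed
  then show "cmod z < 1 \<Longrightarrow> 0 < arc_density a z" "cmod z < 1 \<Longrightarrow> arc_density a z < 1 / (2 * a)" by auto
  have circle: "\<exists>X R. arc_density a z = X / (2 * pi * a) \<and> 0 < R \<and> (X = 0 \<or> X = pi) \<and> R * cos X = 2 * (cos a - Re z)"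
    if z: "cmod z = 1" "Re z \<noteq> cos a"
  proof -
    have np: "z \<notin> poles a" using z(2) by auto
    obtain X R where XR: "arc_density a z = X / (2 * pi * a)" "0 < R" "- pi < X" "X < 3 * pi / 2"
      "R * sin X = sin a * (1 - (cmod z)\<^sup>2)" "R * cos X = cos a * (1 + (cmod z)\<^sup>2) - 2 * Re z"
      using density_angle[OF a _ np] z(1) by (metis order_refl)
    have "sin X = 0" using XR(2,5) z(1) by simp
    then obtain i :: int where i: "X = of_int i * pi" using sin_zero_iff_int2 by blast
    have "pi * (- 1) < pi * real_of_int i" "pi * real_of_int i < pi * (3 / 2)" using XR(3,4) i by (simp_all add: mult.commute)
    then have "- 1 < real_of_int i" "real_of_int i < 3 / 2" by (simp_all only: mult_less_cancel_left_pos pi_gt_zero)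
    then have "i = 0 \<or> i = 1" by linarith
    then have "X = 0 \<or> X = pi" using i by auto
    then show ?thesis using XR(1,2,6) z(1) by (auto simp: algebra_simps)
  qed
  show "cmod z = 1 \<Longrightarrow> cos a < Re z \<Longrightarrow> arc_density a z = 1 / (2 * a)"
    using circle a by (fastforce simp: field_simps)
  show "cmod z = 1 \<Longrightarrow> Re z < cos a \<Longrightarrow> arc_density a z = 0"
    using circle a by (fastforce simp: mult_less_0_iff)
qed

section \<open>Reflection, boundary cases and the Jordan curve\<close>

lemma reflect_region: "- u \<in> region (pi - a) T \<longleftrightarrow> u \<in> region a T"
proof -
  have c: "cis (pi - a) = - cis (- a)" "cis (a - pi) = - cis a" by (simp_all add: complex_eq_iff)
  show ?thesis unfolding region_def by (simp add: c ac_simps)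
qed

lemma reflect_flow: "flow (pi - a) T (- u) = - flow a T u"
proof -
  have c: "cis (pi - a) = - cis (- a)" "cis (a - pi) = - cis a" by (simp_all add: complex_eq_iff)
  show ?thesis unfolding flow_def herglotz_def by (simp add: c mult.commute)
qed

lemma reflect_inv_flow:
  assumes "0 < T" "sin a \<noteq> 0" "cmod z \<le> 1"
  shows "inv_flow (pi - a) T (- z) = - inv_flow a T z"
  using assms inv_flow[OF assms] by (intro inv_flow_unique) (auto simp: reflect_region reflect_flow)

text \<open>This transports the description of the arc around 1 to the arc around \<open>-1\<close> by the reflection
\<open>u \<mapsto> -u\<close>, \<open>a \<mapsto> \<pi> - a\<close>, under which angles shift by \<open>\<pi>\<close>.\<close>

lemma inv_flow_lower_circle:
  assumes a: "0 < a" "a < pi" and T: "0 < T"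
  shows "T \<le> 1 + cos a \<Longrightarrow> \<bar>x - pi\<bar> \<le> corner_angle (pi - a) T \<or> \<bar>x + pi\<bar> \<le> corner_angle (pi - a) T \<Longrightarrow>
      cmod (inv_flow a T (cis x)) = 1 \<and> Re (inv_flow a T (cis x)) < cos a"
    and "cmod (inv_flow a T (cis x)) = 1 \<Longrightarrow> Re (inv_flow a T (cis x)) < cos a \<Longrightarrow> T \<le> 1 + cos a"
    and "cmod (inv_flow a T (cis x)) = 1 \<Longrightarrow> Re (inv_flow a T (cis x)) < cos a \<Longrightarrow> \<bar>x\<bar> \<le> pi \<Longrightarrow>
      pi - corner_angle (pi - a) T \<le> \<bar>x\<bar>"
proof -
  have a': "0 < pi - a" "pi - a < pi" using a by auto
  have cp: "cos (pi - a) = - cos a" by simp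
  have refl: "inv_flow (pi - a) T (cis y) = - inv_flow a T (cis x)" if "cis y = - cis x" for y
    using reflect_inv_flow[OF T sin_a_nz[OF a], of "cis x"] that by simp
  have m: "cis (x - pi) = - cis x" "cis (x + pi) = - cis x" by (simp_all add: complex_eq_iff)
  show "cmod (inv_flow a T (cis x)) = 1 \<and> Re (inv_flow a T (cis x)) < cos a"
    if T': "T \<le> 1 + cos a" and x: "\<bar>x - pi\<bar> \<le> corner_angle (pi - a) T \<or> \<bar>x + pi\<bar> \<le> corner_angle (pi - a) T"
  proof -
    obtain y where y: "\<bar>y\<bar> \<le> corner_angle (pi - a) T" "cis y = - cis x" using x m by blast
    show ?thesis using inv_flow_circle[OF a' T _ y(1)] T' refl[OF y(2)] by (simp add: cp)
  qed
  show "T \<le> 1 + cos a" if "cmod (inv_flow a T (cis x)) = 1" "Re (inv_flow a T (cis x)) < cos a"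
    using inv_flow_circle_converse(1)[OF a' T, of "x - pi"] that refl[OF m(1)] by (simp add: cp)
  show "pi - corner_angle (pi - a) T \<le> \<bar>x\<bar>"
    if "cmod (inv_flow a T (cis x)) = 1" "Re (inv_flow a T (cis x)) < cos a" "\<bar>x\<bar> \<le> pi"
  proof -
    define y where "y = (if 0 \<le> x then x - pi else x + pi)"
    have y: "cis y = - cis x" "\<bar>y\<bar> = pi - \<bar>x\<bar>" using m that(3) by (auto simp: y_def)
    then have "\<bar>y\<bar> \<le> corner_angle (pi - a) T"
      using inv_flow_circle_converse(2)[OF a' T, of y] that refl[OF y(1)] by (simp add: cp)
    then show ?thesis using y(2) by linarith
  qed
qed

text \<open>A point of the circle with real part \<open>cos a\<close> is a pole, and the region avoids the poles.\<close>

lemma inv_flow_trichotomy: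
  assumes "0 < T" "sin a \<noteq> 0" "cmod z \<le> 1"
  obtains "cmod (inv_flow a T z) < 1" | "cmod (inv_flow a T z) = 1" "cos a < Re (inv_flow a T z)"
    | "cmod (inv_flow a T z) = 1" "Re (inv_flow a T z) < cos a"
proof -
  define v where "v = inv_flow a T z"
  have v: "v \<in> region a T" using inv_flow(1)[OF assms] by (simp add: v_def)
  then have np: "v \<notin> poles a" by (rule region_nonpole[OF assms(1,2)])
  have "Re v \<noteq> cos a" if "cmod v = 1"
  proof
    assume "Re v = cos a"
    moreover have "(Re v)\<^sup>2 + (Im v)\<^sup>2 = 1" using that by (metis cmod_power2 power_one)
    ultimately have "(Im v)\<^sup>2 = (sin a)\<^sup>2" by (simp add: sin_squared_eq)
    then have "Im v = sin a \<or> Im v = - sin a" by (simp add: power2_eq_iff)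
    then show False using np \<open>Re v = cos a\<close> by (auto simp: complex_eq_iff)
  qed
  moreover have "cmod v \<le> 1" using v by (simp add: region_def)
  ultimately show thesis using that unfolding v_def by linarith
qed

text \<open>Locally the curve solves \<open>F(\<Gamma>(x)) = x - x\<^sub>0\<close> with the holomorphic function
\<open>F = - i Ln (flow a T \<cdot> e\<^sup>-\<^sup>i\<^sup>x\<^sup>0)\<close>, so it has analytic reparametrisations near every parameter; bisection makes
this global.\<close>

lemma Jordan_curve_inv_flow:
  assumes T: "0 < T" and a: "sin a \<noteq> 0"
  shows "piecewise_analytic_Jordan_curve (inv_flow a T ` sphere 0 1)"
proof -
  define \<Gamma> where "\<Gamma> = (\<lambda>x. inv_flow a T (cis x))"
  have \<Gamma>: "\<Gamma> x \<in> region a T" "flow a T (\<Gamma> x) = cis x" for x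
    using inv_flow[OF T a, of "cis x"] by (auto simp: \<Gamma>_def)
  have cont: "continuous_on A \<Gamma>" for A
    unfolding \<Gamma>_def by (rule continuous_on_compose2[OF continuous_on_inv_flow_snd[OF T a]]) (auto intro!: continuous_intros)
  have local: "\<exists>e>0. \<forall>p q. p \<le> x0 \<and> x0 \<le> q \<and> q - p < e \<longrightarrow> (p < q \<longrightarrow> analytic_reparam \<Gamma> p q)" for x0
  proof -
    define S where "S = - poles a \<inter> flow a T -` {v. 0 < Re (v * cis (- x0))}"
    define F where "F = (\<lambda>u. - \<i> * Ln (flow a T u * cis (- x0)))"
    have op: "open (- poles a)" by (intro open_Compl finite_imp_closed) auto
    have "open S"
      unfolding S_def
      by (intro continuous_open_preimage[OF holomorphic_on_imp_continuous_on[OF holomorphic_on_flow] op]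
          open_Collect_less continuous_intros)
    moreover have "F holomorphic_on S"
    proof -
      have "flow a T holomorphic_on S" by (rule holomorphic_on_subset[OF holomorphic_on_flow]) (auto simp: S_def)
      moreover have "flow a T u * cis (- x0) \<notin> \<real>\<^sub>\<le>\<^sub>0" if "u \<in> S" for u
        using that by (auto simp: S_def complex_nonpos_Reals_iff simp del: cis.sel times_complex.sel)
      ultimately show ?thesis unfolding F_def by (intro holomorphic_intros) auto
    qed
    moreover have "\<Gamma> x0 \<in> S"
      using region_nonpole[OF T a \<Gamma>(1)] \<Gamma>(2)[of x0] by (simp add: S_def cis_mult)
    moreover have "F (\<Gamma> x) = of_real (x - x0)" if "x \<in> {x0 - 1<..<x0 + 1}" for x
    proof -
      have "flow a T (\<Gamma> x) * cis (- x0) = exp (\<i> * of_real (x - x0))"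
        unfolding \<Gamma>(2) cis_mult unfolding cis_conv_exp by simp
      moreover have "Ln (exp (\<i> * of_real (x - x0))) = \<i> * of_real (x - x0)"
        using that pi_gt3 by (intro Ln_exp) auto
      ultimately show ?thesis by (simp add: F_def)
    qed
    ultimately show ?thesis
      using analytic_reparam_local[of F S \<Gamma> x0 1] cont by auto
  qed
  have "- pi < pi \<longrightarrow> analytic_reparam \<Gamma> (- pi) pi"
  proof (rule Bolzano[where P = "\<lambda>p q. p < q \<longrightarrow> analytic_reparam \<Gamma> p q"])
    fix p q r :: real
    assume *: "p < q \<longrightarrow> analytic_reparam \<Gamma> p q" "q < r \<longrightarrow> analytic_reparam \<Gamma> q r" "p \<le> q" "q \<le> r"
    show "p < r \<longrightarrow> analytic_reparam \<Gamma> p r"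
    proof (cases "p < q \<and> q < r")
      case True
      then show ?thesis using analytic_reparam_trans[of \<Gamma> p q r] * by blast
    next
      case False
      then have "p = q \<or> q = r" using * by linarith
      then show ?thesis using * by blast
    qed
  qed (use local in simp_all)
  then have "analytic_reparam \<Gamma> (- pi) pi" by simp
  then have "piecewise_analytic_Jordan_curve (\<Gamma> ` {- pi..pi})"
  proof (rule Jordan_curve_of_analytic_reparam[OF _ cont])
    have "cis (- pi) = cis pi" by (simp add: complex_eq_iff)
    then show "\<Gamma> (- pi) = \<Gamma> pi" by (simp add: \<Gamma>_def)
    fix x y assume xy: "x \<in> {- pi..pi}" "y \<in> {- pi..pi}" "\<Gamma> x = \<Gamma> y" "x < y"
    have "cis x = cis y" using \<Gamma>(2)[of x] \<Gamma>(2)[of y] xy(3) by simp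
    then obtain n :: int where n: "x = y + 2 * pi * n"
      unfolding cis_conv_exp exp_eq by (auto simp: complex_eq_iff)
    have "pi * (- 1) \<le> pi * real_of_int n" "pi * real_of_int n < pi * 0" using n xy by auto
    then have "- 1 \<le> real_of_int n" "real_of_int n < 0" by (simp_all only: mult_less_cancel_left_pos mult_le_cancel_left_pos pi_gt_zero)
    then have "n = - 1" by linarith
    then show "x = - pi \<and> y = pi" using n xy by auto
  qed
  moreover have "cis ` {- pi..pi} = sphere 0 1"
  proof (intro equalityI subsetI)
    fix z :: complex assume "z \<in> sphere 0 1"
    then have "z = cis (Arg z)" using rcis_cmod_Arg[of z] by (simp add: rcis_def)
    moreover have "Arg z \<in> {- pi..pi}" using Arg_bounded[of z] by auto
    ultimately show "z \<in> cis ` {- pi..pi}" by blast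
  qed auto
  ultimately show ?thesis by (simp add: \<Gamma>_def image_image[symmetric, of _ cis])
qed

lemma real_analytic2_at_cong:
  assumes "real_analytic2_at f a b" "0 < r" "\<And>s y. \<bar>s - a\<bar> < r \<Longrightarrow> \<bar>y - b\<bar> < r \<Longrightarrow> f s y = g s y"
  shows "real_analytic2_at g a b"
proof -
  obtain c r' where "0 < r'" and c: "\<And>s y. \<bar>s - a\<bar> < r' \<Longrightarrow> \<bar>y - b\<bar> < r' \<Longrightarrow>
      ((\<lambda>(m, n). c m n * (s - a) ^ m * (y - b) ^ n) has_sum f s y) UNIV"
    using assms(1) unfolding real_analytic2_at_def by blast
  show ?thesis
    unfolding real_analytic2_at_def
  proof (intro exI[of _ c] exI[of _ "min r r'"] conjI allI impI)
    fix s y assume sy: "\<bar>s - a\<bar> < min r r'" "\<bar>y - b\<bar> < min r r'"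
    then have "f s y = g s y" by (intro assms(3)) auto
    then show "((\<lambda>(m, n). c m n * (s - a) ^ m * (y - b) ^ n) has_sum g s y) UNIV"
      using c[of s y] sy by simp
  qed (use assms(2) \<open>0 < r'\<close> in auto)
qed

lemma neighbourhood_of_less:
  fixes \<phi> :: "real \<Rightarrow> real"
  assumes "isCont \<phi> t0" "\<bar>x0 - p\<bar> < \<phi> t0" "open S" "t0 \<in> S"
  obtains r where "0 < r" "\<And>s y. \<bar>s - t0\<bar> < r \<Longrightarrow> \<bar>y - x0\<bar> < r \<Longrightarrow> s \<in> S \<and> \<bar>y - p\<bar> < \<phi> s"
proof -
  define e where "e = (\<phi> t0 - \<bar>x0 - p\<bar>) / 2"
  have e: "0 < e" using assms(2) by (simp add: e_def field_simps)
  obtain d where d: "0 < d" "\<And>s. \<bar>s - t0\<bar> < d \<Longrightarrow> \<bar>\<phi> s - \<phi> t0\<bar> < e"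
    using assms(1) e unfolding continuous_at_eps_delta by (auto simp: dist_real_def)
  obtain d' where d': "0 < d'" "ball t0 d' \<subseteq> S" using assms(3,4) open_contains_ball by blast
  show thesis
  proof (rule that[of "min e (min d d')"])
    fix s y assume sy: "\<bar>s - t0\<bar> < min e (min d d')" "\<bar>y - x0\<bar> < min e (min d d')"
    have "s \<in> S" using sy d'(2) by (auto simp: dist_real_def subset_iff abs_minus_commute)
    moreover have "\<bar>y - p\<bar> < \<phi> s"
    proof -
      have "\<phi> t0 = \<bar>x0 - p\<bar> + 2 * e" by (simp add: e_def field_simps)
      moreover have "\<bar>\<phi> s - \<phi> t0\<bar> < e" "\<bar>y - x0\<bar> < e" using d(2)[of s] sy by simp_all
      ultimately show ?thesis by linarith
    qed
    ultimately show "s \<in> S \<and> \<bar>y - p\<bar> < \<phi> s" by simp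
  qed (use e d d' in auto)
qed

section \<open>The density\<close>

context
  fixes \<alpha> :: real
  assumes \<alpha>: "0 < \<alpha>" "\<alpha> \<le> 1 / 2"
begin

lemma angle_bounds: "0 < pi * \<alpha>" "pi * \<alpha> \<le> pi / 2" "pi * \<alpha> < pi" "sin (pi * \<alpha>) \<noteq> 0"
proof -
  show 1: "0 < pi * \<alpha>" "pi * \<alpha> \<le> pi / 2" using \<alpha> by auto
  then show 2: "pi * \<alpha> < pi" using pi_gt_zero by linarith
  show "sin (pi * \<alpha>) \<noteq> 0" using sin_gt_zero[OF 1(1) 2] by simp
qed

abbreviation (input) W :: "real \<Rightarrow> complex \<Rightarrow> complex" where
  "W t z \<equiv> inv_flow (pi * \<alpha>) (2 * pi\<^sup>2 * t) z"

lemma V_eq: "V \<alpha> t = {u \<in> ball 0 1. flow (pi * \<alpha>) (2 * pi\<^sup>2 * t) u \<in> ball 0 1}"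
  unfolding V_def using \<Phi>_eq[of \<alpha>] \<alpha> by auto

text \<open>Any preimage in the open disk belongs to the region, where the flow map is injective.\<close>

lemma w_eq:
  assumes t: "0 < t" and z: "cmod z < 1"
  shows "w \<alpha> t z = W t z"
  unfolding w_def
proof (rule the_equality)
  have T: "0 < 2 * pi\<^sup>2 * t" using t by simp
  note iv = inv_flow[OF T angle_bounds(4) less_imp_le[OF z]]
  note ball = inv_flow_in_ball[OF T angle_bounds(4) z]
  show "W t z \<in> ball 0 1 \<and> \<Phi> \<alpha> t (W t z) = z"
    using ball iv(2) \<Phi>_eq[of \<alpha>] \<alpha> by simp
  fix u assume u: "u \<in> ball 0 1 \<and> \<Phi> \<alpha> t u = z"
  then have flow: "flow (pi * \<alpha>) (2 * pi\<^sup>2 * t) u = z" using \<Phi>_eq[of \<alpha> u t] \<alpha> by simp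
  have "u \<in> region (pi * \<alpha>) (2 * pi\<^sup>2 * t)"
    using u z flow region_iff_norm_flow[of u "pi * \<alpha>" "2 * pi\<^sup>2 * t"] zero_in_region by (cases "u = 0") auto
  then show "u = W t z"
    using inv_flow_unique[OF T angle_bounds(4) _ flow] by simp
qed

lemma w_ext_eq:
  assumes t: "0 < t" and z: "cmod z \<le> 1"
  shows "w_ext \<alpha> t z = W t z"
  unfolding w_ext_def
  by (rule disk_ext_eq[OF continuous_on_inv_flow_snd]) (use t z angle_bounds w_eq in auto)

lemma f_density_eq:
  assumes t: "0 < t"
  shows "f_density \<alpha> t x = arc_density (pi * \<alpha>) (W t (cis x))"
proof -
  have T: "0 < 2 * pi\<^sup>2 * t" using t by simp
  define v where "v = W t (cis x)"
  have v: "v \<in> region (pi * \<alpha>) (2 * pi\<^sup>2 * t)" using inv_flow(1)[OF T angle_bounds(4), of "cis x"] by (simp add: v_def)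
  have "w_ext \<alpha> t (exp (\<i> * complex_of_real x)) = v"
    using w_ext_eq[OF t, of "cis x"] by (simp add: v_def cis_conv_exp)
  moreover have "g0 \<alpha> v = log_ratio (pi * \<alpha>) v"
    using g0_eq[of \<alpha> v] \<alpha> region_nonpole[OF T angle_bounds(4) v] v by (simp add: region_def)
  ultimately show ?thesis unfolding f_density_def arc_density_def by (simp add: v_def)
qed

lemma curve_properties:
  assumes t: "0 < t"
  shows "continuous_on (cball 0 1) (w_ext \<alpha> t)" "\<forall>z\<in>ball 0 1. w_ext \<alpha> t z = w \<alpha> t z"
    "w_ext \<alpha> t ` sphere 0 1 = frontier (V \<alpha> t)" "piecewise_analytic_Jordan_curve (frontier (V \<alpha> t))"
    "frontier (V \<alpha> t) \<subseteq> cball 0 1 - {\<omega> \<alpha>, cnj (\<omega> \<alpha>)}"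
proof -
  have T: "0 < 2 * pi\<^sup>2 * t" using t by simp
  show "continuous_on (cball 0 1) (w_ext \<alpha> t)"
    using continuous_on_inv_flow_snd[OF T angle_bounds(4)]
    by (rule continuous_on_eq) (use w_ext_eq[OF t] in auto)
  show "\<forall>z\<in>ball 0 1. w_ext \<alpha> t z = w \<alpha> t z" using w_eq[OF t] w_ext_eq[OF t] by auto
  have fr: "frontier (V \<alpha> t) = W t ` sphere 0 1"
    unfolding V_eq by (rule frontier_flow_preimage_ball[OF T angle_bounds(4)])
  show "w_ext \<alpha> t ` sphere 0 1 = frontier (V \<alpha> t)"
    unfolding fr by (rule image_cong) (use w_ext_eq[OF t] in auto)
  show "piecewise_analytic_Jordan_curve (frontier (V \<alpha> t))"
    unfolding fr by (rule Jordan_curve_inv_flow[OF T angle_bounds(4)])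
  have "\<omega> \<alpha> = cis (pi * \<alpha>)" by (simp add: \<omega>_def cis_conv_exp)
  then have poles: "{\<omega> \<alpha>, cnj (\<omega> \<alpha>)} = poles (pi * \<alpha>)" by (simp add: cis_cnj)
  have "v \<in> cball 0 1 - poles (pi * \<alpha>)"
    if "v \<in> region (pi * \<alpha>) (2 * pi\<^sup>2 * t)" for v
    using region_nonpole[OF T angle_bounds(4) that] that by (simp add: region_def)
  then show "frontier (V \<alpha> t) \<subseteq> cball 0 1 - {\<omega> \<alpha>, cnj (\<omega> \<alpha>)}"
    unfolding fr poles using inv_flow(1)[OF T angle_bounds(4)] by auto
qed

lemma continuous_on_f_density: "continuous_on ({0<..} \<times> UNIV) (\<lambda>(t, x). f_density \<alpha> t x)"
proof -
  define h where "h = (\<lambda>p :: real \<times> real. W (fst p) (cis (snd p)))"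
  have "continuous_on ({0<..} \<times> UNIV) (\<lambda>p. (\<lambda>(T, z). inv_flow (pi * \<alpha>) T z) (2 * pi\<^sup>2 * fst p, cis (snd p)))"
    by (rule continuous_on_compose2[OF continuous_on_inv_flow[OF angle_bounds(4)]]) (auto intro!: continuous_intros)
  then have ch: "continuous_on ({0<..} \<times> UNIV) h" by (simp add: h_def)
  have sub: "h ` ({0<..} \<times> UNIV) \<subseteq> cball 0 1 - poles (pi * \<alpha>)"
  proof
    fix v assume "v \<in> h ` ({0<..} \<times> UNIV)"
    then obtain t x where tx: "0 < t" "v = W t (cis x)" by (auto simp: h_def)
    then have T: "0 < 2 * pi\<^sup>2 * t" by simp
    have "v \<in> region (pi * \<alpha>) (2 * pi\<^sup>2 * t)" using inv_flow(1)[OF T angle_bounds(4), of "cis x"] tx by simp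
    then show "v \<in> cball 0 1 - poles (pi * \<alpha>)"
      using region_nonpole[OF T angle_bounds(4)] by (auto simp: region_def)
  qed
  have "continuous_on ({0<..} \<times> UNIV) (\<lambda>p. log_ratio (pi * \<alpha>) (h p))"
    by (rule continuous_on_compose2[OF continuous_on_log_ratio ch sub]) (use angle_bounds in auto)
  then have "continuous_on ({0<..} \<times> UNIV) (\<lambda>p. arc_density (pi * \<alpha>) (h p))"
    unfolding arc_density_def by (intro continuous_intros) auto
  then show ?thesis by (rule continuous_on_eq) (auto simp: f_density_eq h_def)
qed

lemma f_density_analytic_inside:
  assumes t: "0 < t" and inside: "cmod (W t (cis x)) < 1"
  shows "real_analytic2_at (f_density \<alpha>) t x"
proof -
  define g where "g = (\<lambda>z. (1 + 2 * log_ratio (pi * \<alpha>) z) / (2 * of_real pi))"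
  have "g holomorphic_on ball 0 1"
    unfolding g_def using angle_bounds by (intro holomorphic_intros holomorphic_on_log_ratio) auto
  then have "real_analytic2_at (\<lambda>t x. Re (g (W t (cis x)))) t x"
    using t inside angle_bounds(4) by (intro real_analytic2_at_inv_flow) auto
  then show ?thesis
  proof (rule real_analytic2_at_cong[OF _ t])
    fix s y assume "\<bar>s - t\<bar> < t"
    then have "0 < s" by linarith
    have "Re (g z) = arc_density (pi * \<alpha>) z" for z
    proof -
      have "g z = (1 + 2 * log_ratio (pi * \<alpha>) z) / of_real (2 * pi)" by (simp add: g_def)
      then show ?thesis unfolding arc_density_def by (simp only: Re_divide_of_real) simp
    qed
    then show "Re (g (W s (cis y))) = f_density \<alpha> s y"
      using f_density_eq[OF \<open>0 < s\<close>] by simp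
  qed
qed

text \<open>This is \<open>\<phi>\<^sub>1\<close>; the trivial constants bring it into the form of \<open>smooth_on_corner_angle\<close>.\<close>

definition inner_angle :: "real \<Rightarrow> real" where
  "inner_angle t = 0 + 1 * corner_angle (pi * \<alpha>) (2 * pi\<^sup>2 * t)"

text \<open>This is \<open>\<phi>\<^sub>2\<close>, obtained from the angle of the reflected arc.\<close>

definition outer_angle :: "real \<Rightarrow> real" where
  "outer_angle t = pi + (- 1) * corner_angle (pi - pi * \<alpha>) (2 * pi\<^sup>2 * t)"

lemma t_low_eq: "t_low \<alpha> = (1 - cos (pi * \<alpha>)) / (2 * pi\<^sup>2)" "2 * pi\<^sup>2 * t_low \<alpha> = 1 - cos (pi * \<alpha>)"
  by (simp_all add: t_low_def)

lemma t_up_eq: "t_up \<alpha> = (1 - cos (pi - pi * \<alpha>)) / (2 * pi\<^sup>2)" "2 * pi\<^sup>2 * t_up \<alpha> = 1 - cos (pi - pi * \<alpha>)"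
  by (simp_all add: t_up_def)

lemma time_iff:
  "2 * pi\<^sup>2 * t \<le> 1 - cos (pi * \<alpha>) \<longleftrightarrow> t \<le> t_low \<alpha>" "2 * pi\<^sup>2 * t < 1 - cos (pi * \<alpha>) \<longleftrightarrow> t < t_low \<alpha>"
  "2 * pi\<^sup>2 * t \<le> 1 - cos (pi - pi * \<alpha>) \<longleftrightarrow> t \<le> t_up \<alpha>" "2 * pi\<^sup>2 * t < 1 - cos (pi - pi * \<alpha>) \<longleftrightarrow> t < t_up \<alpha>"
  unfolding t_low_eq(2)[symmetric] t_up_eq(2)[symmetric] by simp_all

lemma co_angle_bounds: "0 < pi - pi * \<alpha>" "pi - pi * \<alpha> < pi" using angle_bounds by auto

lemma t_low_t_up: "0 < t_low \<alpha>" "t_low \<alpha> \<le> t_up \<alpha>" "\<alpha> \<noteq> 1 / 2 \<Longrightarrow> t_low \<alpha> < t_up \<alpha>" "\<alpha> = 1 / 2 \<Longrightarrow> t_low \<alpha> = t_up \<alpha>"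
proof -
  show "0 < t_low \<alpha>" using cos_a_bounds(2)[OF angle_bounds(1,3)] by (simp add: t_low_def)
  have "0 \<le> cos (pi * \<alpha>)" using angle_bounds(1,2) pi_gt_zero by (intro cos_ge_zero) linarith+
  then show "t_low \<alpha> \<le> t_up \<alpha>" by (simp add: t_low_def t_up_def divide_right_mono)
  show "t_low \<alpha> < t_up \<alpha>" if "\<alpha> \<noteq> 1 / 2"
  proof -
    have "pi * \<alpha> < pi * (1 / 2)" using \<alpha> that by (intro mult_strict_left_mono) auto
    then have "0 < cos (pi * \<alpha>)" using angle_bounds(1) by (intro cos_gt_zero) linarith+
    then show ?thesis by (simp add: t_low_def t_up_def divide_strict_right_mono)
  qed
  show "t_low \<alpha> = t_up \<alpha>" if "\<alpha> = 1 / 2"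
  proof -
    have "pi * \<alpha> = pi / 2" using that by simp
    then have "cos (pi * \<alpha>) = 0" by (simp only: cos_pi_half)
    then show ?thesis by (simp add: t_low_def t_up_def)
  qed
qed

lemma corner_angle_time_limits:
  assumes a: "0 < a" "a < pi" and T: "2 * pi\<^sup>2 * t1 = 1 - cos a"
  shows "((\<lambda>t. corner_angle a (2 * pi\<^sup>2 * t)) \<longlongrightarrow> a) (at_right 0)"
    "((\<lambda>t. corner_angle a (2 * pi\<^sup>2 * t)) \<longlongrightarrow> 0) (at_left t1)"
proof -
  have t1: "0 < t1"
    using T cos_a_bounds(2)[OF a] by (metis diff_gt_0_iff_gt zero_less_mult_pos zero_less_power pi_gt_zero zero_less_mult_iff zero_less_numeral)
  have mem: "2 * pi\<^sup>2 * t \<in> {0..1 - cos a}" if "t \<in> {0..t1}" for t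
    using that unfolding T[symmetric] by (auto intro!: mult_left_mono)
  have cont: "continuous_on {0..t1} (\<lambda>t. corner_angle a (2 * pi\<^sup>2 * t))"
  proof (rule continuous_on_compose2[OF continuous_on_corner_angle[OF a]])
    show "(\<lambda>t. 2 * pi\<^sup>2 * t) ` {0..t1} \<subseteq> {0..1 - cos a}" using mem by blast
  qed (intro continuous_intros)
  from continuous_on_Icc_at_rightD[OF cont t1] show "((\<lambda>t. corner_angle a (2 * pi\<^sup>2 * t)) \<longlongrightarrow> a) (at_right 0)"
    by (simp add: corner_angle_0[OF a])
  from continuous_on_Icc_at_leftD[OF cont t1] show "((\<lambda>t. corner_angle a (2 * pi\<^sup>2 * t)) \<longlongrightarrow> 0) (at_left t1)"
    by (simp add: T corner_angle_end[OF a])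
qed

lemma inner_angle_properties:
  "smooth_on inner_angle {0<..<t_low \<alpha>}" "inner_angle ` {0<..<t_low \<alpha>} \<subseteq> {0<..<pi * \<alpha>}"
  "strict_antimono_on {0<..<t_low \<alpha>} inner_angle"
  "(inner_angle \<longlongrightarrow> pi * \<alpha>) (at_right 0)" "(inner_angle \<longlongrightarrow> 0) (at_left (t_low \<alpha>))" "inner_angle (t_low \<alpha>) = 0"
proof -
  note a = angle_bounds(1,3)
  show "smooth_on inner_angle {0<..<t_low \<alpha>}"
    unfolding inner_angle_def [abs_def] t_low_eq(1) by (rule smooth_on_corner_angle[OF a]) simp
  show "inner_angle ` {0<..<t_low \<alpha>} \<subseteq> {0<..<pi * \<alpha>}"
    using corner_angle_bounds[OF a] by (auto simp: inner_angle_def time_iff)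
  show "strict_antimono_on {0<..<t_low \<alpha>} inner_angle"
    unfolding monotone_on_def inner_angle_def
    using corner_angle_strict_antimono[OF a] by (auto simp: time_iff)
  show "inner_angle (t_low \<alpha>) = 0" unfolding inner_angle_def t_low_eq(2) by (simp add: corner_angle_end[OF a])
  show "(inner_angle \<longlongrightarrow> pi * \<alpha>) (at_right 0)" "(inner_angle \<longlongrightarrow> 0) (at_left (t_low \<alpha>))"
    using corner_angle_time_limits[OF a t_low_eq(2)] by (simp_all add: inner_angle_def [abs_def])
qed

lemma outer_angle_properties:
  "smooth_on outer_angle {0<..<t_up \<alpha>}" "outer_angle ` {0<..<t_up \<alpha>} \<subseteq> {pi * \<alpha><..<pi}"
  "strict_mono_on {0<..<t_up \<alpha>} outer_angle"
  "(outer_angle \<longlongrightarrow> pi * \<alpha>) (at_right 0)" "(outer_angle \<longlongrightarrow> pi) (at_left (t_up \<alpha>))" "outer_angle (t_up \<alpha>) = pi"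
proof -
  note a = co_angle_bounds
  show "smooth_on outer_angle {0<..<t_up \<alpha>}"
    unfolding outer_angle_def [abs_def] t_up_eq(1) by (rule smooth_on_corner_angle[OF a]) simp
  show "outer_angle ` {0<..<t_up \<alpha>} \<subseteq> {pi * \<alpha><..<pi}"
  proof (intro image_subsetI)
    fix t assume "t \<in> {0<..<t_up \<alpha>}"
    then show "outer_angle t \<in> {pi * \<alpha><..<pi}"
      using corner_angle_bounds[OF a, of "2 * pi\<^sup>2 * t"] unfolding time_iff by (simp add: outer_angle_def)
  qed
  show "strict_mono_on {0<..<t_up \<alpha>} outer_angle"
  proof (rule strict_mono_onI)
    fix s t assume "s \<in> {0<..<t_up \<alpha>}" "t \<in> {0<..<t_up \<alpha>}" "s < t"
    then show "outer_angle s < outer_angle t"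
      using corner_angle_strict_antimono[OF a, of "2 * pi\<^sup>2 * s" "2 * pi\<^sup>2 * t"] unfolding time_iff
      by (simp add: outer_angle_def)
  qed
  show "outer_angle (t_up \<alpha>) = pi" unfolding outer_angle_def t_up_eq(2) using corner_angle_end[OF a] by simp
  note lims = corner_angle_time_limits[OF a t_up_eq(2)]
  have "((\<lambda>t. pi + (- 1) * corner_angle (pi - pi * \<alpha>) (2 * pi\<^sup>2 * t)) \<longlongrightarrow> pi + (- 1) * (pi - pi * \<alpha>)) (at_right 0)"
    by (intro tendsto_intros lims)
  then show "(outer_angle \<longlongrightarrow> pi * \<alpha>) (at_right 0)" by (simp add: outer_angle_def [abs_def])
  have "((\<lambda>t. pi + (- 1) * corner_angle (pi - pi * \<alpha>) (2 * pi\<^sup>2 * t)) \<longlongrightarrow> pi + (- 1) * 0) (at_left (t_up \<alpha>))"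
    by (intro tendsto_intros lims)
  then show "(outer_angle \<longlongrightarrow> pi) (at_left (t_up \<alpha>))" by (simp add: outer_angle_def [abs_def])
qed

lemma f_density_plateau:
  assumes "0 < t" "t \<le> t_low \<alpha>" "\<bar>x\<bar> \<le> inner_angle t"
  shows "f_density \<alpha> t x = 1 / (2 * pi * \<alpha>)"
proof -
  have T: "0 < 2 * pi\<^sup>2 * t" "2 * pi\<^sup>2 * t \<le> 1 - cos (pi * \<alpha>)" using assms by (simp_all add: time_iff)
  have "\<bar>x\<bar> \<le> corner_angle (pi * \<alpha>) (2 * pi\<^sup>2 * t)" using assms(3) by (simp add: inner_angle_def)
  from inv_flow_circle[OF angle_bounds(1,3) T this] show ?thesis
    using f_density_eq[OF assms(1)] density_values(3)[OF angle_bounds(1,2)] by (simp add: mult.assoc)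
qed

lemma f_density_vacuum:
  assumes "0 < t" "t \<le> t_up \<alpha>" "\<bar>x - pi\<bar> \<le> pi - outer_angle t \<or> \<bar>x + pi\<bar> \<le> pi - outer_angle t"
  shows "f_density \<alpha> t x = 0"
proof -
  have T: "0 < 2 * pi\<^sup>2 * t" "2 * pi\<^sup>2 * t \<le> 1 + cos (pi * \<alpha>)" using assms time_iff(3)[of t] by simp_all
  have "\<bar>x - pi\<bar> \<le> corner_angle (pi - pi * \<alpha>) (2 * pi\<^sup>2 * t) \<or> \<bar>x + pi\<bar> \<le> corner_angle (pi - pi * \<alpha>) (2 * pi\<^sup>2 * t)"
    using assms(3) by (simp add: outer_angle_def)
  from inv_flow_lower_circle(1)[OF angle_bounds(1,3) T(1,2) this] show ?thesis
    using f_density_eq[OF assms(1)] density_values(4)[OF angle_bounds(1,2)] by simp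
qed

text \<open>If the boundary point were on the circle, it would be on one of the two arcs, and \<open>x\<close> would be in the
corresponding range of angles. So it is in the open disk, where the density is strictly between its
extreme values and analytic.\<close>

lemma f_density_mixed:
  assumes t: "0 < t" and x: "\<bar>x\<bar> \<le> pi"
    and "t \<le> t_low \<alpha> \<Longrightarrow> inner_angle t < \<bar>x\<bar>" and "t \<le> t_up \<alpha> \<Longrightarrow> \<bar>x\<bar> < outer_angle t"
  shows "0 < f_density \<alpha> t x" "f_density \<alpha> t x < 1 / (2 * pi * \<alpha>)" "real_analytic2_at (f_density \<alpha>) t x"
proof -
  define v where "v = W t (cis x)"
  have T: "0 < 2 * pi\<^sup>2 * t" using t by simp
  have inside: "cmod v < 1"
  proof (rule inv_flow_trichotomy[OF T angle_bounds(4), of "cis x", folded v_def])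
    assume v: "cmod v = 1" "cos (pi * \<alpha>) < Re v"
    have "t \<le> t_low \<alpha>" "\<bar>x\<bar> \<le> inner_angle t"
      using inv_flow_circle_converse[OF angle_bounds(1,3) T, of x] v x
      by (simp_all add: inner_angle_def time_iff flip: v_def)
    then show ?thesis using assms(3) by simp
  next
    assume v: "cmod v = 1" "Re v < cos (pi * \<alpha>)"
    have "2 * pi\<^sup>2 * t \<le> 1 + cos (pi * \<alpha>)" "outer_angle t \<le> \<bar>x\<bar>"
      using inv_flow_lower_circle(2,3)[OF angle_bounds(1,3) T, of x] v x
      by (simp_all add: outer_angle_def flip: v_def)
    then show ?thesis using assms(4) time_iff(3)[of t] by simp
  qed simp_all
  show "0 < f_density \<alpha> t x" "f_density \<alpha> t x < 1 / (2 * pi * \<alpha>)"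
    using density_values(1,2)[OF angle_bounds(1,2) inside] f_density_eq[OF t] by (simp_all add: v_def mult.assoc)
  show "real_analytic2_at (f_density \<alpha>) t x"
    using f_density_analytic_inside[OF t] inside by (simp add: v_def)
qed

lemma isCont_corner_angle_time:
  assumes a: "0 < a" "a < pi" and T: "0 < t" "2 * pi\<^sup>2 * t < 1 - cos a"
  shows "isCont (\<lambda>t. corner_angle a (2 * pi\<^sup>2 * t)) t"
proof -
  have "isCont (corner_angle a) (2 * pi\<^sup>2 * t)"
    using corner_angle_derivative[OF a _ T(2)] T(1) DERIV_isCont by simp
  moreover have "isCont (\<lambda>t. 2 * pi\<^sup>2 * t) t" by (intro continuous_intros)
  ultimately show ?thesis by (rule isCont_o2[rotated])
qed

lemma f_density_analytic_plateau:
  assumes t: "0 < t" "t \<le> t_low \<alpha>" and x: "\<bar>x\<bar> < inner_angle t"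
  shows "real_analytic2_at (f_density \<alpha>) t x"
proof -
  have "t < t_low \<alpha>" using t x inner_angle_properties(6) by (cases "t = t_low \<alpha>") auto
  then have c: "isCont inner_angle t"
    using isCont_corner_angle_time[OF angle_bounds(1,3) t(1)] by (simp add: inner_angle_def [abs_def] time_iff)
  obtain r where r: "0 < r" "\<And>s y. \<bar>s - t\<bar> < r \<Longrightarrow> \<bar>y - x\<bar> < r \<Longrightarrow> s \<in> {0<..<t_low \<alpha>} \<and> \<bar>y - 0\<bar> < inner_angle s"
    using neighbourhood_of_less[OF c, of x 0 "{0<..<t_low \<alpha>}"] x t(1) \<open>t < t_low \<alpha>\<close> by auto
  show ?thesis
  proof (rule real_analytic2_at_const[OF r(1)])
    fix s y assume "\<bar>s - t\<bar> < r" "\<bar>y - x\<bar> < r"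
    then have "s \<in> {0<..<t_low \<alpha>} \<and> \<bar>y - 0\<bar> < inner_angle s" by (rule r(2))
    then show "f_density \<alpha> s y = 1 / (2 * pi * \<alpha>)" by (intro f_density_plateau) auto
  qed
qed

text \<open>The density vanishes on a neighbourhood, which for \<open>|x| = \<pi>\<close> extends beyond \<open>[-\<pi>, \<pi>]\<close>; this is why
\<open>f_density_vacuum\<close> measures distances to \<open>\<plusminus>\<pi>\<close>.\<close>

lemma f_density_analytic_vacuum:
  assumes t: "0 < t" "t \<le> t_up \<alpha>" and x: "outer_angle t < \<bar>x\<bar>" "\<bar>x\<bar> \<le> pi"
  shows "real_analytic2_at (f_density \<alpha>) t x"
proof -
  have "t < t_up \<alpha>" using t x outer_angle_properties(6) by (cases "t = t_up \<alpha>") auto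
  then have c: "isCont (\<lambda>t. corner_angle (pi - pi * \<alpha>) (2 * pi\<^sup>2 * t)) t"
    using isCont_corner_angle_time[OF co_angle_bounds t(1)] time_iff(4)[of t] by blast
  define p where "p = (if 0 \<le> x then pi else - pi)"
  have "\<bar>x - p\<bar> < corner_angle (pi - pi * \<alpha>) (2 * pi\<^sup>2 * t)" using x by (auto simp: p_def outer_angle_def)
  then obtain r where r: "0 < r" "\<And>s y. \<bar>s - t\<bar> < r \<Longrightarrow> \<bar>y - x\<bar> < r \<Longrightarrow>
      s \<in> {0<..<t_up \<alpha>} \<and> \<bar>y - p\<bar> < corner_angle (pi - pi * \<alpha>) (2 * pi\<^sup>2 * s)"
    using neighbourhood_of_less[OF c, of x p "{0<..<t_up \<alpha>}"] t(1) \<open>t < t_up \<alpha>\<close> by auto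
  show ?thesis
  proof (rule real_analytic2_at_const[OF r(1)])
    fix s y assume "\<bar>s - t\<bar> < r" "\<bar>y - x\<bar> < r"
    then have s: "s \<in> {0<..<t_up \<alpha>} \<and> \<bar>y - p\<bar> < corner_angle (pi - pi * \<alpha>) (2 * pi\<^sup>2 * s)" by (rule r(2))
    then have "\<bar>y - pi\<bar> \<le> pi - outer_angle s \<or> \<bar>y + pi\<bar> \<le> pi - outer_angle s"
      by (auto simp: p_def outer_angle_def split: if_splits)
    then show "f_density \<alpha> s y = 0" using s by (intro f_density_vacuum) auto
  qed
qed

lemma f_density_vacuum_abs:
  assumes "0 < t" "t \<le> t_up \<alpha>" "\<bar>x\<bar> \<le> pi" "\<not> \<bar>x\<bar> < outer_angle t"
  shows "f_density \<alpha> t x = 0"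
  using assms by (intro f_density_vacuum) (auto simp: abs_if split: if_splits)

end

lemma abs_in_symmetric_interval:
  fixes x c :: real
  shows "x \<in> {- c..c} \<longleftrightarrow> \<bar>x\<bar> \<le> c" "x \<in> {- c<..<c} \<longleftrightarrow> \<bar>x\<bar> < c"
  by auto

theorem theorem4p3:
  fixes \<alpha> :: real
  assumes "0 < \<alpha>" and "\<alpha> \<le> 1 / 2"
  shows
    "(\<forall>t>0.
        continuous_on (cball 0 1) (w_ext \<alpha> t) \<and>
        (\<forall>z\<in>ball 0 1. w_ext \<alpha> t z = w \<alpha> t z) \<and>
        w_ext \<alpha> t ` sphere 0 1 = frontier (V \<alpha> t) \<and>
        piecewise_analytic_Jordan_curve (frontier (V \<alpha> t)) \<and>
        frontier (V \<alpha> t) \<subseteq> cball 0 1 - {\<omega> \<alpha>, cnj (\<omega> \<alpha>)}) \<and>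
     continuous_on ({0<..} \<times> UNIV) (\<lambda>(t, x). f_density \<alpha> t x) \<and>
     0 < t_low \<alpha> \<and> t_low \<alpha> \<le> t_up \<alpha> \<and>
     (\<alpha> \<noteq> 1 / 2 \<longrightarrow> t_low \<alpha> < t_up \<alpha>) \<and> (\<alpha> = 1 / 2 \<longrightarrow> t_low \<alpha> = t_up \<alpha>) \<and>
     (\<exists>\<phi>1 \<phi>2 :: real \<Rightarrow> real.
        smooth_on \<phi>1 {0<..<t_low \<alpha>} \<and> \<phi>1 ` {0<..<t_low \<alpha>} \<subseteq> {0<..<pi * \<alpha>} \<and>
        strict_antimono_on {0<..<t_low \<alpha>} \<phi>1 \<and>
        (\<phi>1 \<longlongrightarrow> pi * \<alpha>) (at_right 0) \<and> (\<phi>1 \<longlongrightarrow> 0) (at_left (t_low \<alpha>)) \<and> \<phi>1 (t_low \<alpha>) = 0 \<and>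
        smooth_on \<phi>2 {0<..<t_up \<alpha>} \<and> \<phi>2 ` {0<..<t_up \<alpha>} \<subseteq> {pi * \<alpha><..<pi} \<and>
        strict_mono_on {0<..<t_up \<alpha>} \<phi>2 \<and>
        (\<phi>2 \<longlongrightarrow> pi * \<alpha>) (at_right 0) \<and> (\<phi>2 \<longlongrightarrow> pi) (at_left (t_up \<alpha>)) \<and> \<phi>2 (t_up \<alpha>) = pi \<and>
        (\<forall>t\<in>{0<..t_low \<alpha>}. \<forall>x\<in>{-pi..pi}.
           (x \<in> {- \<phi>1 t..\<phi>1 t} \<longrightarrow> f_density \<alpha> t x = 1 / (2 * pi * \<alpha>)) \<and>
           (x \<notin> {- \<phi>2 t<..<\<phi>2 t} \<longrightarrow> f_density \<alpha> t x = 0) \<and>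
           (x \<notin> {- \<phi>1 t..\<phi>1 t} \<and> x \<in> {- \<phi>2 t<..<\<phi>2 t} \<longrightarrow>
              0 < f_density \<alpha> t x \<and> f_density \<alpha> t x < 1 / (2 * pi * \<alpha>)) \<and>
           (x \<notin> {\<phi>1 t, - \<phi>1 t, \<phi>2 t, - \<phi>2 t} \<longrightarrow> real_analytic2_at (f_density \<alpha>) t x)) \<and>
        (\<forall>t\<in>{t_low \<alpha><..t_up \<alpha>}. \<forall>x\<in>{-pi..pi}.
           (x \<notin> {- \<phi>2 t<..<\<phi>2 t} \<longrightarrow> f_density \<alpha> t x = 0) \<and>
           (x \<in> {- \<phi>2 t<..<\<phi>2 t} \<longrightarrow>
              0 < f_density \<alpha> t x \<and> f_density \<alpha> t x < 1 / (2 * pi * \<alpha>)) \<and>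
           (x \<notin> {\<phi>2 t, - \<phi>2 t} \<longrightarrow> real_analytic2_at (f_density \<alpha>) t x)) \<and>
        (\<forall>t\<in>{t_up \<alpha><..}. \<forall>x\<in>{-pi..pi}.
           0 < f_density \<alpha> t x \<and> f_density \<alpha> t x < 1 / (2 * pi * \<alpha>) \<and>
           real_analytic2_at (f_density \<alpha>) t x))"
proof ((intro conjI allI impI curve_properties[OF assms] continuous_on_f_density[OF assms] t_low_t_up[OF assms];
      (assumption)?),
    rule exI[of _ "inner_angle \<alpha>"], rule exI[of _ "outer_angle \<alpha>"],
    intro conjI inner_angle_properties[OF assms] outer_angle_properties[OF assms], goal_cases)
  \<comment> \<open>The three remaining goals describe the density in the three ranges of time.\<close>
  case 1
  show ?case
    unfolding abs_in_symmetric_interval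
  proof (intro ballI conjI impI)
    fix t x :: real assume t: "t \<in> {0<..t_low \<alpha>}" and "x \<in> {- pi..pi}"
    then have x: "\<bar>x\<bar> \<le> pi" by auto
    have t': "0 < t" "t \<le> t_low \<alpha>" "t \<le> t_up \<alpha>" using t t_low_t_up(2)[OF assms] by auto
    show "f_density \<alpha> t x = 1 / (2 * pi * \<alpha>)" if "\<bar>x\<bar> \<le> inner_angle \<alpha> t"
      using f_density_plateau[OF assms t'(1,2) that] .
    show "f_density \<alpha> t x = 0" if "\<not> \<bar>x\<bar> < outer_angle \<alpha> t" using f_density_vacuum_abs[OF assms t'(1,3) x that] .
    show "0 < f_density \<alpha> t x" "f_density \<alpha> t x < 1 / (2 * pi * \<alpha>)"
      if "\<not> \<bar>x\<bar> \<le> inner_angle \<alpha> t \<and> \<bar>x\<bar> < outer_angle \<alpha> t"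
      using f_density_mixed(1,2)[OF assms t'(1) x] that by auto
    show "real_analytic2_at (f_density \<alpha>) t x" if "x \<notin> {inner_angle \<alpha> t, - inner_angle \<alpha> t, outer_angle \<alpha> t, - outer_angle \<alpha> t}"
    proof -
      have "\<bar>x\<bar> \<noteq> inner_angle \<alpha> t" "\<bar>x\<bar> \<noteq> outer_angle \<alpha> t" using that by auto
      then consider "\<bar>x\<bar> < inner_angle \<alpha> t" | "outer_angle \<alpha> t < \<bar>x\<bar>" | "inner_angle \<alpha> t < \<bar>x\<bar>" "\<bar>x\<bar> < outer_angle \<alpha> t" by linarith
      then show ?thesis
        by cases (use f_density_analytic_plateau[OF assms t'(1,2)] f_density_analytic_vacuum[OF assms t'(1,3)] f_density_mixed(3)[OF assms t'(1)] x in auto)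
    qed
  qed
next
  case 2
  show ?case
    unfolding abs_in_symmetric_interval
  proof (intro ballI conjI impI)
    fix t x :: real assume t: "t \<in> {t_low \<alpha><..t_up \<alpha>}" and "x \<in> {- pi..pi}"
    then have x: "\<bar>x\<bar> \<le> pi" by auto
    have t': "0 < t" "\<not> t \<le> t_low \<alpha>" "t \<le> t_up \<alpha>" using t t_low_t_up(1)[OF assms] by auto
    show "f_density \<alpha> t x = 0" if "\<not> \<bar>x\<bar> < outer_angle \<alpha> t" using f_density_vacuum_abs[OF assms t'(1,3) x that] .
    show "0 < f_density \<alpha> t x" "f_density \<alpha> t x < 1 / (2 * pi * \<alpha>)" if "\<bar>x\<bar> < outer_angle \<alpha> t"
      using f_density_mixed(1,2)[OF assms t'(1) x] that t'(2) by auto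
    show "real_analytic2_at (f_density \<alpha>) t x" if "x \<notin> {outer_angle \<alpha> t, - outer_angle \<alpha> t}"
    proof -
      have "\<bar>x\<bar> \<noteq> outer_angle \<alpha> t" using that by auto
      then consider "outer_angle \<alpha> t < \<bar>x\<bar>" | "\<bar>x\<bar> < outer_angle \<alpha> t" by linarith
      then show ?thesis
        by cases (use f_density_analytic_vacuum[OF assms t'(1,3)] f_density_mixed(3)[OF assms t'(1)] x t'(2) in auto)
    qed
  qed
next
  case 3
  show ?case
    unfolding abs_in_symmetric_interval
  proof (intro ballI conjI)
    fix t x :: real assume t: "t \<in> {t_up \<alpha><..}" and "x \<in> {- pi..pi}"
    then have x: "\<bar>x\<bar> \<le> pi" by auto
    have t': "0 < t" "\<not> t \<le> t_low \<alpha>" "\<not> t \<le> t_up \<alpha>" using t t_low_t_up(1,2)[OF assms] by auto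
    show "0 < f_density \<alpha> t x" "f_density \<alpha> t x < 1 / (2 * pi * \<alpha>)" "real_analytic2_at (f_density \<alpha>) t x"
      using f_density_mixed[OF assms t'(1) x] t' by auto
  qed
qed

end
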